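(* Let $\alpha\in(0,1)$ be fixed. Suppose that $n_1\asymp n_2\asymp n$, that $\log d=O(n^{1/3-\epsilon})$ for some (arbitrary) $0<\epsilon<1/3$, and that $\zeta_{a,ij}>r_a>0$ for $a=1,2$ and all $1\le i<j\le d$, with constants $r_1,r_2$ not depending on $i,j$. (i) Under these conditions, as $n,d\to\infty$, $$\inf_{(\mathbf U_1^\tau,\mathbf U_2^\tau)\in\mathbb U(4)}\mathbb P(\mathrm T_\alpha^{\tau,\mathrm{jack}}=1)\to1,\qquad \inf_{(\mathbf U_1^\tau,\mathbf U_2^\tau)\in\mathbb U(4)}\mathbb P(\mathrm T_\alpha^{\tau,\mathrm{plug}}=1)\to1.$$ (ii) If in addition $\boldsymbol X$ and $\boldsymbol Y$ belong to the meta-elliptical family and there are $\Gamma\subset\{1,\dots,d\}$ with $|\Gamma|=o(d)$ and a constant $\alpha_0>0$ such that for all $\gamma>0$, $\max_{j\notin\Gamma}|\mathrm{supp}_j(\alpha_0)|=o(d^\gamma)$, where $\mathrm{supp}_j(\alpha_0)=\{1\le i\le d:|\tau_{1,ij}|\ge(\log d)^{-1-\alpha_0}\text{ or }|\tau_{2,ij}|\ge(\log d)^{-1-\alpha_0}\}$, then as $n,d\to\infty$, $$\inf_{(\mathbf U_1^\tau,\mathbf U_2^\tau)\in\mathbb V(4)}\mathbb P(\mathrm T_\alpha^{\tau,\mathrm{ps}}=1)\to1.$$ The infima are over distributions of $\boldsymbol X,\boldsymbol Y$ satisfying the respective assumptions and for which $(\mathbf U_1^\tau,\mathbf U_2^\tau)$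 lies in the indicated set.
   Context: Setting. $\boldsymbol X,\boldsymbol Y$ are random vectors in $\mathbb R^d$ with continuous marginal distributions; $\boldsymbol X_k=(X_{k1},\dots,X_{kd})^T$, $k\le n_1$, are i.i.d. copies of $\boldsymbol X$ and $\boldsymbol Y_k$, $k\le n_2$, i.i.d. copies of $\boldsymbol Y$, the two samples being independent; $n:=\max\{n_1,n_2\}$. In asymptotic statements $n_1,n_2,d$ and the laws may vary along the sequence; the constants in the assumptions (and rates in $o(\cdot),O(\cdot)$) are fixed. Kendall's tau: $\widehat\tau_{1,ij}=\frac{2}{n_1(n_1-1)}\sum_{1\le k<\ell\le n_1}\mathrm{sign}(X_{ki}-X_{\ell i})\,\mathrm{sign}(X_{kj}-X_{\ell j})$; $\widehat\tau_{2,ij}$ is the same with $\boldsymbol Y,n_2$. $\tau_{a,ij}=\mathbb E[\widehat\tau_{a,ij}]$, $\mathbf U_a^\tau=(\tau_{a,ij})_{1\le i,j\le d}$. Jackknife: $\widehat\sigma^2(\widehat\tau_{1,ij})=\frac{4(n_1-1)}{n_1(n_1-2)^2}\sum_{\alpha=1}^{n_1}(q_{1\alpha,ij}-\widehat\tau_{1,ij})^2$, $q_{1\alpha,ij}=\frac1{n_1-1}\sum_{\beta\ne\alpha}\mathrm{sign}(X_{\alpha i}-X_{\beta i})\,\mathrm{sign}(X_{\alpha j}-X_{\beta j})$; analogously $\widehat\sigma^2(\widehat\tau_{2,ij})$. Plug-in: $\widehat\sigma^2_{\mathrm{plug}}(\widehat\tau_{a,ij})=\frac{16}{n_a}(\widehat\Pi_{cc}-\widehat\Pi_c^2)$,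 where $\widehat\Pi_c,\widehat\Pi_{cc}$ are the U-statistics estimating $\Pi_c=\mathbb P((U_2-U_1)(V_2-V_1)>0)$ and $\Pi_{cc}=\mathbb P((U_2-U_1)(V_2-V_1)>0,\ (U_3-U_1)(V_3-V_1)>0)$, $(U_k,V_k)$ being the $k$-th observation of the pair of coordinates $(i,j)$ in sample $a$; i.e. averages of the corresponding indicators over all ordered pairs (resp. triples) of distinct sample indices. Meta-elliptical: a continuous random vector $\boldsymbol Z\in\mathbb R^d$ is meta-elliptical if there are strictly increasing univariate functions $f_1,\dots,f_d$ with $(f_1(Z_1),\dots,f_d(Z_d))^T$ equal in law to $\xi\mathbf A\mathbf U$, where $\mathbf A\mathbf A^T=\boldsymbol\Sigma^\ell$ is positive semidefinite with unit diagonal and rank $p$, $\mathbf A\in\mathbb R^{d\times p}$, $\mathbf U$ is uniform on the unit sphere of $\mathbb R^p$, and $\xi\ge0$ is a scalar random variable independent of $\mathbf U$. Pseudo variance (meta-elliptical case): $\widetilde\sigma^2_{a,\mathrm{ps}}$ is the variance of $\sqrt{n_a}\,\widehat\tau_{a,ij}$ computed in the given meta-elliptical model when $\tau_{a,ij}=0$ (equivalently for $n_a$ i.i.d. copies of $\xi(U_1,U_2)$, with $(U_1,U_2)$ the first two coordinates of $\mathbf U$), and $\sigma_{a,\mathrm{ps}}=\lim_{n_a\to\infty}\widetilde\sigma_{a,\mathrm{ps}}$ (limit over sample size for the fixed bivariate law). $M_n^{\tau,\mathrm{jack}}$, $M_n^{\tau,\mathrm{plug}}$, $M_n^{\tau,\mathrm{ps}}$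 are $\max_{1\le i<j\le d}(\widehat\tau_{1,ij}-\widehat\tau_{2,ij})^2/D_{ij}$ with $D_{ij}=\widehat\sigma^2(\widehat\tau_{1,ij})+\widehat\sigma^2(\widehat\tau_{2,ij})$, $D_{ij}=\widehat\sigma^2_{\mathrm{plug}}(\widehat\tau_{1,ij})+\widehat\sigma^2_{\mathrm{plug}}(\widehat\tau_{2,ij})$, $D_{ij}=\sigma^2_{1,\mathrm{ps}}/n_1+\sigma^2_{2,\mathrm{ps}}/n_2$, respectively. For $\star\in\{\mathrm{jack},\mathrm{plug},\mathrm{ps}\}$, $\mathrm T_\alpha^{\tau,\star}=\mathbb 1\{M_n^{\tau,\star}\ge G^-(\alpha)+4\log d-\log(\log d)\}$, $G^-(\alpha)=-\log(8\pi)-2\log(-\log(1-\alpha))$. $g_{ij}(\boldsymbol X_\alpha)=\mathbb E[\mathrm{sign}(X_{\alpha i}-X_{\beta i})\,\mathrm{sign}(X_{\alpha j}-X_{\beta j})\mid\boldsymbol X_\alpha]$ ($\beta\ne\alpha$), similarly for $\boldsymbol Y$; $\zeta_{1,ij}=\mathrm{Var}(g_{ij}(\boldsymbol X_\alpha))$, $\zeta_{2,ij}=\mathrm{Var}(g_{ij}(\boldsymbol Y_\alpha))$. $\mathbb U(C)=\Big\{(\mathbf U_1^\tau,\mathbf U_2^\tau):\max_{i<j}\frac{|\tau_{1,ij}-\tau_{2,ij}|}{\sqrt{4\zeta_{1,ij}/n_1+4\zeta_{2,ij}/n_2}}\ge C\sqrt{\log d}\Big\}$, $\ \mathbb V(C)=\Big\{(\mathbf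 U_1^\tau,\mathbf U_2^\tau):\max_{i<j}\frac{|\tau_{1,ij}-\tau_{2,ij}|}{\sqrt{\sigma^2_{1,\mathrm{ps}}/n_1+\sigma^2_{2,\mathrm{ps}}/n_2}}\ge C\sqrt{\log d}\Big\}$. *)

theory Defs
  imports
    "HOL-Probability.Probability"
    "HOL-Library.Landau_Symbols"
    "Jordan_Normal_Form.DL_Rank"
begin

text \<open>
  The dimension \<open>d\<close> tends to infinity along with the sample sizes, so a vector in
  \<open>\<real>\<^sup>d\<close> is a function \<open>nat \<Rightarrow> real\<close> in the product space over
  \<open>{..<d}\<close> (coordinates are numbered from 0), and the law of a random vector is a
  probability measure on that product space. A sample \<open>x\<close> is indexed as \<open>x k i\<close>:
  coordinate \<open>i\<close> of observation \<open>k\<close>.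
\<close>

abbreviation vec_borel :: "nat \<Rightarrow> (nat \<Rightarrow> real) measure" where
  "vec_borel d \<equiv> PiM {..<d} (\<lambda>_. borel)"

definition is_law :: "nat \<Rightarrow> (nat \<Rightarrow> real) measure \<Rightarrow> bool" where
  "is_law d P \<longleftrightarrow> prob_space P \<and> sets P = sets (vec_borel d)"

definition continuous_marginals :: "nat \<Rightarrow> (nat \<Rightarrow> real) measure \<Rightarrow> bool" where
  "continuous_marginals d P \<longleftrightarrow>
     (\<forall>i<d. continuous_on UNIV (cdf (distr P borel (\<lambda>x. x i))))"

definition iid :: "nat \<Rightarrow> (nat \<Rightarrow> real) measure \<Rightarrow> (nat \<Rightarrow> nat \<Rightarrow> real) measure" where
  "iid n P = PiM {..<n} (\<lambda>_. P)"

definition two_sample ::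
  "nat \<Rightarrow> nat \<Rightarrow> (nat \<Rightarrow> real) measure \<Rightarrow> (nat \<Rightarrow> real) measure \<Rightarrow>
   ((nat \<Rightarrow> nat \<Rightarrow> real) \<times> (nat \<Rightarrow> nat \<Rightarrow> real)) measure" where
  "two_sample n1 n2 P Q = iid n1 P \<Otimes>\<^sub>M iid n2 Q"


subsection \<open>Kendall's tau and its variance estimators\<close>

definition kernel :: "nat \<Rightarrow> nat \<Rightarrow> (nat \<Rightarrow> real) \<Rightarrow> (nat \<Rightarrow> real) \<Rightarrow> real" where
  "kernel i j u v = sgn (u i - v i) * sgn (u j - v j)"

definition tau_hat :: "nat \<Rightarrow> (nat \<Rightarrow> nat \<Rightarrow> real) \<Rightarrow> nat \<Rightarrow> nat \<Rightarrow> real" where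
  "tau_hat n x i j =
     2 / (real n * (real n - 1)) * (\<Sum>(k, l)\<in>{(k, l). k < l \<and> l < n}. kernel i j (x k) (x l))"

definition tau :: "nat \<Rightarrow> (nat \<Rightarrow> real) measure \<Rightarrow> nat \<Rightarrow> nat \<Rightarrow> real" where
  "tau n P i j = prob_space.expectation (iid n P) (\<lambda>x. tau_hat n x i j)"

definition jack_q :: "nat \<Rightarrow> (nat \<Rightarrow> nat \<Rightarrow> real) \<Rightarrow> nat \<Rightarrow> nat \<Rightarrow> nat \<Rightarrow> real" where
  "jack_q n x a i j = 1 / (real n - 1) * (\<Sum>b\<in>{..<n} - {a}. kernel i j (x a) (x b))"

definition var_jack :: "nat \<Rightarrow> (nat \<Rightarrow> nat \<Rightarrow> real) \<Rightarrow> nat \<Rightarrow> nat \<Rightarrow> real" where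
  "var_jack n x i j =
     4 * (real n - 1) / (real n * (real n - 2)\<^sup>2) *
     (\<Sum>a<n. (jack_q n x a i j - tau_hat n x i j)\<^sup>2)"

definition concordant :: "nat \<Rightarrow> nat \<Rightarrow> (nat \<Rightarrow> real) \<Rightarrow> (nat \<Rightarrow> real) \<Rightarrow> bool" where
  "concordant i j u v \<longleftrightarrow> (v i - u i) * (v j - u j) > 0"

definition Pi_c_hat :: "nat \<Rightarrow> (nat \<Rightarrow> nat \<Rightarrow> real) \<Rightarrow> nat \<Rightarrow> nat \<Rightarrow> real" where
  "Pi_c_hat n x i j =
     1 / (real n * (real n - 1)) *
     (\<Sum>(k, l)\<in>{(k, l). k < n \<and> l < n \<and> k \<noteq> l}. of_bool (concordant i j (x k) (x l)))"

definition Pi_cc_hat :: "nat \<Rightarrow> (nat \<Rightarrow> nat \<Rightarrow> real) \<Rightarrow> nat \<Rightarrow> nat \<Rightarrow> real" where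
  "Pi_cc_hat n x i j =
     1 / (real n * (real n - 1) * (real n - 2)) *
     (\<Sum>(k, l, m)\<in>{(k, l, m). k < n \<and> l < n \<and> m < n \<and> k \<noteq> l \<and> k \<noteq> m \<and> l \<noteq> m}.
        of_bool (concordant i j (x k) (x l) \<and> concordant i j (x k) (x m)))"

definition var_plug :: "nat \<Rightarrow> (nat \<Rightarrow> nat \<Rightarrow> real) \<Rightarrow> nat \<Rightarrow> nat \<Rightarrow> real" where
  "var_plug n x i j = 16 / real n * (Pi_cc_hat n x i j - (Pi_c_hat n x i j)\<^sup>2)"

text \<open>
  On \<open>P \<Otimes>\<^sub>M P\<close> the two components are independent copies, and the
  \<open>\<sigma>\<close>-algebra generated by the first is the pull-back of \<open>P\<close> along \<open>fst\<close>.
\<close>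

definition proj_g ::
  "(nat \<Rightarrow> real) measure \<Rightarrow> nat \<Rightarrow> nat \<Rightarrow> (nat \<Rightarrow> real) \<times> (nat \<Rightarrow> real) \<Rightarrow> real" where
  "proj_g P i j =
     real_cond_exp (P \<Otimes>\<^sub>M P) (vimage_algebra (space (P \<Otimes>\<^sub>M P)) fst P)
       (\<lambda>(u, v). kernel i j u v)"

definition zeta :: "(nat \<Rightarrow> real) measure \<Rightarrow> nat \<Rightarrow> nat \<Rightarrow> real" where
  "zeta P i j = prob_space.variance (P \<Otimes>\<^sub>M P) (proj_g P i j)"


subsection \<open>The meta-elliptical family and the pseudo variance\<close>

text \<open>
  The uniform distribution on the unit sphere of \<open>\<real>\<^sup>p\<close>: the normalized surface
  (cone) measure, that is, the law of the direction of a uniform point of the unit ball.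
\<close>

definition sphere_unif :: "nat \<Rightarrow> (nat \<Rightarrow> real) measure" where
  "sphere_unif p =
     distr
       (uniform_measure (PiM {..<p} (\<lambda>_. lborel))
         {x \<in> space (PiM {..<p} (\<lambda>_. lborel)). (\<Sum>k<p. (x k)\<^sup>2) \<le> 1})
       (vec_borel p)
       (\<lambda>x. \<lambda>i\<in>{..<p}. x i / sqrt (\<Sum>k<p. (x k)\<^sup>2))"

definition radial_law :: "real measure \<Rightarrow> bool" where
  "radial_law R \<longleftrightarrow> prob_space R \<and> sets R = sets borel \<and> (AE r in R. 0 \<le> r)"

text \<open>
  The predicate keeps the dimension \<open>p\<close> of the sphere and the law \<open>R\<close> of \<open>\<xi>\<close> as
  arguments, since the pseudo variance refers to them. Positive semidefiniteness of
  \<open>A * A\<^sup>T\<close> is automatic.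
\<close>

definition meta_elliptical :: "nat \<Rightarrow> (nat \<Rightarrow> real) measure \<Rightarrow> nat \<Rightarrow> real measure \<Rightarrow> bool" where
  "meta_elliptical d P p R \<longleftrightarrow>
     is_law d P \<and> continuous_marginals d P \<and> radial_law R \<and>
     (\<exists>(f :: nat \<Rightarrow> real \<Rightarrow> real) (A :: real mat).
        (\<forall>i<d. strict_mono (f i)) \<and>
        A \<in> carrier_mat d p \<and>
        (\<forall>i<d. (A * transpose_mat A) $$ (i, i) = 1) \<and>
        vec_space.rank d (A * transpose_mat A) = p \<and>
        distr P (vec_borel d) (\<lambda>z. \<lambda>i\<in>{..<d}. f i (z i)) =
        distr (R \<Otimes>\<^sub>M sphere_unif p) (vec_borel d)
          (\<lambda>(r, u). \<lambda>i\<in>{..<d}. r * (\<Sum>k<p. A $$ (i, k) * u k)))"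

text \<open>
  The law of \<open>\<xi> (U\<^sub>1, U\<^sub>2)\<close>; meaningful for \<open>p \<ge> 2\<close>. If \<open>p = 1\<close>, all
  correlations are \<open>\<plusminus>1\<close> and \<open>zeta\<close> vanishes.
\<close>

definition elliptical_pair :: "nat \<Rightarrow> real measure \<Rightarrow> (nat \<Rightarrow> real) measure" where
  "elliptical_pair p R =
     distr (R \<Otimes>\<^sub>M sphere_unif p) (vec_borel 2) (\<lambda>(r, u). \<lambda>i\<in>{..<2}. r * u i)"

definition pseudo_var :: "nat \<Rightarrow> nat \<Rightarrow> real measure \<Rightarrow> real" where
  "pseudo_var n p R =
     prob_space.variance (iid n (elliptical_pair p R)) (\<lambda>x. sqrt (real n) * tau_hat n x 0 1)"

definition sigma_ps :: "nat \<Rightarrow> real measure \<Rightarrow> real" where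
  "sigma_ps p R = lim (\<lambda>n. sqrt (pseudo_var n p R))"


subsection \<open>Test statistics and tests\<close>

definition index_pairs :: "nat \<Rightarrow> (nat \<times> nat) set" where
  "index_pairs d = {(i, j). i < j \<and> j < d}"

definition max_stat ::
  "nat \<Rightarrow> nat \<Rightarrow> nat \<Rightarrow> (nat \<Rightarrow> nat \<Rightarrow> real) \<Rightarrow>
   (nat \<Rightarrow> nat \<Rightarrow> real) \<times> (nat \<Rightarrow> nat \<Rightarrow> real) \<Rightarrow> real" where
  "max_stat n1 n2 d D = (\<lambda>(x, y).
     Max ((\<lambda>(i, j). (tau_hat n1 x i j - tau_hat n2 y i j)\<^sup>2 / D i j) ` index_pairs d))"

definition M_jack where
  "M_jack n1 n2 d = (\<lambda>(x, y).
     max_stat n1 n2 d (\<lambda>i j. var_jack n1 x i j + var_jack n2 y i j) (x, y))"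

definition M_plug where
  "M_plug n1 n2 d = (\<lambda>(x, y).
     max_stat n1 n2 d (\<lambda>i j. var_plug n1 x i j + var_plug n2 y i j) (x, y))"

definition M_ps where
  "M_ps n1 n2 d p1 R1 p2 R2 =
     max_stat n1 n2 d (\<lambda>i j. (sigma_ps p1 R1)\<^sup>2 / real n1 + (sigma_ps p2 R2)\<^sup>2 / real n2)"

definition G_inv :: "real \<Rightarrow> real" where
  "G_inv \<alpha> = - ln (8 * pi) - 2 * ln (- ln (1 - \<alpha>))"

definition test :: "real \<Rightarrow> nat \<Rightarrow> real \<Rightarrow> nat" where
  "test \<alpha> d M = of_bool (M \<ge> G_inv \<alpha> + 4 * ln (real d) - ln (ln (real d)))"

definition rejection_prob ::
  "real \<Rightarrow> nat \<Rightarrow> nat \<Rightarrow> nat \<Rightarrow>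
   ((nat \<Rightarrow> nat \<Rightarrow> real) \<times> (nat \<Rightarrow> nat \<Rightarrow> real) \<Rightarrow> real) \<Rightarrow>
   (nat \<Rightarrow> real) measure \<Rightarrow> (nat \<Rightarrow> real) measure \<Rightarrow> real" where
  "rejection_prob \<alpha> n1 n2 d M P Q =
     measure (two_sample n1 n2 P Q) {\<omega> \<in> space (two_sample n1 n2 P Q). test \<alpha> d (M \<omega>) = 1}"


subsection \<open>Alternatives and assumptions\<close>

definition in_U ::
  "real \<Rightarrow> nat \<Rightarrow> nat \<Rightarrow> nat \<Rightarrow> (nat \<Rightarrow> real) measure \<Rightarrow> (nat \<Rightarrow> real) measure \<Rightarrow> bool" where
  "in_U C n1 n2 d P Q \<longleftrightarrow>
     Max ((\<lambda>(i, j). \<bar>tau n1 P i j - tau n2 Q i j\<bar> /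
             sqrt (4 * zeta P i j / real n1 + 4 * zeta Q i j / real n2)) ` index_pairs d)
       \<ge> C * sqrt (ln (real d))"

definition in_V ::
  "real \<Rightarrow> nat \<Rightarrow> nat \<Rightarrow> nat \<Rightarrow> (nat \<Rightarrow> real) measure \<Rightarrow> nat \<Rightarrow> real measure \<Rightarrow>
   (nat \<Rightarrow> real) measure \<Rightarrow> nat \<Rightarrow> real measure \<Rightarrow> bool" where
  "in_V C n1 n2 d P p1 R1 Q p2 R2 \<longleftrightarrow>
     Max ((\<lambda>(i, j). \<bar>tau n1 P i j - tau n2 Q i j\<bar> /
             sqrt ((sigma_ps p1 R1)\<^sup>2 / real n1 + (sigma_ps p2 R2)\<^sup>2 / real n2)) ` index_pairs d)
       \<ge> C * sqrt (ln (real d))"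

definition admissible :: "nat \<Rightarrow> real \<Rightarrow> (nat \<Rightarrow> real) measure \<Rightarrow> bool" where
  "admissible d r P \<longleftrightarrow>
     is_law d P \<and> continuous_marginals d P \<and> (\<forall>(i, j)\<in>index_pairs d. zeta P i j > r)"

definition supp ::
  "real \<Rightarrow> nat \<Rightarrow> nat \<Rightarrow> nat \<Rightarrow> (nat \<Rightarrow> real) measure \<Rightarrow> (nat \<Rightarrow> real) measure \<Rightarrow>
   nat \<Rightarrow> nat set" where
  "supp \<alpha>0 n1 n2 d P Q j =
     {i. i < d \<and> (\<bar>tau n1 P i j\<bar> \<ge> ln (real d) powr (- 1 - \<alpha>0) \<or>
                  \<bar>tau n2 Q i j\<bar> \<ge> ln (real d) powr (- 1 - \<alpha>0))}"

text \<open>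
  The sparsity assumption at one index of the sequence, with explicit bounds: \<open>s\<close> for the
  size of the exceptional set and \<open>t\<close> for the maximal support size outside it. The rates
  \<open>s = o(d)\<close> and \<open>t = o(d\<^sup>\<gamma>)\<close> for all \<open>\<gamma> > 0\<close> are imposed on the sequences of bounds,
  which are common to all laws over which the infimum is taken.
\<close>

definition sparse_dependence ::
  "real \<Rightarrow> real \<Rightarrow> real \<Rightarrow> nat \<Rightarrow> nat \<Rightarrow> nat \<Rightarrow>
   (nat \<Rightarrow> real) measure \<Rightarrow> (nat \<Rightarrow> real) measure \<Rightarrow> bool" where
  "sparse_dependence \<alpha>0 s t n1 n2 d P Q \<longleftrightarrow>
     (\<exists>\<Gamma>\<subseteq>{..<d}. real (card \<Gamma>) \<le> s \<and>
        (\<forall>j\<in>{..<d} - \<Gamma>. real (card (supp \<alpha>0 n1 n2 d P Q j)) \<le> t))"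

text \<open>The infimum of a set of probabilities, taken in \<open>[0, 1]\<close>: that of the empty set is 1.\<close>

definition inf_prob :: "real set \<Rightarrow> real" where
  "inf_prob S = Inf (insert 1 S)"

end

theory Submission
  imports Defs "HOL-Real_Asymp.Real_Asymp"
begin

text \<open>
  A single pair of coordinates attaining the maximum in the alternative already forces rejection.
  There \<open>\<bar>\<tau>\<^sub>1 - \<tau>\<^sub>2\<bar> \<ge> 4 (v log d)\<^sup>1\<^sup>/\<^sup>2\<close>, both estimation errors are below
  \<open>(v log d)\<^sup>1\<^sup>/\<^sup>2 / 2\<close> by Chebyshev's inequality since \<open>d \<rightarrow> \<infinity>\<close>, and the variance estimate is
  at most \<open>3 v / 2\<close>, so the statistic is at least \<open>6 log d\<close>, above the critical value
  \<open>4 log d - log log d + O(1)\<close>. Second moments of a U-statistic and of the mean square of its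
  row averages, bounded through the Hoeffding decomposition, suffice for this.

  For the pseudo variance it remains to bound \<open>\<sigma>\<^sub>p\<^sub>s\<close> below uniformly over the meta-elliptical
  family. Sparsity rules out rank \<open>p \<le> 2\<close>, where three coordinates are linearly dependent and some
  \<open>\<bar>\<tau>\<bar>\<close> is at least \<open>1/3\<close>. For \<open>p \<ge> 3\<close>, symmetry under sign changes reduces the bound to one
  for the probability that \<open>\<bar>U'\<^sub>1\<bar> \<le> \<bar>U\<^sub>1\<bar>\<close> and \<open>\<bar>U'\<^sub>2\<bar> \<le> \<bar>U\<^sub>2\<bar>\<close>, with \<open>U, U'\<close> independent
  uniform points of the sphere. If \<open>N\<close> counts the \<open>k\<close> with \<open>\<bar>U'\<^sub>k\<bar> \<le> \<bar>U\<^sub>k\<bar>\<close>, then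
  \<open>E N \<ge> p/2\<close>, and \<open>E N\<^sup>2 \<ge> (E N)\<^sup>2\<close> with exchangeability of the coordinates gives that
  probability the lower bound \<open>(p - 2) / (4 (p - 1)) \<ge> 1/8\<close>.
\<close>


subsection \<open>Second moments of U-statistics\<close>

text \<open>The infima run over laws, so a limit theorem for a fixed law does not help: every
  probability is bounded explicitly in \<open>n1\<close>, \<open>n2\<close>, \<open>d\<close> and
  constants common to all laws considered. Since a single pair of coordinates is followed, no union
  bound over pairs arises, and the factor log d in the squared gap is what drives Chebyshev's bound
  to 0. That bound is of order 1 / (v n_a log d), so everything hinges on a uniform lower bound for
  v n_a. For the two estimated variances \<open>zeta > r\<close> provides it. For the pseudo
  variance it does not: \<open>sigma_ps\<close> belongs to the law of \<xi>(U_1, U_2), not to the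
  coordinate pairs whose \<open>zeta\<close> is controlled, and both p and the radial law vary
  freely. Hence the lower bound has to hold for every p \<ge> 3 and every radial law without atom at
  0, and it rests on symmetry and second moments alone. The value (p - 2) / (4 (p - 1)) vanishes at
  p = 2, so the planar case is excluded rather than estimated.\<close>

text \<open>Fubini, integrating coordinate \<open>l\<close> first. All orthogonality relations below
  come from here: a factor centred in one coordinate annihilates every product whose other factors
  do not involve that coordinate.\<close>

lemma (in prob_space) PiM_integral_zero:
  fixes f :: "_ \<Rightarrow> real" and l n :: nat
  assumes l: "l < n"
    and f: "integrable (PiM {..<n} (\<lambda>_. M)) f"
    and zero: "\<And>x. (\<And>k. k < n \<Longrightarrow> k \<noteq> l \<Longrightarrow> x k \<in> space M) \<Longrightarrow> (\<integral>y. f (x(l := y)) \<partial>M) = 0"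
  shows "(\<integral>x. f x \<partial>PiM {..<n} (\<lambda>_. M)) = 0"
proof -
  interpret PF: product_sigma_finite "\<lambda>_::nat. M"
    by unfold_locales
  let ?I = "{..<n} - {l} "
  have I: "insert l ?I = {..<n}"
    using l by auto
  have "(\<integral>x. f x \<partial>PiM {..<n} (\<lambda>_. M)) = (\<integral>x. (\<integral>y. f (x(l := y)) \<partial>M) \<partial>PiM ?I (\<lambda>_. M))"
    using PF.product_integral_insert[of ?I l f] f unfolding I by simp
  also have "\<dots> = (\<integral>x. 0 \<partial>PiM ?I (\<lambda>_. M))"
    by (rule Bochner_Integration.integral_cong) (auto intro!: zero simp: space_PiM PiE_iff)
  finally show ?thesis
    by simp
qed

lemma (in prob_space) square_expectation_le:
  fixes f :: "'a \<Rightarrow> real"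
  assumes [measurable]: "f \<in> borel_measurable M" and B: "\<And>x. x \<in> space M \<Longrightarrow> \<bar>f x\<bar> \<le> B"
  shows "(expectation f)\<^sup>2 \<le> expectation (\<lambda>x. (f x)\<^sup>2)"
proof -
  have i: "integrable M f"
    by (rule integrable_const_bound[where B=B]) (auto intro!: AE_I2 B)
  have i2: "integrable M (\<lambda>x. (f x)\<^sup>2)"
    by (rule integrable_const_bound[where B="B\<^sup>2"]) (auto intro!: AE_I2 abs_le_square_iff[THEN iffD1] B[THEN order_trans])
  show ?thesis
    using variance_eq[OF i i2] variance_positive[of f] by simp
qed

lemma (in prob_space) prob_abs_ge_le:
  fixes f :: "'a \<Rightarrow> real"
  assumes [measurable]: "f \<in> borel_measurable M" and i: "integrable M (\<lambda>x. (f x)\<^sup>2)" and \<eta>: "0 < \<eta>"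
  shows "prob {x \<in> space M. \<eta> \<le> \<bar>f x\<bar>} \<le> expectation (\<lambda>x. (f x)\<^sup>2) / \<eta>\<^sup>2"
proof -
  have "{x \<in> space M. \<eta> \<le> \<bar>f x\<bar>} = {x \<in> space M. \<eta>\<^sup>2 \<le> (f x)\<^sup>2}"
    using \<eta> by (auto simp: abs_le_square_iff[symmetric])
  then show ?thesis
    using integral_Markov_inequality_measure[OF i, of "{}" "\<eta>\<^sup>2"] \<eta> by simp
qed

text \<open>Two kernels are used: the product of signs, for Kendall's tau and the jackknife, and the
  indicator of concordance, for the plug-in estimator. Requiring \<open>H x x = 0\<close> lets all
  sums run over the full index square.\<close>

locale sym_kernel = prob_space P for P :: "'a measure" +
  fixes H :: "'a \<Rightarrow> 'a \<Rightarrow> real"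
  assumes H_meas [measurable]: "case_prod H \<in> borel_measurable (P \<Otimes>\<^sub>M P)"
    and H_abs: "\<bar>H x y\<bar> \<le> 1"
    and H_sym: "H x y = H y x"
    and H_diag: "H x x = 0"
begin

text \<open>The Hoeffding components, with the first projection left uncentred so that \<kappa> -
  \<mu>^2 is the variance \<zeta> of \<open>g\<close>. The remainder \<open>w\<close> is fully
  degenerate, but \<open>w x x\<close> is not 0; this is why the sums of \<open>w\<close> below
  leave out the diagonal \<open>Id\<close>.\<close>

definition g :: "'a \<Rightarrow> real" where "g x = (\<integral>y. H x y \<partial>P)"
definition \<mu> :: real where "\<mu> = (\<integral>x. g x \<partial>P)"
definition \<kappa> :: real where "\<kappa> = (\<integral>x. (g x)\<^sup>2 \<partial>P)"
definition w :: "'a \<Rightarrow> 'a \<Rightarrow> real" where "w x y = H x y - g x - g y + \<mu>"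

abbreviation sample :: "nat \<Rightarrow> (nat \<Rightarrow> 'a) measure" where
  "sample n \<equiv> PiM {..<n} (\<lambda>_. P)"

text \<open>\<open>row_mean\<close> is the jackknife quantity q, an empirical version of
  \<open>g\<close> at the k-th observation, and \<open>mean_square\<close> estimates \<kappa>. Both
  variance estimators turn out to be functions of \<open>ustat\<close> and
  \<open>mean_square\<close>.\<close>

definition ustat :: "nat \<Rightarrow> (nat \<Rightarrow> 'a) \<Rightarrow> real" where
  "ustat n x = (\<Sum>k<n. \<Sum>l<n. H (x k) (x l)) / (real n * (real n - 1))"
definition row_mean :: "nat \<Rightarrow> (nat \<Rightarrow> 'a) \<Rightarrow> nat \<Rightarrow> real" where
  "row_mean n x k = (\<Sum>l<n. H (x k) (x l)) / (real n - 1)"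
definition mean_square :: "nat \<Rightarrow> (nat \<Rightarrow> 'a) \<Rightarrow> real" where
  "mean_square n x = (\<Sum>k<n. (row_mean n x k)\<^sup>2) / real n"

lemma H_measurable [measurable]:
  assumes [measurable]: "f \<in> measurable N P" "h \<in> measurable N P"
  shows "(\<lambda>z. H (f z) (h z)) \<in> borel_measurable N"
proof -
  have "(\<lambda>z. case_prod H (f z, h z)) \<in> borel_measurable N"
    by measurable
  then show ?thesis by simp
qed

lemma prob_space_sample: "prob_space (sample n)"
  by (intro prob_space_PiM) unfold_locales

lemma H_integrable: "x \<in> space P \<Longrightarrow> integrable P (H x)"
  by (rule integrable_const_bound[where B=1]) (auto intro!: AE_I2 H_abs)

lemma g_measurable [measurable]: "g \<in> borel_measurable P"
  unfolding g_def by measurable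

text \<open>A non-integrable function has integral 0 by convention, so no integrability is required
  and the bounds on \<open>g\<close> hold at every point, inside the space of \<open>P\<close> or
  not.\<close>

lemma abs_integral_le_1:
  fixes f :: "'a \<Rightarrow> real"
  assumes "\<And>x. \<bar>f x\<bar> \<le> 1"
  shows "\<bar>integral\<^sup>L P f\<bar> \<le> 1"
proof (cases "integrable P f")
  case True
  have "\<bar>integral\<^sup>L P f\<bar> \<le> (\<integral>x. \<bar>f x\<bar> \<partial>P)"
    by (rule integral_abs_bound)
  also have "\<dots> \<le> (\<integral>x. 1 \<partial>P)"
    using True assms by (intro integral_mono) auto
  finally show ?thesis by (simp add: prob_space)
qed (simp add: not_integrable_integral_eq)

lemma g_abs: "\<bar>g x\<bar> \<le> 1"
  unfolding g_def by (rule abs_integral_le_1) (rule H_abs)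

lemma \<mu>_abs: "\<bar>\<mu>\<bar> \<le> 1"
  unfolding \<mu>_def by (rule abs_integral_le_1) (rule g_abs)

lemma g_sq: "(g x)\<^sup>2 \<le> 1"
  using g_abs[of x] by (simp add: abs_square_le_1)

lemma \<kappa>_nonneg: "0 \<le> \<kappa>"
  unfolding \<kappa>_def by simp

lemma \<kappa>_le_1: "\<kappa> \<le> 1"
proof -
  have "\<bar>\<kappa>\<bar> \<le> 1"
    unfolding \<kappa>_def by (rule abs_integral_le_1) (simp add: g_sq)
  then show ?thesis by simp
qed

lemma g_integrable: "integrable P g" "integrable P (\<lambda>x. (g x)\<^sup>2)"
  by (rule integrable_const_bound[where B=1]; auto intro!: AE_I2 g_abs simp: g_sq)+

lemma w_abs: "\<bar>w x y\<bar> \<le> 4"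
  using H_abs[of x y] g_abs[of x] g_abs[of y] \<mu>_abs unfolding w_def by linarith

lemma w_sym: "w x y = w y x"
  unfolding w_def by (simp add: H_sym[of x y])

lemma w_measurable [measurable]:
  assumes [measurable]: "f \<in> measurable N P" "h \<in> measurable N P"
  shows "(\<lambda>z. w (f z) (h z)) \<in> borel_measurable N"
  unfolding w_def by measurable

lemma w_integral: "x \<in> space P \<Longrightarrow> (\<integral>y. w x y \<partial>P) = 0"
  using H_integrable[of x] g_integrable
  unfolding w_def by (simp add: g_def[symmetric] \<mu>_def[symmetric] prob_space)

lemma sample_integrable:
  fixes f :: "_ \<Rightarrow> real"
  assumes "f \<in> borel_measurable (sample n)" "\<And>x. \<bar>f x\<bar> \<le> B"
  shows "integrable (sample n) f"
proof -
  interpret N: prob_space "sample n" by (rule prob_space_sample)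
  show ?thesis
    by (rule N.integrable_const_bound[where B=B]) (auto intro!: AE_I2 assms)
qed

lemma sample_integral_le:
  fixes f :: "_ \<Rightarrow> real"
  assumes "f \<in> borel_measurable (sample n)" "\<And>x. \<bar>f x\<bar> \<le> B"
  shows "(\<integral>x. f x \<partial>sample n) \<le> B"
proof -
  interpret N: prob_space "sample n" by (rule prob_space_sample)
  have "(\<integral>x. f x \<partial>sample n) \<le> (\<integral>x. B \<partial>sample n)"
    using assms by (intro integral_mono sample_integrable) (auto intro: order_trans[OF abs_ge_self])
  then show ?thesis by (simp add: N.prob_space)
qed

lemma sample_component:
  fixes f :: "'a \<Rightarrow> real"
  assumes "k < n" and [measurable]: "f \<in> borel_measurable P"
  shows "(\<integral>x. f (x k) \<partial>sample n) = (\<integral>y. f y \<partial>P)"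
proof -
  have "distr (sample n) P (\<lambda>x. x k) = P"
    using assms(1) by (intro distr_PiM_component) (auto intro: prob_space_axioms)
  then have "(\<integral>y. f y \<partial>P) = (\<integral>y. f y \<partial>distr (sample n) P (\<lambda>x. x k))"
    by simp
  also have "\<dots> = (\<integral>x. f (x k) \<partial>sample n)"
    using assms by (subst integral_distr) auto
  finally show ?thesis ..
qed

lemma abs_mult_le: "\<bar>a\<bar> \<le> A \<Longrightarrow> \<bar>b\<bar> \<le> B \<Longrightarrow> \<bar>a * b\<bar> \<le> A * (B::real)"
  unfolding abs_mult by (intro mult_mono) auto

text \<open>Integrating out coordinate \<open>l\<close> kills \<open>w\<close>, while \<phi> is
  constant in that coordinate.\<close>

lemma integral_w_zero:
  assumes "k < n" "l < n" "k \<noteq> l" and phi: "\<And>x y. \<phi> (x(l := y)) = \<phi> x"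
    and [measurable]: "\<phi> \<in> borel_measurable (sample n)" and "\<And>x. \<bar>\<phi> x\<bar> \<le> B"
  shows "(\<integral>x. w (x k) (x l) * \<phi> x \<partial>sample n) = 0"
proof (rule PiM_integral_zero[OF \<open>l < n\<close>])
  show "integrable (sample n) (\<lambda>x. w (x k) (x l) * \<phi> x)"
    using assms by (intro sample_integrable[where B="4 * B"] abs_mult_le w_abs) auto
qed (use assms in \<open>simp add: w_integral phi\<close>)

text \<open>Two different unordered pairs leave an index that occurs in only one of them. By
  symmetry of \<open>w\<close> it may be taken as the second argument and integrated out.\<close>

lemma integral_w_w:
  assumes "k < n" "l < n" "k \<noteq> l" "k' < n" "l' < n" "k' \<noteq> l'" "{k, l} \<noteq> {k', l'}"
  shows "(\<integral>x. w (x k) (x l) * w (x k') (x l') \<partial>sample n) = 0"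
proof -
  have *: "(\<integral>x. w (x k) (x l) * w (x k') (x l') \<partial>sample n) = 0"
    if "k < n" "l < n" "k \<noteq> l" "l \<noteq> k'" "l \<noteq> l'" for k l
    using that assms by (intro integral_w_zero[where B=4]) (auto intro: w_abs)
  show ?thesis
  proof (cases "l = k' \<or> l = l'")
    case True
    then have "k \<noteq> k'" "k \<noteq> l'" using assms by auto
    then show ?thesis
      using *[of l k] assms by (simp add: w_sym[of _ "_ k"])
  qed (use *[of k l] assms in auto)
qed

text \<open>Since \<open>k \<noteq> l\<close>, at least one argument of \<open>w\<close> differs
  from \<open>m\<close> and can be integrated out.\<close>

lemma integral_w_g:
  assumes "k < n" "l < n" "k \<noteq> l" "m < n"
  shows "(\<integral>x. w (x k) (x l) * (g (x m) - \<mu>) \<partial>sample n) = 0"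
proof -
  have b: "\<bar>g x - \<mu>\<bar> \<le> 2" for x
    using g_abs[of x] \<mu>_abs by linarith
  have *: "(\<integral>x. w (x k) (x l) * (g (x m) - \<mu>) \<partial>sample n) = 0"
    if "k < n" "l < n" "k \<noteq> l" "l \<noteq> m" for k l
    using that assms by (intro integral_w_zero[where B=2]) (auto intro: b)
  show ?thesis
  proof (cases "l = m")
    case True
    then show ?thesis
      using *[of l k] assms by (simp add: w_sym[of _ "_ k"])
  qed (use *[of k l] assms in auto)
qed

lemma integral_g_g:
  assumes "k < n" "l < n"
  shows "(\<integral>x. (g (x k) - \<mu>) * (g (x l) - \<mu>) \<partial>sample n) = (if k = l then \<kappa> - \<mu>\<^sup>2 else 0)"
proof (cases "k = l")
  case True
  have "(\<integral>x. (g (x k) - \<mu>) * (g (x k) - \<mu>) \<partial>sample n) = (\<integral>y. (g y - \<mu>) * (g y - \<mu>) \<partial>P)"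
    using assms by (intro sample_component[where f="\<lambda>y. (g y - \<mu>) * (g y - \<mu>)"]) auto
  also have "\<dots> = (\<integral>y. (g y - \<mu>)\<^sup>2 \<partial>P)"
    by (simp add: power2_eq_square)
  also have "\<dots> = \<kappa> - \<mu>\<^sup>2"
    using variance_eq[OF g_integrable] unfolding \<kappa>_def \<mu>_def .
  finally show ?thesis using True by simp
next
  case False
  have b: "\<bar>g x - \<mu>\<bar> \<le> 2" for x
    using g_abs[of x] \<mu>_abs by linarith
  have "(\<integral>x. (g (x k) - \<mu>) * (g (x l) - \<mu>) \<partial>sample n) = 0"
    by (rule PiM_integral_zero[OF \<open>l < n\<close>]) (use assms False g_integrable in
        \<open>auto intro!: sample_integrable[where B="2 * 2"] abs_mult_le b simp: \<mu>_def[symmetric] prob_space\<close>)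
  then show ?thesis using False by simp
qed

lemma \<zeta>_nonneg: "0 \<le> \<kappa> - \<mu>\<^sup>2"
  using square_expectation_le[of g 1] g_abs unfolding \<kappa>_def \<mu>_def by simp

text \<open>Hoeffding decomposition: each \<open>g (x k)\<close> occurs in 2 (n - 1) off-diagonal
  pairs, which after division by n (n - 1) leaves the weight 2 / n.\<close>

lemma ustat_decomp:
  assumes "2 \<le> n"
  shows "ustat n x - \<mu> = 2 / real n * (\<Sum>k<n. g (x k) - \<mu>) +
    (\<Sum>(k, l)\<in>{..<n} \<times> {..<n} - Id. w (x k) (x l)) / (real n * (real n - 1))"
proof -
  have off: "(\<Sum>(k, l)\<in>{..<n} \<times> {..<n} - Id. f k l) = (\<Sum>k<n. \<Sum>l<n. f k l) - (\<Sum>k<n. f k k)"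
    for f :: "nat \<Rightarrow> nat \<Rightarrow> real"
  proof -
    have "(\<Sum>(k, l)\<in>{..<n} \<times> {..<n}. f k l)
        = (\<Sum>(k, l)\<in>{..<n} \<times> {..<n} - Id. f k l) + (\<Sum>(k, l)\<in>{..<n} \<times> {..<n} \<inter> Id. f k l)"
      by (subst sum.union_disjoint[symmetric]) (auto intro!: sum.cong)
    also have "(\<Sum>(k, l)\<in>{..<n} \<times> {..<n} \<inter> Id. f k l) = (\<Sum>k<n. f k k)"
      by (intro sum.reindex_bij_witness[of _ "\<lambda>k. (k, k)" fst]) auto
    finally show ?thesis by (simp add: sum.cartesian_product)
  qed
  have "(\<Sum>(k, l)\<in>{..<n} \<times> {..<n} - Id. w (x k) (x l))
      = (\<Sum>k<n. \<Sum>l<n. H (x k) (x l)) - 2 * (real n - 1) * (\<Sum>k<n. g (x k)) + real n * (real n - 1) * \<mu>"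
    unfolding off w_def
    by (simp add: sum.distrib sum_subtractf H_diag sum_distrib_left[symmetric] algebra_simps)
  then show ?thesis
    using assms unfolding ustat_def by (simp add: sum_subtractf divide_simps) (simp add: algebra_simps)
qed

lemma sum_g_second_moment:
  "(\<integral>x. (\<Sum>k<n. g (x k) - \<mu>)\<^sup>2 \<partial>sample n) = real n * (\<kappa> - \<mu>\<^sup>2)"
proof -
  have b: "\<bar>g x - \<mu>\<bar> \<le> 2" for x
    using g_abs[of x] \<mu>_abs by linarith
  have "(\<integral>x. (\<Sum>k<n. g (x k) - \<mu>)\<^sup>2 \<partial>sample n)
      = (\<integral>x. (\<Sum>k<n. \<Sum>l<n. (g (x k) - \<mu>) * (g (x l) - \<mu>)) \<partial>sample n)"
    by (simp add: power2_eq_square sum_product)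
  also have "\<dots> = (\<Sum>k<n. \<Sum>l<n. \<integral>x. (g (x k) - \<mu>) * (g (x l) - \<mu>) \<partial>sample n)"
    by (subst Bochner_Integration.integral_sum sum.cong,
        auto intro!: Bochner_Integration.integral_sum Bochner_Integration.integrable_sum sum.cong
          sample_integrable[where B="2 * 2"] abs_mult_le b)
  also have "\<dots> = (\<Sum>k<n. \<Sum>l<n. if k = l then \<kappa> - \<mu>\<^sup>2 else 0)"
    by (intro sum.cong refl) (simp only: integral_g_g lessThan_iff)
  finally show ?thesis by simp
qed

text \<open>By \<open>integral_w_w\<close> an ordered pair correlates only with itself and its swap.
  As \<bar>w\<bar> \<le> 4, this gives at most 2 * 16 = 32 for each of the n (n - 1) pairs.\<close>

lemma sum_w_second_moment:
  defines "S \<equiv> \<lambda>n x. \<Sum>(k, l)\<in>{..<n} \<times> {..<n} - Id. w (x k) (x l)"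
  assumes "1 \<le> n"
  shows "(\<integral>x. (S n x)\<^sup>2 \<partial>sample n) \<le> 32 * (real n * (real n - 1))"
proof -
  let ?I = "{..<n} \<times> {..<n} - Id"
  have card: "real (card ?I) = real n * (real n - 1)"
  proof -
    have "card ?I = card ({..<n} \<times> {..<n}) - card ((\<lambda>k. (k, k)) ` {..<n})"
      by (subst card_Diff_subset[symmetric]) (auto intro!: arg_cong[where f=card])
    also have "card ((\<lambda>k. (k, k)) ` {..<n}) = n"
      by (subst card_image) (auto simp: inj_on_def)
    finally show ?thesis using \<open>1 \<le> n\<close> by (simp add: of_nat_diff algebra_simps)
  qed
  have bound: "(\<integral>x. w (x (fst p)) (x (snd p)) * w (x (fst q)) (x (snd q)) \<partial>sample n)
      \<le> (if q \<in> {p, prod.swap p} then 16 else 0)" if "p \<in> ?I" "q \<in> ?I" for p q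
  proof (cases "q \<in> {p, prod.swap p}")
    case True
    have "(\<integral>x. w (x (fst p)) (x (snd p)) * w (x (fst q)) (x (snd q)) \<partial>sample n) \<le> 4 * 4"
      using that by (intro sample_integral_le abs_mult_le w_abs) auto
    then show ?thesis using True by simp
  next
    case False
    then have "(\<integral>x. w (x (fst p)) (x (snd p)) * w (x (fst q)) (x (snd q)) \<partial>sample n) = 0"
      using that by (intro integral_w_w) (auto simp: doubleton_eq_iff)
    then show ?thesis using False by simp
  qed
  have "(\<integral>x. (S n x)\<^sup>2 \<partial>sample n)
      = (\<integral>x. (\<Sum>p\<in>?I. \<Sum>q\<in>?I. w (x (fst p)) (x (snd p)) * w (x (fst q)) (x (snd q))) \<partial>sample n)"
    unfolding S_def by (simp add: power2_eq_square sum_product case_prod_beta')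
  also have "\<dots> = (\<Sum>p\<in>?I. \<Sum>q\<in>?I. \<integral>x. w (x (fst p)) (x (snd p)) * w (x (fst q)) (x (snd q)) \<partial>sample n)"
    by (subst Bochner_Integration.integral_sum,
        auto intro!: Bochner_Integration.integral_sum Bochner_Integration.integrable_sum sum.cong
          sample_integrable[where B="4 * 4"] abs_mult_le w_abs)
  also have "\<dots> \<le> (\<Sum>p\<in>?I. \<Sum>q\<in>?I. if q \<in> {p, prod.swap p} then 16 else 0)"
    by (intro sum_mono bound)
  also have "\<dots> \<le> (\<Sum>p\<in>?I. 32)"
  proof (rule sum_mono)
    fix p assume "p \<in> ?I"
    have "(\<Sum>q\<in>?I. if q \<in> {p, prod.swap p} then 16 else (0::real)) = (\<Sum>q\<in>?I \<inter> {p, prod.swap p}. 16)"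
      by (intro sum.mono_neutral_cong_right) auto
    also have "\<dots> \<le> 32"
    proof -
      have "card (?I \<inter> {p, prod.swap p}) \<le> card {p, prod.swap p}"
        by (intro card_mono) auto
      also have "\<dots> \<le> 2"
        by (simp add: card_insert_if)
      finally show ?thesis by simp
    qed
    finally show "(\<Sum>q\<in>?I. if q \<in> {p, prod.swap p} then 16 else (0::real)) \<le> 32" .
  qed
  finally show ?thesis by (simp add: card)
qed

lemma ustat_measurable [measurable]: "ustat n \<in> borel_measurable (sample n)"
  unfolding ustat_def by measurable

lemma row_mean_measurable [measurable]:
  "k < n \<Longrightarrow> (\<lambda>x. row_mean n x k) \<in> borel_measurable (sample n)"
  unfolding row_mean_def by measurable

lemma mean_square_measurable [measurable]: "mean_square n \<in> borel_measurable (sample n)"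
  unfolding mean_square_def by measurable

lemma ustat_abs:
  assumes "2 \<le> n" shows "\<bar>ustat n x\<bar> \<le> 1"
proof -
  have row: "\<bar>\<Sum>l<n. H (x k) (x l)\<bar> \<le> real n - 1" if "k < n" for k
  proof -
    have "(\<Sum>l<n. H (x k) (x l)) = (\<Sum>l\<in>{..<n} - {k}. H (x k) (x l))"
      using that by (subst sum.remove[of _ k]) (auto simp: H_diag)
    also have "\<bar>\<dots>\<bar> \<le> (\<Sum>l\<in>{..<n} - {k}. 1)"
      by (rule order_trans[OF sum_abs sum_mono]) (rule H_abs)
    finally show ?thesis using that by (simp add: of_nat_diff)
  qed
  have "\<bar>\<Sum>k<n. \<Sum>l<n. H (x k) (x l)\<bar> \<le> (\<Sum>k<n. real n - 1)"
    by (rule order_trans[OF sum_abs sum_mono]) (use row in auto)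
  then show ?thesis
    using assms unfolding ustat_def by (simp add: abs_mult divide_le_eq)
qed

lemma row_mean_abs:
  assumes "k < n" "2 \<le> n" shows "\<bar>row_mean n x k\<bar> \<le> 1"
proof -
  have "(\<Sum>l<n. H (x k) (x l)) = (\<Sum>l\<in>{..<n} - {k}. H (x k) (x l))"
    using assms by (subst sum.remove[of _ k]) (auto simp: H_diag)
  also have "\<bar>\<dots>\<bar> \<le> (\<Sum>l\<in>{..<n} - {k}. 1)"
    by (rule order_trans[OF sum_abs sum_mono]) (rule H_abs)
  finally show ?thesis
    using assms unfolding row_mean_def by (simp add: of_nat_diff)
qed

lemma mean_square_bounds:
  assumes "2 \<le> n" shows "0 \<le> mean_square n x" "mean_square n x \<le> 1"
proof -
  have "(\<Sum>k<n. (row_mean n x k)\<^sup>2) \<le> (\<Sum>k<n. 1)"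
    by (intro sum_mono) (use row_mean_abs[of _ n x] assms in \<open>auto simp: abs_square_le_1\<close>)
  then show "mean_square n x \<le> 1"
    using assms unfolding mean_square_def by (simp add: divide_le_eq)
qed (simp add: mean_square_def sum_nonneg)

text \<open>The linear and the degenerate part are orthogonal. The leading term is kept exact
  because the same identity serves the Chebyshev bounds and, later, the limit that defines the
  pseudo variance.\<close>

lemma ustat_second_moment:
  assumes n: "2 \<le> n"
  obtains \<rho> where "(\<integral>x. (ustat n x - \<mu>)\<^sup>2 \<partial>sample n) = 4 * (\<kappa> - \<mu>\<^sup>2) / real n + \<rho>"
    "0 \<le> \<rho>" "\<rho> \<le> 32 / (real n * (real n - 1))"
proof -
  define L where "L x = (\<Sum>k<n. g (x k) - \<mu>)" for x
  define S where "S x = (\<Sum>(k, l)\<in>{..<n} \<times> {..<n} - Id. w (x k) (x l))" for x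
  define c where "c = real n * (real n - 1)"
  have c: "0 < c" unfolding c_def using n by simp
  have b: "\<bar>g x - \<mu>\<bar> \<le> 2" for x
    using g_abs[of x] \<mu>_abs by linarith
  have [measurable]: "L \<in> borel_measurable (sample n)"
    unfolding L_def by measurable
  have [measurable]: "S \<in> borel_measurable (sample n)"
    unfolding S_def case_prod_beta' by (intro borel_measurable_sum) auto
  have L_abs: "\<bar>L x\<bar> \<le> real n * 2" for x
    unfolding L_def
    by (rule order_trans[OF sum_abs]) (use sum_mono[of "{..<n}" "\<lambda>k. \<bar>g (x k) - \<mu>\<bar>" "\<lambda>_. 2"] b in auto)
  have S_abs: "\<bar>S x\<bar> \<le> real (card ({..<n} \<times> {..<n} - Id)) * 4" for x
    unfolding S_def
    by (rule order_trans[OF sum_abs])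
      (rule sum_bounded_above, use w_abs in auto)
  have cross: "(\<integral>x. L x * S x \<partial>sample n) = 0"
  proof -
    have "L x * S x = (\<Sum>m<n. \<Sum>p\<in>{..<n} \<times> {..<n} - Id. w (x (fst p)) (x (snd p)) * (g (x m) - \<mu>))" for x
      unfolding L_def S_def by (simp add: sum_product case_prod_beta' mult.commute)
    then have "(\<integral>x. L x * S x \<partial>sample n) = (\<Sum>m<n. \<Sum>p\<in>{..<n} \<times> {..<n} - Id.
        \<integral>x. w (x (fst p)) (x (snd p)) * (g (x m) - \<mu>) \<partial>sample n)"
      by (simp,
        subst Bochner_Integration.integral_sum,
        auto intro!: Bochner_Integration.integral_sum Bochner_Integration.integrable_sum sum.cong
          sample_integrable[where B="4 * 2"] abs_mult_le w_abs b)
    also have "\<dots> = 0"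
      by (intro sum.neutral ballI integral_w_g) auto
    finally show ?thesis .
  qed
  have i: "integrable (sample n) (\<lambda>x. (L x)\<^sup>2)" "integrable (sample n) (\<lambda>x. (S x)\<^sup>2)"
    "integrable (sample n) (\<lambda>x. L x * S x)"
    unfolding power2_eq_square by (rule sample_integrable, measurable, rule abs_mult_le[OF L_abs L_abs] abs_mult_le[OF S_abs S_abs] abs_mult_le[OF L_abs S_abs])+
  have "(ustat n x - \<mu>)\<^sup>2 = 4 / (real n)\<^sup>2 * (L x)\<^sup>2 + 1 / c\<^sup>2 * (S x)\<^sup>2 + 4 / (real n * c) * (L x * S x)" for x
    unfolding ustat_decomp[OF n] L_def[symmetric] S_def[symmetric] c_def[symmetric]
    using n c by (simp add: power2_eq_square divide_simps) (simp add: algebra_simps)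
  then have "(\<integral>x. (ustat n x - \<mu>)\<^sup>2 \<partial>sample n)
      = 4 / (real n)\<^sup>2 * (\<integral>x. (L x)\<^sup>2 \<partial>sample n) + 1 / c\<^sup>2 * (\<integral>x. (S x)\<^sup>2 \<partial>sample n)"
    using i by (simp add: cross)
  also have "4 / (real n)\<^sup>2 * (\<integral>x. (L x)\<^sup>2 \<partial>sample n) = 4 * (\<kappa> - \<mu>\<^sup>2) / real n"
    unfolding L_def sum_g_second_moment using n by (simp add: power2_eq_square)
  finally have "(\<integral>x. (ustat n x - \<mu>)\<^sup>2 \<partial>sample n)
      = 4 * (\<kappa> - \<mu>\<^sup>2) / real n + 1 / c\<^sup>2 * (\<integral>x. (S x)\<^sup>2 \<partial>sample n)" .
  moreover have "0 \<le> 1 / c\<^sup>2 * (\<integral>x. (S x)\<^sup>2 \<partial>sample n)"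
    by simp
  moreover have "1 / c\<^sup>2 * (\<integral>x. (S x)\<^sup>2 \<partial>sample n) \<le> 1 / c\<^sup>2 * (32 * c)"
    using sum_w_second_moment[of n] n unfolding S_def c_def by (intro mult_left_mono) auto
  then have "1 / c\<^sup>2 * (\<integral>x. (S x)\<^sup>2 \<partial>sample n) \<le> 32 / c"
    using c by (simp add: power2_eq_square)
  ultimately show thesis
    using that unfolding c_def by blast
qed

text \<open>36 = 4 + 32, from \<kappa> - \<mu>^2 \<le> 1 and n - 1 \<ge> 1.\<close>

lemma ustat_second_moment_le:
  assumes n: "2 \<le> n"
  shows "(\<integral>x. (ustat n x - \<mu>)\<^sup>2 \<partial>sample n) \<le> 36 / real n"
proof -
  obtain \<rho> where \<rho>: "(\<integral>x. (ustat n x - \<mu>)\<^sup>2 \<partial>sample n) = 4 * (\<kappa> - \<mu>\<^sup>2) / real n + \<rho>"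
    "\<rho> \<le> 32 / (real n * (real n - 1))"
    using ustat_second_moment[OF n] by metis
  have "4 * (\<kappa> - \<mu>\<^sup>2) / real n \<le> 4 / real n"
  proof (rule divide_right_mono)
    show "4 * (\<kappa> - \<mu>\<^sup>2) \<le> 4"
      using diff_mono[OF \<kappa>_le_1 zero_le_power2[of \<mu>]] by (simp add: algebra_simps)
  qed simp
  moreover have "32 / (real n * (real n - 1)) \<le> 32 / real n"
    using n by (intro divide_left_mono) auto
  ultimately show ?thesis
    using \<rho> by (simp add: add_divide_distrib[symmetric])
qed

lemma ustat_expectation:
  assumes n: "2 \<le> n"
  shows "(\<integral>x. ustat n x \<partial>sample n) = \<mu>"
proof -
  interpret N: prob_space "sample n" by (rule prob_space_sample)
  have b: "\<bar>g x - \<mu>\<bar> \<le> 2" for x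
    using g_abs[of x] \<mu>_abs by linarith
  have 1: "(\<integral>x. (\<Sum>k<n. g (x k) - \<mu>) \<partial>sample n) = 0"
  proof -
    have "(\<integral>x. (\<Sum>k<n. g (x k) - \<mu>) \<partial>sample n) = (\<Sum>k<n. \<integral>x. g (x k) - \<mu> \<partial>sample n)"
      by (rule Bochner_Integration.integral_sum) (auto intro!: sample_integrable[where B=2] b)
    also have "\<dots> = (\<Sum>k<n. \<integral>y. g y - \<mu> \<partial>P)"
      by (intro sum.cong refl sample_component) auto
    finally show ?thesis
      using g_integrable by (simp add: \<mu>_def[symmetric] prob_space)
  qed
  have 2: "(\<integral>x. (\<Sum>p\<in>{..<n} \<times> {..<n} - Id. w (x (fst p)) (x (snd p))) \<partial>sample n) = 0"
  proof -
    have "(\<integral>x. (\<Sum>p\<in>{..<n} \<times> {..<n} - Id. w (x (fst p)) (x (snd p))) \<partial>sample n)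
      = (\<Sum>p\<in>{..<n} \<times> {..<n} - Id. \<integral>x. w (x (fst p)) (x (snd p)) \<partial>sample n)"
      by (rule Bochner_Integration.integral_sum) (auto intro!: sample_integrable[where B=4] w_abs)
    also have "\<dots> = 0"
      by (intro sum.neutral ballI) (use integral_w_zero[where \<phi>="\<lambda>_. 1" and B=1 and n=n] in force)
    finally show ?thesis .
  qed
  have i1: "integrable (sample n) (\<lambda>x. \<Sum>k<n. g (x k) - \<mu>)"
    by (intro Bochner_Integration.integrable_sum sample_integrable[where B=2]) (auto intro: b)
  have i2: "integrable (sample n) (\<lambda>x. \<Sum>p\<in>{..<n} \<times> {..<n} - Id. w (x (fst p)) (x (snd p)))"
    by (intro Bochner_Integration.integrable_sum sample_integrable[where B=4]) (auto intro: w_abs)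
  have "ustat n x = \<mu> + 2 / real n * (\<Sum>k<n. g (x k) - \<mu>) +
    (\<Sum>p\<in>{..<n} \<times> {..<n} - Id. w (x (fst p)) (x (snd p))) / (real n * (real n - 1))" for x
    using ustat_decomp[OF n, of x] by (simp add: case_prod_beta')
  then show ?thesis
    using i1 i2 by (simp add: 1 2 N.prob_space del: sum_subtractf)
qed

text \<open>Given \<open>x k\<close>, the n - 1 entries of its row are independent with mean
  \<open>g (x k)\<close>. So only the diagonal of the squared sum survives, each term being at most
  2 * 2.\<close>

lemma row_mean_second_moment:
  assumes n: "2 \<le> n" "k < n"
  shows "(\<integral>x. (row_mean n x k - g (x k))\<^sup>2 \<partial>sample n) \<le> 4 / (real n - 1)"
proof -
  let ?I = "{..<n} - {k}"
  define e where "e x l = H (x k) (x l) - g (x k)" for x l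
  have b: "\<bar>e x l\<bar> \<le> 2" for x l
    using H_abs[of "x k" "x l"] g_abs[of "x k"] unfolding e_def by linarith
  have [measurable]: "(\<lambda>x. e x l) \<in> borel_measurable (sample n)" if "l < n" for l
    unfolding e_def using n that by simp
  have e2: "(\<integral>x. e x l * e x m \<partial>sample n) \<le> (if m = l then 4 else 0)" if "l \<in> ?I" "m \<in> ?I" for l m
  proof (cases "m = l")
    case True
    have "(\<integral>x. e x l * e x m \<partial>sample n) \<le> 2 * 2"
      using that by (intro sample_integral_le abs_mult_le b) auto
    then show ?thesis using True by simp
  next
    case False
    have "(\<integral>x. e x l * e x m \<partial>sample n) = 0"
    proof (rule PiM_integral_zero[of l])
      show "integrable (sample n) (\<lambda>x. e x l * e x m)"
        using that by (intro sample_integrable[where B="2 * 2"] abs_mult_le b) auto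
    qed (use that n False H_integrable in \<open>auto simp: e_def g_def[symmetric] prob_space\<close>)
    then show ?thesis using False by simp
  qed
  have "row_mean n x k - g (x k) = (\<Sum>l\<in>?I. e x l) / (real n - 1)" for x
  proof -
    have "(\<Sum>l<n. H (x k) (x l)) = (\<Sum>l\<in>?I. H (x k) (x l))"
      using n by (subst sum.remove[of _ k]) (auto simp: H_diag)
    then show ?thesis
      unfolding row_mean_def e_def using n by (simp add: sum_subtractf of_nat_diff diff_divide_distrib)
  qed
  then have "(\<integral>x. (row_mean n x k - g (x k))\<^sup>2 \<partial>sample n)
      = (\<integral>x. (\<Sum>l\<in>?I. \<Sum>m\<in>?I. e x l * e x m) / (real n - 1)\<^sup>2 \<partial>sample n)"
    by (simp add: power_divide power2_eq_square[of "sum _ _"] sum_product)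
  also have "\<dots> = (\<Sum>l\<in>?I. \<Sum>m\<in>?I. \<integral>x. e x l * e x m \<partial>sample n) / (real n - 1)\<^sup>2"
    by (simp, subst Bochner_Integration.integral_sum,
        auto intro!: Bochner_Integration.integral_sum Bochner_Integration.integrable_sum sum.cong
          sample_integrable[where B="2 * 2"] abs_mult_le b)
  also have "\<dots> \<le> (\<Sum>l\<in>?I. \<Sum>m\<in>?I. if m = l then 4 else 0) / (real n - 1)\<^sup>2"
    by (intro divide_right_mono sum_mono e2) auto
  also have "(\<Sum>l\<in>?I. \<Sum>m\<in>?I. if m = l then 4 else (0::real)) = (\<Sum>l\<in>?I. 4)"
    by (intro sum.cong refl) (simp add: sum.delta)
  also have "\<dots> / (real n - 1)\<^sup>2 = 4 / (real n - 1)"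
    using n by (simp add: of_nat_diff power2_eq_square divide_simps)
  finally show ?thesis .
qed

text \<open>Replacing each row mean by \<open>g (x k)\<close> leaves an average of independent
  terms, whose sum \<open>G\<close> is handled by orthogonality. The rows themselves are dependent,
  so the replacement error \<open>D\<close> is bounded by Cauchy-Schwarz and a^2 - g^2 = (a + g)(a -
  g) with \<bar>a + g\<bar> \<le> 2. The two parts contribute 8 * 4 = 32 and 2.\<close>

lemma mean_square_second_moment:
  assumes n: "2 \<le> n"
  shows "(\<integral>x. (mean_square n x - \<kappa>)\<^sup>2 \<partial>sample n) \<le> 34 / (real n - 1)"
proof -
  define a where "a x k = row_mean n x k" for x k
  define G where "G x = (\<Sum>k<n. (g (x k))\<^sup>2 - \<kappa>)" for x
  have [measurable]: "G \<in> borel_measurable (sample n)"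
    unfolding G_def by measurable
  have b: "\<bar>(g x)\<^sup>2 - \<kappa>\<bar> \<le> 1" for x
    using g_sq[of x] zero_le_power2[of "g x"] \<kappa>_nonneg \<kappa>_le_1 by linarith
  have G_abs: "\<bar>G x\<bar> \<le> real n" for x
    unfolding G_def
    by (rule order_trans[OF sum_abs]) (use sum_mono[of "{..<n}" "\<lambda>k. \<bar>(g (x k))\<^sup>2 - \<kappa>\<bar>" "\<lambda>_. 1"] b in auto)
  have gg: "(\<integral>x. ((g (x k))\<^sup>2 - \<kappa>) * ((g (x l))\<^sup>2 - \<kappa>) \<partial>sample n) \<le> (if k = l then 1 else 0)"
    if "k < n" "l < n" for k l
  proof (cases "k = l")
    case True
    have "(\<integral>x. ((g (x k))\<^sup>2 - \<kappa>) * ((g (x l))\<^sup>2 - \<kappa>) \<partial>sample n) \<le> 1 * 1"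
      using that by (intro sample_integral_le abs_mult_le b) auto
    then show ?thesis using True by simp
  next
    case False
    have "(\<integral>x. ((g (x k))\<^sup>2 - \<kappa>) * ((g (x l))\<^sup>2 - \<kappa>) \<partial>sample n) = 0"
      by (rule PiM_integral_zero[OF \<open>l < n\<close>]) (use that False g_integrable in
        \<open>auto intro!: sample_integrable[where B="1 * 1"] abs_mult_le b simp: \<kappa>_def[symmetric] prob_space\<close>)
    then show ?thesis using False by simp
  qed
  have "(\<integral>x. (G x)\<^sup>2 \<partial>sample n)
      = (\<integral>x. (\<Sum>k<n. \<Sum>l<n. ((g (x k))\<^sup>2 - \<kappa>) * ((g (x l))\<^sup>2 - \<kappa>)) \<partial>sample n)"
    unfolding G_def by (simp only: power2_eq_square[of "sum _ _"] sum_product)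
  also have "\<dots> = (\<Sum>k<n. \<Sum>l<n. \<integral>x. ((g (x k))\<^sup>2 - \<kappa>) * ((g (x l))\<^sup>2 - \<kappa>) \<partial>sample n)"
    by (subst Bochner_Integration.integral_sum,
        auto intro!: Bochner_Integration.integral_sum Bochner_Integration.integrable_sum sum.cong
          sample_integrable[where B="1 * 1"] abs_mult_le b)
  also have "\<dots> \<le> (\<Sum>k<n. \<Sum>l<n. if k = l then 1 else 0)"
    by (intro sum_mono gg) auto
  finally have G2: "(\<integral>x. (G x)\<^sup>2 \<partial>sample n) \<le> real n"
    by simp
  have pointwise: "(mean_square n x - \<kappa>)\<^sup>2 \<le> 8 / real n * (\<Sum>k<n. (a x k - g (x k))\<^sup>2) + 2 / (real n)\<^sup>2 * (G x)\<^sup>2" for x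
  proof -
    define D where "D = (\<Sum>k<n. (a x k)\<^sup>2 - (g (x k))\<^sup>2)"
    have "mean_square n x - \<kappa> = (D + G x) / real n"
      using n unfolding D_def G_def mean_square_def a_def
      by (simp add: sum_subtractf field_simps)
    then have "(mean_square n x - \<kappa>)\<^sup>2 = (D + G x)\<^sup>2 / (real n)\<^sup>2"
      by (simp add: power_divide)
    also have "\<dots> \<le> (2 * D\<^sup>2 + 2 * (G x)\<^sup>2) / (real n)\<^sup>2"
      using sum_squares_bound[of D "G x"] by (intro divide_right_mono) (auto simp: power2_sum)
    also have "D\<^sup>2 \<le> (\<Sum>k<n. ((a x k)\<^sup>2 - (g (x k))\<^sup>2)\<^sup>2) * real n"
      unfolding D_def using sum_squared_le_sum_of_squares[of _ "{..<n}"] by simp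
    also have "(\<Sum>k<n. ((a x k)\<^sup>2 - (g (x k))\<^sup>2)\<^sup>2) \<le> (\<Sum>k<n. 4 * (a x k - g (x k))\<^sup>2)"
    proof (rule sum_mono)
      fix k assume "k \<in> {..<n}"
      then have "\<bar>a x k + g (x k)\<bar> \<le> \<bar>2\<bar>"
        using row_mean_abs[of k n x] g_abs[of "x k"] n unfolding a_def by simp
      then have "(a x k + g (x k))\<^sup>2 \<le> 2\<^sup>2"
        by (simp only: abs_le_square_iff)
      then have "(a x k + g (x k))\<^sup>2 * (a x k - g (x k))\<^sup>2 \<le> 4 * (a x k - g (x k))\<^sup>2"
        by (intro mult_right_mono) auto
      also have "(a x k + g (x k))\<^sup>2 * (a x k - g (x k))\<^sup>2 = ((a x k)\<^sup>2 - (g (x k))\<^sup>2)\<^sup>2"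
        by (simp add: power_mult_distrib[symmetric] square_diff_square_factored power2_eq_square[of "a x k"] power2_eq_square[of "g (x k)"])
      finally show "((a x k)\<^sup>2 - (g (x k))\<^sup>2)\<^sup>2 \<le> 4 * (a x k - g (x k))\<^sup>2" .
    qed
    finally show ?thesis
      using n by (simp add: sum_distrib_left[symmetric] field_simps power2_eq_square[of "real n"])
  qed
  have [measurable]: "(\<lambda>x. a x k) \<in> borel_measurable (sample n)" if "k < n" for k
    unfolding a_def using that by measurable
  have ab: "(a x k - g (x k))\<^sup>2 \<le> 4" if "k < n" for x k
  proof -
    have "\<bar>a x k - g (x k)\<bar> \<le> \<bar>2\<bar>"
      using row_mean_abs[of k n x] g_abs[of "x k"] n that unfolding a_def by simp
    then have "(a x k - g (x k))\<^sup>2 \<le> 2\<^sup>2"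
      by (simp only: abs_le_square_iff)
    then show ?thesis by simp
  qed
  have ia: "integrable (sample n) (\<lambda>x. (a x k - g (x k))\<^sup>2)" if "k < n" for k
    using that ab by (intro sample_integrable[where B=4]) auto
  have iG: "integrable (sample n) (\<lambda>x. (G x)\<^sup>2)"
    unfolding power2_eq_square by (rule sample_integrable, measurable, rule abs_mult_le[OF G_abs G_abs])
  have "(\<integral>x. (mean_square n x - \<kappa>)\<^sup>2 \<partial>sample n)
      \<le> (\<integral>x. 8 / real n * (\<Sum>k<n. (a x k - g (x k))\<^sup>2) + 2 / (real n)\<^sup>2 * (G x)\<^sup>2 \<partial>sample n)"
  proof (rule integral_mono)
    have "\<bar>mean_square n x - \<kappa>\<bar> \<le> 1" for x
      using mean_square_bounds[OF n, of x] \<kappa>_nonneg \<kappa>_le_1 by linarith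
    then show "integrable (sample n) (\<lambda>x. (mean_square n x - \<kappa>)\<^sup>2)"
      by (intro sample_integrable[where B=1]) (auto simp: abs_square_le_1)
    show "integrable (sample n) (\<lambda>x. 8 / real n * (\<Sum>k<n. (a x k - g (x k))\<^sup>2) + 2 / (real n)\<^sup>2 * (G x)\<^sup>2)"
      using ia iG by (intro Bochner_Integration.integrable_add integrable_mult_right Bochner_Integration.integrable_sum) auto
  qed (rule pointwise)
  also have "\<dots> = 8 / real n * (\<Sum>k<n. \<integral>x. (a x k - g (x k))\<^sup>2 \<partial>sample n) + 2 / (real n)\<^sup>2 * (\<integral>x. (G x)\<^sup>2 \<partial>sample n)"
    using ia iG Bochner_Integration.integrable_sum[of "{..<n}" "sample n" "\<lambda>k x. (a x k - g (x k))\<^sup>2"]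
    by (subst Bochner_Integration.integral_add) auto
  also have "\<dots> \<le> 8 / real n * (\<Sum>k<n. 4 / (real n - 1)) + 2 / (real n)\<^sup>2 * real n"
    using n row_mean_second_moment G2 unfolding a_def by (intro add_mono mult_left_mono sum_mono) auto
  also have "\<dots> = 32 / (real n - 1) + 2 / real n"
    using n by (simp add: power2_eq_square)
  also have "2 / real n \<le> 2 / (real n - 1)"
    using n by (intro divide_left_mono) auto
  finally show ?thesis
    by (simp add: add_divide_distrib[symmetric])
qed

lemma ustat_deviation:
  assumes n: "2 \<le> n" and \<eta>: "0 < \<eta>"
  shows "measure (sample n) {x \<in> space (sample n). \<eta> \<le> \<bar>ustat n x - \<mu>\<bar>} \<le> 36 / (real n * \<eta>\<^sup>2)"
proof -
  interpret N: prob_space "sample n" by (rule prob_space_sample)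
  have b: "\<bar>ustat n x - \<mu>\<bar> \<le> 2" for x
    using ustat_abs[OF n, of x] \<mu>_abs by linarith
  have "measure (sample n) {x \<in> space (sample n). \<eta> \<le> \<bar>ustat n x - \<mu>\<bar>}
      \<le> (\<integral>x. (ustat n x - \<mu>)\<^sup>2 \<partial>sample n) / \<eta>\<^sup>2"
  proof (rule N.prob_abs_ge_le)
    show "integrable (sample n) (\<lambda>x. (ustat n x - \<mu>)\<^sup>2)"
      unfolding power2_eq_square by (intro sample_integrable[where B="2 * 2"] abs_mult_le b) measurable
  qed (use \<eta> in auto)
  also have "\<dots> \<le> 36 / real n / \<eta>\<^sup>2"
    by (intro divide_right_mono ustat_second_moment_le n) auto
  finally show ?thesis by simp
qed

lemma mean_square_deviation:
  assumes n: "2 \<le> n" and \<eta>: "0 < \<eta>"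
  shows "measure (sample n) {x \<in> space (sample n). \<eta> \<le> \<bar>mean_square n x - \<kappa>\<bar>} \<le> 34 / ((real n - 1) * \<eta>\<^sup>2)"
proof -
  interpret N: prob_space "sample n" by (rule prob_space_sample)
  have b: "\<bar>mean_square n x - \<kappa>\<bar> \<le> 1" for x
    using mean_square_bounds[OF n, of x] \<kappa>_nonneg \<kappa>_le_1 by linarith
  have "measure (sample n) {x \<in> space (sample n). \<eta> \<le> \<bar>mean_square n x - \<kappa>\<bar>}
      \<le> (\<integral>x. (mean_square n x - \<kappa>)\<^sup>2 \<partial>sample n) / \<eta>\<^sup>2"
    using \<eta> b by (intro N.prob_abs_ge_le sample_integrable[where B=1]) (auto simp: abs_square_le_1)
  also have "\<dots> \<le> 34 / (real n - 1) / \<eta>\<^sup>2"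
    by (intro divide_right_mono mean_square_second_moment n) auto
  finally show ?thesis by simp
qed

end


subsection \<open>Kendall's tau and its variance estimators\<close>

lemma law_component_measurable:
  assumes "is_law d P" "i < d"
  shows "(\<lambda>u. u i) \<in> borel_measurable P"
proof -
  have "(\<lambda>u. u i) \<in> borel_measurable (vec_borel d)"
    using assms(2) by (intro measurable_component_singleton) auto
  then show ?thesis
    using assms(1) unfolding is_law_def by (subst measurable_cong_sets[of P "vec_borel d" borel borel]) auto
qed

lemma sgn_measurable [measurable]: "(sgn :: real \<Rightarrow> real) \<in> borel_measurable borel"
proof -
  have "(\<lambda>x::real. if x = 0 then 0 else if 0 < x then 1 else -1 :: real) \<in> borel_measurable borel"
    by measurable
  then show ?thesis
    by (simp add: sgn_if[abs_def])
qed

lemma sym_kernel_kernel: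
  assumes "is_law d P" "i < d" "j < d"
  shows "sym_kernel P (kernel i j)"
proof -
  interpret prob_space P using assms(1) by (simp add: is_law_def)
  note [measurable] = law_component_measurable[OF assms(1,2)] law_component_measurable[OF assms(1,3)]
  show ?thesis
  proof
    show "case_prod (kernel i j) \<in> borel_measurable (P \<Otimes>\<^sub>M P)"
      unfolding kernel_def by measurable
    show "\<bar>kernel i j x y\<bar> \<le> 1" for x y
      by (auto simp: kernel_def abs_mult abs_sgn_eq)
    show "kernel i j x y = kernel i j y x" for x y
      unfolding kernel_def minus_diff_eq[of "x i" "y i", symmetric] minus_diff_eq[of "x j" "y j", symmetric] sgn_minus by simp
    show "kernel i j x x = 0" for x
      by (simp add: kernel_def)
  qed
qed

lemma sym_kernel_concordant:
  assumes "is_law d P" "i < d" "j < d"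
  shows "sym_kernel P (\<lambda>u v. of_bool (concordant i j u v))"
proof -
  interpret prob_space P using assms(1) by (simp add: is_law_def)
  note [measurable] = law_component_measurable[OF assms(1,2)] law_component_measurable[OF assms(1,3)]
  show ?thesis
  proof
    show "(\<lambda>(u, v). of_bool (concordant i j u v) :: real) \<in> borel_measurable (P \<Otimes>\<^sub>M P)"
      unfolding concordant_def of_bool_def by measurable
    show "of_bool (concordant i j x y) = (of_bool (concordant i j y x) :: real)" for x y
      by (auto simp: concordant_def zero_less_mult_iff)
  qed (auto simp: concordant_def)
qed

lemma prob_space_iid: "is_law d P \<Longrightarrow> prob_space (iid n P)"
  unfolding iid_def is_law_def by (intro prob_space_PiM) auto

context
  fixes d :: nat and P :: "(nat \<Rightarrow> real) measure" and i j :: nat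
  assumes law: "is_law d P" and ij: "i < d" "j < d"
begin

interpretation K: sym_kernel P "kernel i j"
  using law ij by (rule sym_kernel_kernel)

interpretation C: sym_kernel P "\<lambda>u v. of_bool (concordant i j u v)"
  using law ij by (rule sym_kernel_concordant)

lemma tau_hat_eq_ustat: "tau_hat n x i j = K.ustat n x"
proof -
  let ?f = "\<lambda>(k, l). kernel i j (x k) (x l)"
  let ?A = "{(k, l). k < l \<and> l < n}" and ?B = "{(k, l). l < k \<and> k < n}"
  have fin: "finite ?A" "finite ?B"
    by (rule finite_subset[of _ "{..<n} \<times> {..<n}"]; auto)+
  have "(\<Sum>k<n. \<Sum>l<n. kernel i j (x k) (x l)) = sum ?f ({..<n} \<times> {..<n})"
    by (simp add: sum.cartesian_product)
  also have "\<dots> = sum ?f (?A \<union> ?B)"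
    by (rule sum.mono_neutral_right) (auto, metis K.H_diag linorder_neqE_nat)
  also have "\<dots> = sum ?f ?A + sum ?f ?B"
    using fin by (intro sum.union_disjoint) auto
  also have "sum ?f ?B = sum ?f ?A"
    by (rule sum.reindex_bij_witness[of _ prod.swap prod.swap]) (auto simp: K.H_sym)
  finally show ?thesis
    unfolding tau_hat_def K.ustat_def by simp
qed

lemma tau_eq: "2 \<le> n \<Longrightarrow> tau n P i j = K.\<mu>"
  unfolding tau_def iid_def tau_hat_eq_ustat by (rule K.ustat_expectation)

lemma jack_q_eq: "a < n \<Longrightarrow> jack_q n x a i j = K.row_mean n x a"
  unfolding jack_q_def K.row_mean_def by (subst (2) sum.remove[of _ a]) (auto simp: K.H_diag)

text \<open>The row means average to \<open>ustat\<close>, so their squared deviations sum to n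
  (\<open>mean_square\<close> - \<open>ustat\<close>^2). At \<open>n = 2\<close> the prefactors on
  both sides are 0, by division by 0.\<close>

lemma var_jack_eq:
  assumes "2 \<le> n"
  shows "var_jack n x i j = 4 * (real n - 1) / (real n - 2)\<^sup>2 * (K.mean_square n x - (K.ustat n x)\<^sup>2)"
proof -
  define t where "t = K.ustat n x"
  have s: "(\<Sum>a<n. K.row_mean n x a) = real n * t"
    using assms unfolding t_def K.row_mean_def K.ustat_def by (simp add: sum_divide_distrib[symmetric])
  have "(\<Sum>a<n. (jack_q n x a i j - tau_hat n x i j)\<^sup>2) = (\<Sum>a<n. (K.row_mean n x a)\<^sup>2 - 2 * t * K.row_mean n x a + t\<^sup>2)"
    by (intro sum.cong) (auto simp: jack_q_eq tau_hat_eq_ustat t_def power2_diff)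
  also have "\<dots> = (\<Sum>a<n. (K.row_mean n x a)\<^sup>2) - 2 * t * (real n * t) + real n * t\<^sup>2"
    by (simp add: sum.distrib sum_subtractf sum_distrib_left[symmetric] s)
  also have "\<dots> = real n * (K.mean_square n x - t\<^sup>2)"
    using assms unfolding K.mean_square_def by (simp add: algebra_simps power2_eq_square)
  finally show ?thesis
    using assms unfolding var_jack_def t_def by simp
qed

lemma Pi_c_hat_eq: "Pi_c_hat n x i j = C.ustat n x"
proof -
  have "(\<Sum>k<n. \<Sum>l<n. of_bool (concordant i j (x k) (x l)) :: real)
      = (\<Sum>(k, l)\<in>{..<n} \<times> {..<n}. of_bool (concordant i j (x k) (x l)))"
    by (rule sum.cartesian_product)
  also have "\<dots> = (\<Sum>(k, l)\<in>{(k, l). k < n \<and> l < n \<and> k \<noteq> l}. of_bool (concordant i j (x k) (x l)))"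
    by (rule sum.mono_neutral_right) (auto simp: concordant_def)
  finally show ?thesis
    unfolding Pi_c_hat_def C.ustat_def by simp
qed

text \<open>Summing over triples amounts to squaring the row sums and removing the terms with l = m.
  Those terms reduce to single indicators because an indicator equals its square; terms with k = l
  or k = m are 0 anyway.\<close>

lemma Pi_cc_hat_eq:
  assumes "3 \<le> n"
  shows "Pi_cc_hat n x i j = ((real n - 1) * C.mean_square n x - C.ustat n x) / (real n - 2)"
proof -
  define c where "c k l = (of_bool (concordant i j (x k) (x l)) :: real)" for k l
  let ?I = "{(k, l, m). k < n \<and> l < n \<and> m < n \<and> k \<noteq> l \<and> k \<noteq> m \<and> l \<noteq> m}"
  have cc: "c k l * c k l = c k l" "c k k = 0" for k l
    by (auto simp: c_def concordant_def)
  have "(\<Sum>(k, l, m)\<in>?I. of_bool (concordant i j (x k) (x l) \<and> concordant i j (x k) (x m)))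
      = (\<Sum>(k, l, m)\<in>?I. c k l * c k m)"
    by (intro sum.cong) (auto simp: c_def)
  also have "\<dots> = (\<Sum>(k, l, m)\<in>{..<n} \<times> {..<n} \<times> {..<n}. if l = m then 0 else c k l * c k m)"
    by (rule sum.mono_neutral_cong_left) (auto simp: cc split: if_splits)
  also have "\<dots> = (\<Sum>k<n. \<Sum>l<n. \<Sum>m<n. if l = m then 0 else c k l * c k m)"
    by (simp add: sum.cartesian_product)
  also have "\<dots> = (\<Sum>k<n. \<Sum>l<n. (\<Sum>m<n. c k l * c k m) - c k l)"
  proof (intro sum.cong refl)
    fix k l assume "l \<in> {..<n}"
    then have "(\<Sum>m<n. c k l * c k m) = c k l * c k l + (\<Sum>m\<in>{..<n} - {l}. c k l * c k m)"
      by (subst sum.remove[of _ l]) auto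
    moreover have "(\<Sum>m<n. if l = m then 0 else c k l * c k m) = (\<Sum>m\<in>{..<n} - {l}. c k l * c k m)"
      by (rule sum.mono_neutral_cong_right) auto
    ultimately show "(\<Sum>m<n. if l = m then 0 else c k l * c k m) = (\<Sum>m<n. c k l * c k m) - c k l"
      by (simp add: cc)
  qed
  also have "\<dots> = (\<Sum>k<n. (\<Sum>l<n. c k l)\<^sup>2) - (\<Sum>k<n. \<Sum>l<n. c k l)"
    by (simp add: sum_subtractf power2_eq_square sum_product)
  also have "(\<Sum>k<n. (\<Sum>l<n. c k l)\<^sup>2) = real n * (real n - 1)\<^sup>2 * C.mean_square n x"
    using assms unfolding C.mean_square_def C.row_mean_def c_def[symmetric]
    by (simp add: power_divide sum_divide_distrib[symmetric])
  also have "(\<Sum>k<n. \<Sum>l<n. c k l) = real n * (real n - 1) * C.ustat n x"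
    using assms unfolding C.ustat_def c_def[symmetric] by simp
  finally show ?thesis
    using assms unfolding Pi_cc_hat_def
    by (simp add: divide_simps power2_eq_square) (simp add: algebra_simps)
qed

text \<open>Sets of the conditioning \<sigma>-algebra are cylinders over the first component, so
  Fubini identifies \<open>K.g\<close> of the first component as a version of the conditional
  expectation. Variances depend only on the version up to null sets.\<close>

lemma zeta_eq: "zeta P i j = K.\<kappa> - K.\<mu>\<^sup>2"
proof -
  let ?M = "P \<Otimes>\<^sub>M P" and ?F = "vimage_algebra (space (P \<Otimes>\<^sub>M P)) fst P"
  interpret PP: pair_prob_space P P ..
  have fst: "fst \<in> measurable ?F P"
    by (rule measurable_vimage_algebra1) (auto simp: space_pair_measure)
  have sub: "subalgebra ?M ?F"
  proof (unfold subalgebra_def, intro conjI subsetI)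
    fix A assume "A \<in> sets ?F"
    then obtain B where "B \<in> sets P" "A = fst -` B \<inter> space ?M"
      by (subst (asm) sets_vimage_algebra2) (auto simp: space_pair_measure)
    then show "A \<in> sets ?M"
      using measurable_sets[OF measurable_fst, of B P P] by simp
  qed simp
  then interpret finite_measure_subalgebra ?M ?F
    by unfold_locales
  interpret sigma_finite_subalgebra ?M ?F
    by (rule finite_measure_subalgebra_is_sigma_finite) unfold_locales
  have int_f: "integrable ?M (\<lambda>(u, v). kernel i j u v)"
    by (rule PP.integrable_const_bound[where B=1]) (auto intro!: AE_I2 K.H_abs)
  have gm: "(\<lambda>z. K.g (fst z)) \<in> borel_measurable ?F"
    using measurable_compose[OF fst K.g_measurable] .
  have int_g: "integrable ?M (\<lambda>z. K.g (fst z))"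
    by (rule PP.integrable_const_bound[where B=1]) (auto intro!: AE_I2 K.g_abs)
  have "AE z in ?M. proj_g P i j z = K.g (fst z)"
    unfolding proj_g_def
  proof (rule real_cond_exp_charact[OF _ int_f int_g gm])
    fix A assume "A \<in> sets ?F"
    then obtain B where B: "B \<in> sets P" "A = fst -` B \<inter> space ?M"
      by (subst (asm) sets_vimage_algebra2) (auto simp: space_pair_measure)
    have ind: "indicat_real A z = indicat_real B (fst z)" if "z \<in> space ?M" for z
      using that B by (auto simp: indicator_def)
    have "(\<integral>z\<in>A. (case z of (u, v) \<Rightarrow> kernel i j u v) \<partial>?M) = (\<integral>z. indicat_real B (fst z) * kernel i j (fst z) (snd z) \<partial>?M)"
      unfolding set_lebesgue_integral_def by (intro Bochner_Integration.integral_cong) (auto simp: ind)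
    also have "\<dots> = (\<integral>u. (\<integral>v. indicat_real B u * kernel i j u v \<partial>P) \<partial>P)"
    proof -
      have "integrable ?M (\<lambda>(u, v). indicat_real B u * kernel i j u v)"
        using B(1) K.H_abs
        by (intro PP.integrable_const_bound[where B=1]) (auto intro!: AE_I2 simp: indicator_def)
      from PP.integral_fst'[OF this] show ?thesis by (simp add: case_prod_beta')
    qed
    also have "\<dots> = (\<integral>u. (\<integral>v. indicat_real B u * K.g u \<partial>P) \<partial>P)"
      by (simp add: K.g_def[symmetric] K.prob_space)
    also have "\<dots> = (\<integral>z. indicat_real B (fst z) * K.g (fst z) \<partial>?M)"
    proof -
      have "integrable ?M (\<lambda>(u, v). indicat_real B u * K.g u)"
        using B(1) K.g_abs
        by (intro PP.integrable_const_bound[where B=1]) (auto intro!: AE_I2 simp: indicator_def)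
      from PP.integral_fst'[OF this] show ?thesis by (simp add: case_prod_beta')
    qed
    also have "\<dots> = (\<integral>z\<in>A. K.g (fst z) \<partial>?M)"
      unfolding set_lebesgue_integral_def by (intro Bochner_Integration.integral_cong) (auto simp: ind)
    finally show "(\<integral>z\<in>A. (case z of (u, v) \<Rightarrow> kernel i j u v) \<partial>?M) = (\<integral>z\<in>A. K.g (fst z) \<partial>?M)" .
  qed
  moreover have [measurable]: "proj_g P i j \<in> borel_measurable ?M"
    unfolding proj_g_def by (rule measurable_from_subalg[OF sub]) measurable
  moreover have m1: "(\<integral>z. f (fst z) \<partial>?M) = (\<integral>u. f u \<partial>P)"
    if [measurable]: "f \<in> borel_measurable P" and "\<And>u. \<bar>f u\<bar> \<le> 1" for f :: "_ \<Rightarrow> real"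
  proof -
    have "integrable ?M (\<lambda>(u, v). f u)"
      by (intro PP.integrable_const_bound[where B=1]) (auto intro!: AE_I2 that)
    from PP.integral_fst'[OF this] show ?thesis by (simp add: case_prod_beta' K.prob_space)
  qed
  ultimately have E: "(\<integral>z. f (proj_g P i j z) \<partial>?M) = (\<integral>u. f (K.g u) \<partial>P)"
    if [measurable]: "f \<in> borel_measurable borel" and "\<And>u. \<bar>f (K.g u)\<bar> \<le> B" "0 < B" for f :: "real \<Rightarrow> real" and B
  proof -
    have "(\<integral>z. f (proj_g P i j z) \<partial>?M) = (\<integral>z. f (K.g (fst z)) \<partial>?M)"
      using \<open>AE z in ?M. proj_g P i j z = K.g (fst z)\<close> by (intro integral_cong_AE) auto
    \<comment> \<open>The fact \<open>m1\<close> covers functions bounded by 1, hence the rescaling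
      by \<open>B\<close>; the square below needs \<open>B = 4\<close>.\<close>
    also have "\<dots> = B * (\<integral>z. f (K.g (fst z)) / B \<partial>?M)"
      using that by simp
    also have "(\<integral>z. f (K.g (fst z)) / B \<partial>?M) = (\<integral>u. f (K.g u) / B \<partial>P)"
      using that by (intro m1) (auto simp: abs_mult divide_le_eq)
    finally show ?thesis using that by simp
  qed
  have "zeta P i j = (\<integral>z. (proj_g P i j z - (\<integral>z. proj_g P i j z \<partial>?M))\<^sup>2 \<partial>?M)"
    unfolding zeta_def ..
  also have "(\<integral>z. proj_g P i j z \<partial>?M) = K.\<mu>"
    using E[of "\<lambda>x. x" 1] by (simp add: K.g_abs K.\<mu>_def)
  also have "(\<integral>z. (proj_g P i j z - K.\<mu>)\<^sup>2 \<partial>?M) = (\<integral>u. (K.g u - K.\<mu>)\<^sup>2 \<partial>P)"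
  proof (rule E)
    fix u
    have "\<bar>K.g u - K.\<mu>\<bar> \<le> 2"
      using K.g_abs[of u] K.\<mu>_abs by linarith
    then show "\<bar>(K.g u - K.\<mu>)\<^sup>2\<bar> \<le> 2 * 2"
      unfolding power2_eq_square by (intro K.abs_mult_le)
  qed auto
  also have "\<dots> = K.\<kappa> - K.\<mu>\<^sup>2"
    using K.variance_eq[OF K.g_integrable] unfolding K.\<kappa>_def K.\<mu>_def .
  finally show ?thesis .
qed

end

section \<open>Absence of ties\<close>

lemma continuous_marginals_null:
  assumes law: "is_law d P" "continuous_marginals d P" "i < d"
  shows "AE y in P. y i \<noteq> a"
proof -
  interpret prob_space P using law by (simp add: is_law_def)
  note [measurable] = law_component_measurable[OF law(1,3)]
  interpret D: real_distribution "distr P borel (\<lambda>x. x i)"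
    by (rule real_distribution_distr) measurable
  have "isCont (cdf (distr P borel (\<lambda>x. x i))) a"
    using law unfolding continuous_marginals_def by (simp add: continuous_on_eq_continuous_at)
  then have "measure (distr P borel (\<lambda>x. x i)) {a} = 0"
    by (simp add: D.isCont_cdf)
  then have "prob {y \<in> space P. y i = a} = 0"
    by (subst (asm) measure_distr) (auto intro!: arg_cong[where f=prob] simp: vimage_def Int_def conj_commute)
  then show ?thesis
    by (subst (asm) prob_eq_0) auto
qed

text \<open>Without ties the sign kernel is almost surely 2 c - 1, so its projection is 2 g_c - 1
  and its variance is four times that of g_c. This reconciles the factor 16 of the plug-in estimator
  with the 4 \<zeta> of the jackknife, and it is where continuity of the marginals enters part
  (i).\<close>

lemma concordant_zeta_eq:
  assumes law: "is_law d P" "continuous_marginals d P" and ij: "i < d" "j < d"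
  defines "c \<equiv> \<lambda>u v. of_bool (concordant i j u v)"
  shows "16 * (sym_kernel.\<kappa> P c - (sym_kernel.\<mu> P c)\<^sup>2) = 4 * zeta P i j"
proof -
  interpret K: sym_kernel P "kernel i j"
    using law(1) ij by (rule sym_kernel_kernel)
  interpret C: sym_kernel P c
    unfolding c_def using law(1) ij by (rule sym_kernel_concordant)
  have g: "K.g x = 2 * C.g x - 1" if x: "x \<in> space P" for x
  proof -
    have "K.g x = (\<integral>y. 2 * c x y - 1 \<partial>P)"
      unfolding K.g_def
    proof (rule integral_cong_AE)
      show "AE y in P. kernel i j x y = 2 * c x y - 1"
        using continuous_marginals_null[OF law ij(1), of "x i"] continuous_marginals_null[OF law ij(2), of "x j"]
        by eventually_elim (auto simp: kernel_def c_def concordant_def sgn_if zero_less_mult_iff)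
    qed (use x in auto)
    also have "\<dots> = 2 * C.g x - 1"
      using C.H_integrable[OF x] by (simp add: C.g_def K.prob_space)
    finally show ?thesis .
  qed
  have mu: "K.\<mu> = 2 * C.\<mu> - 1"
  proof -
    have "K.\<mu> = (\<integral>x. 2 * C.g x - 1 \<partial>P)"
      unfolding K.\<mu>_def by (intro Bochner_Integration.integral_cong) (auto simp: g)
    then show ?thesis
      using C.g_integrable by (simp add: C.\<mu>_def K.prob_space)
  qed
  have "K.\<kappa> = (\<integral>x. 4 * (C.g x)\<^sup>2 - 4 * C.g x + 1 \<partial>P)"
    unfolding K.\<kappa>_def by (intro Bochner_Integration.integral_cong) (auto simp: g power2_eq_square algebra_simps)
  also have "\<dots> = 4 * C.\<kappa> - 4 * C.\<mu> + 1"
    using C.g_integrable by (simp add: C.\<mu>_def C.\<kappa>_def K.prob_space)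
  finally show ?thesis
    unfolding zeta_eq[OF law(1) ij] mu by (simp add: power2_eq_square algebra_simps)
qed


subsection \<open>Power of the maximum test\<close>

lemma square_diff_deviation:
  fixes t :: real
  assumes "\<bar>t - \<mu>\<bar> < \<eta>" "\<bar>s - \<kappa>\<bar> < \<eta>" "\<bar>t\<bar> \<le> 1" "\<bar>\<mu>\<bar> \<le> 1"
  shows "\<bar>(s - t\<^sup>2) - (\<kappa> - \<mu>\<^sup>2)\<bar> \<le> 3 * \<eta>"
proof -
  have "\<bar>t\<^sup>2 - \<mu>\<^sup>2\<bar> = \<bar>t - \<mu>\<bar> * \<bar>t + \<mu>\<bar>"
    by (simp add: abs_mult[symmetric] power2_eq_square algebra_simps)
  also have "\<dots> \<le> \<eta> * 2"
    using assms by (intro mult_mono) auto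
  finally show ?thesis
    using assms by linarith
qed

lemma affine_deviation:
  fixes z :: real
  assumes "\<bar>z - k\<bar> \<le> a" "\<bar>q\<bar> \<le> b" "0 \<le> c"
  shows "\<bar>c * z + q - c * k\<bar> \<le> c * a + b"
proof -
  have "\<bar>c * (z - k) + q\<bar> \<le> \<bar>c * (z - k)\<bar> + \<bar>q\<bar>"
    by (rule abs_triangle_ineq)
  also have "\<dots> \<le> c * a + b"
    using assms by (intro add_mono) (auto simp: abs_mult mult_left_mono)
  finally show ?thesis by (simp add: algebra_simps)
qed

text \<open>No measurability of \<open>Q\<close> is asked for: the bad set only has to lie in the
  union of two measurable deviation events. The constant is 104 = 36 + 2 * 34, using n - 1 \<ge> n /
  2.\<close>

lemma (in sym_kernel) ustat_mean_square_deviation: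
  assumes n: "2 \<le> n" and \<eta>: "0 < \<eta>"
    and good: "\<And>x. \<bar>ustat n x - \<mu>\<bar> < \<eta> \<Longrightarrow> \<bar>mean_square n x - \<kappa>\<bar> < \<eta> \<Longrightarrow> Q x"
  shows "measure (sample n) {x \<in> space (sample n). \<not> Q x} \<le> 104 / (real n * \<eta>\<^sup>2)"
proof -
  interpret N: prob_space "sample n" by (rule prob_space_sample)
  let ?A = "{x \<in> space (sample n). \<eta> \<le> \<bar>ustat n x - \<mu>\<bar>}"
  let ?B = "{x \<in> space (sample n). \<eta> \<le> \<bar>mean_square n x - \<kappa>\<bar>}"
  have "measure (sample n) {x \<in> space (sample n). \<not> Q x} \<le> measure (sample n) (?A \<union> ?B)"
    by (rule N.finite_measure_mono) (use good in \<open>force simp: not_le\<close>, measurable)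
  also have "\<dots> \<le> measure (sample n) ?A + measure (sample n) ?B"
    by (rule measure_Un_le) measurable
  also have "\<dots> \<le> 36 / (real n * \<eta>\<^sup>2) + 34 / ((real n - 1) * \<eta>\<^sup>2)"
    by (intro add_mono ustat_deviation mean_square_deviation n \<eta>)
  also have "34 / ((real n - 1) * \<eta>\<^sup>2) \<le> 34 / ((real n / 2) * \<eta>\<^sup>2)"
    using n \<eta> by (intro divide_left_mono mult_right_mono mult_pos_pos) auto
  finally show ?thesis
    by (simp add: add_divide_distrib[symmetric])
qed

section \<open>Concentration of the variance estimators\<close>

context
  fixes d :: nat and P :: "(nat \<Rightarrow> real) measure" and i j :: nat and r :: real and n :: nat
  assumes law: "is_law d P" and ij: "i < d" "j < d"
    and r: "0 < r" "r < zeta P i j" and n: "4 \<le> n" "64 \<le> r * real n"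
begin

text \<open>The target is 4 \<zeta>, and the window allows an error of 2 \<zeta> > 2 r. Deviations
  of size r / 12 cost 4 * 3 * r / 12 = r, and the excess of the jackknife factor over 4 costs at
  most another r. The constant 240000 is shared with the plug-in estimator, where 104 * 48^2 =
  239616 is needed.\<close>

lemma var_jack_deviation:
  "measure (iid n P) {x \<in> space (iid n P). \<not> (2 * zeta P i j \<le> real n * var_jack n x i j \<and>
      real n * var_jack n x i j \<le> 6 * zeta P i j)} \<le> 240000 / (real n * r\<^sup>2)"
proof -
  interpret K: sym_kernel P "kernel i j"
    using law ij by (rule sym_kernel_kernel)
  let ?a = "4 * real n * (real n - 1) / (real n - 2)\<^sup>2"
  have "?a - 4 = 4 * (3 * real n - 4) / (real n - 2)\<^sup>2"
    using n by (simp add: divide_simps) (simp add: power2_eq_square algebra_simps)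
  \<comment> \<open>Here n - 2 \<ge> n / 2, by n \<ge> 4.\<close>
  also have "\<dots> \<le> 4 * (3 * real n) / (real n / 2)\<^sup>2"
    using n by (intro frac_le mult_left_mono power_mono) auto
  also have "\<dots> = 48 / real n"
    using n by (simp add: power2_eq_square field_simps)
  also have "\<dots> \<le> r"
    using n by (simp add: divide_le_eq)
  finally have a1: "?a - 4 \<le> r" .
  have a0: "0 \<le> ?a - 4"
    using n by (simp add: divide_simps) (simp add: power2_eq_square algebra_simps)
  have "measure (K.sample n) {x \<in> space (K.sample n). \<not> (2 * zeta P i j \<le> real n * var_jack n x i j \<and>
      real n * var_jack n x i j \<le> 6 * zeta P i j)} \<le> 104 / (real n * (r / 12)\<^sup>2)"
  proof (rule K.ustat_mean_square_deviation)
    fix x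
    assume "\<bar>K.ustat n x - K.\<mu>\<bar> < r / 12" "\<bar>K.mean_square n x - K.\<kappa>\<bar> < r / 12"
    then have dev: "\<bar>(K.mean_square n x - (K.ustat n x)\<^sup>2) - (K.\<kappa> - K.\<mu>\<^sup>2)\<bar> \<le> 3 * (r / 12)"
      using n by (intro square_diff_deviation) (auto intro: K.ustat_abs K.\<mu>_abs)
    define z where "z = K.mean_square n x - (K.ustat n x)\<^sup>2"
    have z: "\<bar>z\<bar> \<le> 1"
    proof -
      have "(K.ustat n x)\<^sup>2 \<le> 1"
        using K.ustat_abs[of n x] n by (simp add: abs_square_le_1)
      moreover have "0 \<le> (K.ustat n x)\<^sup>2" "0 \<le> K.mean_square n x" "K.mean_square n x \<le> 1"
        using K.mean_square_bounds[of n x] n by auto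
      ultimately show ?thesis
        unfolding z_def abs_le_iff by (metis diff_mono diff_zero minus_diff_eq)
    qed
    have "real n * var_jack n x i j = ?a * z"
      using n unfolding z_def var_jack_eq[OF law ij, of n, simplified] by (subst var_jack_eq[OF law ij]) auto
    also have "\<dots> = 4 * z + (?a - 4) * z"
      by (simp add: algebra_simps)
    finally have eq: "real n * var_jack n x i j = 4 * z + (?a - 4) * z" .
    have "\<bar>(?a - 4) * z\<bar> \<le> r * 1"
      using a0 a1 z r by (intro K.abs_mult_le) auto
    then have "\<bar>real n * var_jack n x i j - 4 * zeta P i j\<bar> \<le> 4 * (3 * (r / 12)) + r"
      using affine_deviation[OF dev, of "(?a - 4) * z" r 4] unfolding eq zeta_eq[OF law ij] z_def[symmetric] by simp
    then show "2 * zeta P i j \<le> real n * var_jack n x i j \<and> real n * var_jack n x i j \<le> 6 * zeta P i j"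
      using r by linarith
  qed (use n r in auto)
  also have "\<dots> \<le> 240000 / (real n * r\<^sup>2)"
    using r n by (simp add: power_divide frac_le)
  finally show ?thesis
    unfolding iid_def .
qed

text \<open>As for the jackknife, but with prefactor 16, so the deviations are taken of size r / 48.
  The second error of size r comes from the triples with repeated indices: \<bar>e\<bar> \<le> 4 / n
  \<le> r / 16, which is the origin of the condition 64 \<le> r n.\<close>

lemma var_plug_deviation:
  assumes cont: "continuous_marginals d P"
  shows "measure (iid n P) {x \<in> space (iid n P). \<not> (2 * zeta P i j \<le> real n * var_plug n x i j \<and>
      real n * var_plug n x i j \<le> 6 * zeta P i j)} \<le> 240000 / (real n * r\<^sup>2)"
proof -
  interpret C: sym_kernel P "\<lambda>u v. of_bool (concordant i j u v)"
    using law ij by (rule sym_kernel_concordant)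
  have "measure (C.sample n) {x \<in> space (C.sample n). \<not> (2 * zeta P i j \<le> real n * var_plug n x i j \<and>
      real n * var_plug n x i j \<le> 6 * zeta P i j)} \<le> 104 / (real n * (r / 48)\<^sup>2)"
  proof (rule C.ustat_mean_square_deviation)
    fix x
    assume "\<bar>C.ustat n x - C.\<mu>\<bar> < r / 48" "\<bar>C.mean_square n x - C.\<kappa>\<bar> < r / 48"
    then have dev: "\<bar>(C.mean_square n x - (C.ustat n x)\<^sup>2) - (C.\<kappa> - C.\<mu>\<^sup>2)\<bar> \<le> 3 * (r / 48)"
      using n by (intro square_diff_deviation) (auto intro: C.ustat_abs C.\<mu>_abs)
    define e where "e = (C.mean_square n x - C.ustat n x) / (real n - 2)"
    have Pcc: "Pi_cc_hat n x i j = C.mean_square n x + e"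
      using n unfolding e_def by (subst Pi_cc_hat_eq[OF law ij]) (auto simp: field_simps)
    have "\<bar>C.mean_square n x - C.ustat n x\<bar> \<le> 2"
      using C.mean_square_bounds[of n x] C.ustat_abs[of n x] n by simp
    then have "\<bar>e\<bar> \<le> 2 / (real n / 2)"
      using n unfolding e_def abs_divide by (intro frac_le) auto
    also have "\<dots> \<le> r / 16"
      using n by (simp add: divide_simps mult.commute)
    finally have e: "\<bar>e\<bar> \<le> r / 16" .
    have "real n * var_plug n x i j = 16 * (C.mean_square n x + e - (C.ustat n x)\<^sup>2)"
      using n unfolding var_plug_def Pcc Pi_c_hat_eq[OF law ij] by simp
    then have "real n * var_plug n x i j = 16 * (C.mean_square n x - (C.ustat n x)\<^sup>2) + 16 * e"
      by (simp add: algebra_simps)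
    then have "\<bar>real n * var_plug n x i j - 16 * (C.\<kappa> - C.\<mu>\<^sup>2)\<bar> \<le> 16 * (3 * (r / 48)) + r"
      using affine_deviation[OF dev, of "16 * e" r 16] e by simp
    then show "2 * zeta P i j \<le> real n * var_plug n x i j \<and> real n * var_plug n x i j \<le> 6 * zeta P i j"
      using r unfolding concordant_zeta_eq[OF law cont ij] by linarith
  qed (use n r in auto)
  also have "\<dots> \<le> 240000 / (real n * r\<^sup>2)"
    using r n by (simp add: power_divide frac_le)
  finally show ?thesis
    unfolding iid_def .
qed

end

lemma tau_hat_measurable:
  assumes "is_law d P" "i < d" "j < d"
  shows "(\<lambda>x. tau_hat n x i j) \<in> borel_measurable (iid n P)"
proof -
  interpret K: sym_kernel P "kernel i j"
    using assms by (rule sym_kernel_kernel)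
  show ?thesis
    unfolding tau_hat_eq_ustat[OF assms] iid_def by (rule K.ustat_measurable)
qed

lemma var_jack_measurable:
  assumes "is_law d P" "i < d" "j < d" "2 \<le> n"
  shows "(\<lambda>x. var_jack n x i j) \<in> borel_measurable (iid n P)"
proof -
  interpret K: sym_kernel P "kernel i j"
    using assms(1-3) by (rule sym_kernel_kernel)
  show ?thesis
    unfolding var_jack_eq[OF assms] iid_def by measurable
qed

lemma var_plug_measurable:
  assumes "is_law d P" "i < d" "j < d" "3 \<le> n"
  shows "(\<lambda>x. var_plug n x i j) \<in> borel_measurable (iid n P)"
proof -
  interpret C: sym_kernel P "\<lambda>u v. of_bool (concordant i j u v)"
    using assms(1-3) by (rule sym_kernel_concordant)
  show ?thesis
    unfolding var_plug_def Pi_cc_hat_eq[OF assms] Pi_c_hat_eq[OF assms(1-3)] iid_def by measurable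
qed

lemma tau_hat_deviation:
  assumes "is_law d P" "i < d" "j < d" "2 \<le> n" "0 < \<eta>"
  shows "measure (iid n P) {x \<in> space (iid n P). \<eta> \<le> \<bar>tau_hat n x i j - tau n P i j\<bar>} \<le> 36 / (real n * \<eta>\<^sup>2)"
proof -
  interpret K: sym_kernel P "kernel i j"
    using assms(1-3) by (rule sym_kernel_kernel)
  show ?thesis
    unfolding tau_hat_eq_ustat[OF assms(1-3)] tau_eq[OF assms(1-4)] iid_def
    using assms by (intro K.ustat_deviation)
qed

section \<open>From one pair of coordinates to rejection\<close>

lemma finite_index_pairs: "finite (index_pairs d)"
  by (rule finite_subset[of _ "{..<d} \<times> {..<d}"]) (auto simp: index_pairs_def)

lemma index_pairs_nonempty: "2 \<le> d \<Longrightarrow> index_pairs d \<noteq> {}"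
  unfolding index_pairs_def by (intro ex_in_conv[THEN iffD1] exI[of _ "(0, 1)"]) simp

lemma measure_pair_rectangles:
  assumes "prob_space M" "prob_space N"
  shows "A \<in> sets M \<Longrightarrow> measure (M \<Otimes>\<^sub>M N) {\<omega> \<in> space (M \<Otimes>\<^sub>M N). fst \<omega> \<in> A} = measure M A"
    and "B \<in> sets N \<Longrightarrow> measure (M \<Otimes>\<^sub>M N) {\<omega> \<in> space (M \<Otimes>\<^sub>M N). snd \<omega> \<in> B} = measure N B"
proof -
  interpret M: prob_space M by fact
  interpret N: prob_space N by fact
  show "measure (M \<Otimes>\<^sub>M N) {\<omega> \<in> space (M \<Otimes>\<^sub>M N). fst \<omega> \<in> A} = measure M A" if "A \<in> sets M"
  proof -
    have "{\<omega> \<in> space (M \<Otimes>\<^sub>M N). fst \<omega> \<in> A} = A \<times> space N"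
      using sets.sets_into_space[OF that] by (auto simp: space_pair_measure)
    then show ?thesis
      using that by (simp add: measure_def N.emeasure_pair_measure_Times N.emeasure_space_1)
  qed
  show "measure (M \<Otimes>\<^sub>M N) {\<omega> \<in> space (M \<Otimes>\<^sub>M N). snd \<omega> \<in> B} = measure N B" if "B \<in> sets N"
  proof -
    have "{\<omega> \<in> space (M \<Otimes>\<^sub>M N). snd \<omega> \<in> B} = space M \<times> B"
      using sets.sets_into_space[OF that] by (auto simp: space_pair_measure)
    then show ?thesis
      using that by (simp add: measure_def N.emeasure_pair_measure_Times M.emeasure_space_1)
  qed
qed

lemma prob_space_two_sample:
  "is_law d P \<Longrightarrow> is_law d Q \<Longrightarrow> prob_space (two_sample n1 n2 P Q)"
  unfolding two_sample_def by (intro prob_space_pair prob_space_iid)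

text \<open>The denominator \<open>D\<close> is abstract so that random and deterministic ones are
  treated alike; \<open>e\<close> bounds the probability that it is not positive or exceeds 3 v / 2.
  With deviation threshold (v log d)^(1/2) / 2, Chebyshev gives 144 / (v n_a log d), and
  \<open>c1\<close>, \<open>c2\<close> make this independent of the laws. Measurability is required
  at all pairs because the rejection event involves the maximum.\<close>

lemma rejection_prob_ge:
  fixes D :: "(nat \<Rightarrow> nat \<Rightarrow> real) \<Rightarrow> (nat \<Rightarrow> nat \<Rightarrow> real) \<Rightarrow> nat \<Rightarrow> nat \<Rightarrow> real"
  assumes law: "is_law d P" "is_law d Q" and n: "2 \<le> n1" "2 \<le> n2"
    and meas: "\<And>i j. (i, j) \<in> index_pairs d \<Longrightarrow>
        (\<lambda>\<omega>. D (fst \<omega>) (snd \<omega>) i j) \<in> borel_measurable (two_sample n1 n2 P Q)"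
    and ij: "(i, j) \<in> index_pairs d"
    and L: "0 < ln (real d)" "G_inv \<alpha> \<le> 2 * ln (real d) + ln (ln (real d))"
    and v: "0 < v" and gap: "4 * sqrt (ln (real d)) * sqrt v \<le> \<bar>tau n1 P i j - tau n2 Q i j\<bar>"
    and c: "0 < c1" "c1 \<le> v * real n1" "0 < c2" "c2 \<le> v * real n2"
    and D: "measure (two_sample n1 n2 P Q) {\<omega> \<in> space (two_sample n1 n2 P Q).
        \<not> (0 < D (fst \<omega>) (snd \<omega>) i j \<and> D (fst \<omega>) (snd \<omega>) i j \<le> 3 / 2 * v)} \<le> e"
  shows "1 - (144 / (c1 * ln (real d)) + 144 / (c2 * ln (real d)) + e)
    \<le> rejection_prob \<alpha> n1 n2 d (\<lambda>(x, y). max_stat n1 n2 d (D x y) (x, y)) P Q"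
proof -
  let ?T = "two_sample n1 n2 P Q" and ?L = "ln (real d)"
  let ?s = "sqrt (?L * v)"
  interpret T: prob_space ?T using law by (rule prob_space_two_sample)
  have s: "0 < ?s" using L v by simp
  have d: "2 \<le> d" "i < d" "j < d" using ij by (auto simp: index_pairs_def)
  define stat where "stat \<omega> p = (tau_hat n1 (fst \<omega>) (fst p) (snd p) - tau_hat n2 (snd \<omega>) (fst p) (snd p))\<^sup>2
      / D (fst \<omega>) (snd \<omega>) (fst p) (snd p)" for \<omega> p
  define M where "M = (\<lambda>(x, y). max_stat n1 n2 d (D x y) (x, y))"
  have M_eq: "M \<omega> = Max ((\<lambda>p. stat \<omega> p) ` index_pairs d)" for \<omega>
    unfolding M_def max_stat_def stat_def by (simp add: case_prod_beta')
  have tau_meas: "(\<lambda>\<omega>. tau_hat n1 (fst \<omega>) k l) \<in> borel_measurable ?T"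
      "(\<lambda>\<omega>. tau_hat n2 (snd \<omega>) k l) \<in> borel_measurable ?T" if "k < d" "l < d" for k l
    unfolding two_sample_def
    using measurable_compose[OF measurable_fst tau_hat_measurable[OF law(1) that]]
      measurable_compose[OF measurable_snd tau_hat_measurable[OF law(2) that]] by auto
  have M_meas [measurable]: "M \<in> borel_measurable ?T"
    unfolding M_eq
  proof (rule borel_measurable_Max[OF finite_index_pairs])
    fix p assume "p \<in> index_pairs d"
    then show "(\<lambda>\<omega>. stat \<omega> p) \<in> borel_measurable ?T"
      unfolding stat_def
      by (intro borel_measurable_divide borel_measurable_power borel_measurable_diff tau_meas meas)
        (auto simp: index_pairs_def)
  qed
  define A where "A = {x \<in> space (iid n1 P). ?s / 2 \<le> \<bar>tau_hat n1 x i j - tau n1 P i j\<bar>}"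
  define B where "B = {x \<in> space (iid n2 Q). ?s / 2 \<le> \<bar>tau_hat n2 x i j - tau n2 Q i j\<bar>}"
  define C where "C = {\<omega> \<in> space ?T. \<not> (0 < D (fst \<omega>) (snd \<omega>) i j \<and> D (fst \<omega>) (snd \<omega>) i j \<le> 3 / 2 * v)}"
  define A' where "A' = {\<omega> \<in> space ?T. fst \<omega> \<in> A}"
  define B' where "B' = {\<omega> \<in> space ?T. snd \<omega> \<in> B}"
  note [measurable] = tau_hat_measurable[OF law(1) d(2,3)] tau_hat_measurable[OF law(2) d(2,3)] meas[OF ij]
  have AB: "A \<in> sets (iid n1 P)" "B \<in> sets (iid n2 Q)"
    unfolding A_def B_def by measurable
  have ABC [measurable]: "A' \<in> sets ?T" "B' \<in> sets ?T" "C \<in> sets ?T"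
    using AB unfolding A'_def B'_def C_def two_sample_def[symmetric]
    by (auto simp: two_sample_def intro!: measurable_sets_Collect[OF measurable_fst] measurable_sets_Collect[OF measurable_snd])
       (use meas[OF ij] in \<open>simp add: two_sample_def\<close>)
  have bound: "36 / (real m * (?s / 2)\<^sup>2) \<le> 144 / (c * ?L)" if "0 < c" "c \<le> v * real m" for m c
  proof -
    have "(?s / 2)\<^sup>2 = ?L * v / 4"
      using L v by (simp add: power_divide)
    then have "36 / (real m * (?s / 2)\<^sup>2) = 36 / (real m * (?L * v / 4))"
      by (simp only:)
    also have "\<dots> = 144 / ((v * real m) * ?L)"
      by (simp add: mult_ac)
    also have "\<dots> \<le> 144 / (c * ?L)"
    proof (rule divide_left_mono)
      show "c * ?L \<le> v * real m * ?L"
        using that L by (intro mult_right_mono) auto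
      show "0 < v * real m * ?L * (c * ?L)"
        using that L less_le_trans[OF that] by (intro mult_pos_pos[of "v * real m * ?L"] mult_pos_pos[of "v * real m"] mult_pos_pos[of c])
    qed simp
    finally show ?thesis .
  qed
  have "T.prob A' = measure (iid n1 P) A"
    using AB measure_pair_rectangles(1)[OF prob_space_iid[OF law(1)] prob_space_iid[OF law(2)]]
    unfolding A'_def two_sample_def by simp
  also have "\<dots> \<le> 36 / (real n1 * (?s / 2)\<^sup>2)"
    unfolding A_def using s by (intro tau_hat_deviation[OF law(1) d(2,3) n(1)]) simp
  also note bound[OF c(1,2)]
  finally have A'_le: "T.prob A' \<le> 144 / (c1 * ?L)" .
  have "T.prob B' = measure (iid n2 Q) B"
    using AB measure_pair_rectangles(2)[OF prob_space_iid[OF law(1)] prob_space_iid[OF law(2)]]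
    unfolding B'_def two_sample_def by simp
  also have "\<dots> \<le> 36 / (real n2 * (?s / 2)\<^sup>2)"
    unfolding B_def using s by (intro tau_hat_deviation[OF law(2) d(2,3) n(2)]) simp
  also note bound[OF c(3,4)]
  finally have B'_le: "T.prob B' \<le> 144 / (c2 * ?L)" .
  have reject: "test \<alpha> d (M \<omega>) = 1" if \<omega>: "\<omega> \<in> space ?T" "\<omega> \<notin> A' \<union> B' \<union> C" for \<omega>
  proof -
    let ?t1 = "tau_hat n1 (fst \<omega>) i j" and ?t2 = "tau_hat n2 (snd \<omega>) i j" and ?D = "D (fst \<omega>) (snd \<omega>) i j"
    have "fst \<omega> \<in> space (iid n1 P)" "snd \<omega> \<in> space (iid n2 Q)"
      using \<omega>(1) by (auto simp: two_sample_def space_pair_measure)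
    then have dev: "\<bar>?t1 - tau n1 P i j\<bar> < ?s / 2" "\<bar>?t2 - tau n2 Q i j\<bar> < ?s / 2"
      using \<omega> by (auto simp: A'_def B'_def A_def B_def not_le)
    have D: "0 < ?D" "?D \<le> 3 / 2 * v"
      using \<omega> by (auto simp: C_def)
    have "4 * ?s \<le> \<bar>tau n1 P i j - tau n2 Q i j\<bar>"
      using gap L v by (simp add: real_sqrt_mult)
    then have "3 * ?s \<le> \<bar>?t1 - ?t2\<bar>"
      using dev by linarith
    then have "(3 * ?s)\<^sup>2 \<le> (?t1 - ?t2)\<^sup>2"
      using s by (intro abs_le_square_iff[THEN iffD1]) auto
    then have sq: "9 * (?L * v) \<le> (?t1 - ?t2)\<^sup>2"
      using L v by (simp add: power_mult_distrib)
    \<comment> \<open>The 9 is (4 - 1/2 - 1/2)^2. The surplus 6 - 4 = 2 over the critical value has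
      to absorb \<open>G_inv \<alpha>\<close>, which is the second assumption in
      \<open>L\<close>.\<close>
    have "6 * ?L = 9 * (?L * v) / (3 / 2 * v)"
      using v by simp
    also have "\<dots> \<le> (?t1 - ?t2)\<^sup>2 / ?D"
      using sq D L v by (intro frac_le) auto
    also have "\<dots> = stat \<omega> (i, j)"
      unfolding stat_def by simp
    also have "\<dots> \<le> M \<omega>"
      unfolding M_eq using ij finite_index_pairs by (intro Max_ge) auto
    finally show ?thesis
      using L unfolding test_def by simp
  qed
  have "1 - (T.prob A' + T.prob B' + T.prob C) \<le> 1 - T.prob (A' \<union> B' \<union> C)"
    using measure_Un_le[of "A' \<union> B'" ?T C] measure_Un_le[of A' ?T B'] ABC by simp
  also have "\<dots> = T.prob (space ?T - (A' \<union> B' \<union> C))"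
    using ABC by (intro T.prob_compl[symmetric]) auto
  also have "\<dots> \<le> T.prob {\<omega> \<in> space ?T. test \<alpha> d (M \<omega>) = 1}"
  proof (rule T.finite_measure_mono)
    show "{\<omega> \<in> space ?T. test \<alpha> d (M \<omega>) = 1} \<in> sets ?T"
      unfolding test_def of_bool_eq_1_iff by measurable
  qed (use reject in blast)
  finally show ?thesis
    using A'_le B'_le D unfolding rejection_prob_def M_def[symmetric] C_def[symmetric] by linarith
qed

text \<open>The condition \<open>0 \<le> e m\<close> puts \<open>1 - e m\<close> below the inserted
  element 1 as well, so it bounds the whole set.\<close>

lemma inf_prob_tendsto_1:
  assumes "e \<longlonglongrightarrow> 0" "eventually (\<lambda>m. 0 \<le> e m) sequentially"
    and "eventually (\<lambda>m. \<forall>x\<in>S m. 1 - e m \<le> x) sequentially"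
  shows "(\<lambda>m. inf_prob (S m)) \<longlonglongrightarrow> 1"
proof (rule tendsto_sandwich[where f="\<lambda>m. 1 - e m" and h="\<lambda>_. 1"])
  show "eventually (\<lambda>m. 1 - e m \<le> inf_prob (S m)) sequentially"
    using assms(2,3) by eventually_elim (auto simp: inf_prob_def intro!: cInf_greatest)
  show "eventually (\<lambda>m. inf_prob (S m) \<le> 1) sequentially"
    using assms(3)
  proof eventually_elim
    case (elim m)
    \<comment> \<open>An infimum of reals is at most each element only if the set is bounded below;
      the assumed bound supplies this too.\<close>
    have "bdd_below (insert 1 (S m))"
      using elim by (auto simp: bdd_below_insert intro!: bdd_belowI[of _ "1 - e m"])
    then show ?case
      unfolding inf_prob_def by (intro cInf_lower) auto
  qed
qed (use tendsto_diff[OF tendsto_const[of 1] assms(1)] in auto)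


subsection \<open>The uniform distribution on the sphere\<close>

abbreviation vec_lborel :: "nat \<Rightarrow> (nat \<Rightarrow> real) measure" where
  "vec_lborel p \<equiv> PiM {..<p} (\<lambda>_. lborel)"

definition unit_ball :: "nat \<Rightarrow> (nat \<Rightarrow> real) set" where
  "unit_ball p = {x \<in> space (vec_lborel p). (\<Sum>k<p. (x k)\<^sup>2) \<le> 1}"

definition direction :: "nat \<Rightarrow> (nat \<Rightarrow> real) \<Rightarrow> nat \<Rightarrow> real" where
  "direction p x = (\<lambda>i\<in>{..<p}. x i / sqrt (\<Sum>k<p. (x k)\<^sup>2))"

text \<open>The symmetries of the cube. They map boxes to boxes, so invariance of the product
  Lebesgue measure can be checked on boxes, and they preserve the Euclidean norm, so it passes to
  the sphere. Permutations serve exchangeability and sign changes serve symmetrization.\<close>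

definition signed_perm :: "nat \<Rightarrow> (nat \<Rightarrow> real) \<Rightarrow> (nat \<Rightarrow> nat) \<Rightarrow> (nat \<Rightarrow> real) \<Rightarrow> nat \<Rightarrow> real" where
  "signed_perm p s \<pi> x = (\<lambda>i\<in>{..<p}. s i * x (\<pi> i))"

lemma sphere_unif_eq:
  "sphere_unif p = distr (uniform_measure (vec_lborel p) (unit_ball p)) (vec_borel p) (direction p)"
  unfolding sphere_unif_def unit_ball_def direction_def ..

lemma sets_vec_lborel: "sets (vec_lborel p) = sets (vec_borel p)"
  by (intro sets_PiM_cong) auto

lemma unit_ball_sets [measurable]: "unit_ball p \<in> sets (vec_lborel p)"
  unfolding unit_ball_def by measurable

lemma direction_measurable [measurable]: "direction p \<in> measurable (vec_lborel p) (vec_borel p)"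
  unfolding direction_def by (intro measurable_restrict) measurable

lemma signed_perm_measurable:
  assumes "\<pi> \<in> {..<p} \<rightarrow> {..<p}" "sets M = sets (vec_borel p)" "sets N = sets (vec_borel p)"
  shows "signed_perm p s \<pi> \<in> measurable M N"
proof -
  have "signed_perm p s \<pi> \<in> measurable (vec_borel p) (vec_borel p)"
    unfolding signed_perm_def
    by (intro measurable_restrict borel_measurable_times borel_measurable_const measurable_component_singleton)
      (use assms(1) in auto)
  then show ?thesis
    using measurable_cong_sets[OF assms(2,3)] by simp
qed

lemma emeasure_unit_ball: "emeasure (vec_lborel p) (unit_ball p) \<noteq> 0" "emeasure (vec_lborel p) (unit_ball p) \<noteq> \<infinity>"
proof -
  interpret product_sigma_finite "\<lambda>_::nat. lborel :: real measure"
    by unfold_locales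
  \<comment> \<open>The side 1 / p is chosen since p (1 / p)^2 \<le> 1. For p = 0 both sets are the
    one-point space.\<close>
  have "(\<Pi>\<^sub>E k\<in>{..<p}. {0..1 / real p}) \<subseteq> unit_ball p"
  proof
    fix x assume x: "x \<in> (\<Pi>\<^sub>E k\<in>{..<p}. {0..1 / real p})"
    have "(\<Sum>k<p. (x k)\<^sup>2) \<le> (\<Sum>k<p. (1 / real p)\<^sup>2)"
      using x by (intro sum_mono power_mono) (auto simp: PiE_iff)
    also have "\<dots> \<le> 1"
      by (cases "p = 0") (auto simp: power2_eq_square divide_simps)
    finally show "x \<in> unit_ball p"
      using x unfolding unit_ball_def by (auto simp: space_PiM)
  qed
  then have "emeasure (vec_lborel p) (\<Pi>\<^sub>E k\<in>{..<p}. {0..1 / real p}) \<le> emeasure (vec_lborel p) (unit_ball p)"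
    by (intro emeasure_mono) auto
  moreover have "emeasure (vec_lborel p) (\<Pi>\<^sub>E k\<in>{..<p}. {0..1 / real p}) \<noteq> 0"
    by (subst emeasure_PiM) auto
  ultimately show "emeasure (vec_lborel p) (unit_ball p) \<noteq> 0"
    by auto
  have "unit_ball p \<subseteq> (\<Pi>\<^sub>E k\<in>{..<p}. {-1..1})"
  proof
    fix x assume x: "x \<in> unit_ball p"
    have "\<bar>x k\<bar> \<le> 1" if "k < p" for k
    proof -
      have "(x k)\<^sup>2 \<le> (\<Sum>k<p. (x k)\<^sup>2)"
        using that by (intro member_le_sum) auto
      also have "\<dots> \<le> 1"
        using x by (simp add: unit_ball_def)
      finally show ?thesis
        by (simp add: abs_square_le_1)
    qed
    then show "x \<in> (\<Pi>\<^sub>E k\<in>{..<p}. {-1..1})"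
      using x by (auto simp: unit_ball_def space_PiM PiE_iff abs_le_iff minus_le_iff)
  qed
  then have "emeasure (vec_lborel p) (unit_ball p) \<le> emeasure (vec_lborel p) (\<Pi>\<^sub>E k\<in>{..<p}. {-1..1})"
    by (intro emeasure_mono) auto
  also have "\<dots> = (\<Prod>k<p. 2)"
    by (subst emeasure_PiM) auto
  also have "\<dots> < \<infinity>"
    by (simp add: power_less_top_ennreal)
  finally show "emeasure (vec_lborel p) (unit_ball p) \<noteq> \<infinity>"
    by simp
qed

lemma prob_space_uniform_ball: "prob_space (uniform_measure (vec_lborel p) (unit_ball p))"
  using emeasure_unit_ball by (rule prob_space_uniform_measure)

lemma prob_space_sphere_unif: "prob_space (sphere_unif p)"
  unfolding sphere_unif_eq by (intro prob_space.prob_space_distr[OF prob_space_uniform_ball]) simp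

lemma sets_sphere_unif [measurable_cong]: "sets (sphere_unif p) = sets (vec_borel p)"
  unfolding sphere_unif_eq by simp

text \<open>The hyperplane \<open>x k = 0\<close> is a box with one side of length 0, hence null
  even though its other sides are infinite. Off it the norm is positive, so normalizing keeps the
  coordinate nonzero.\<close>

lemma sphere_unif_nonzero:
  assumes k: "k < p"
  shows "AE u in sphere_unif p. u k \<noteq> 0"
proof -
  interpret product_sigma_finite "\<lambda>_::nat. lborel :: real measure"
    by unfold_locales
  have "emeasure (vec_lborel p) (\<Pi>\<^sub>E i\<in>{..<p}. if i = k then {0} else UNIV) = 0"
  proof -
    have "emeasure (vec_lborel p) (\<Pi>\<^sub>E i\<in>{..<p}. if i = k then {0} else UNIV)
        = (\<Prod>i<p. emeasure lborel (if i = k then {0::real} else UNIV))"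
      by (intro emeasure_PiM) auto
    also have "\<dots> = 0"
      using k by (intro prod_zero bexI[of _ k]) auto
    finally show ?thesis .
  qed
  moreover have "{x \<in> space (vec_lborel p). x k = 0} = (\<Pi>\<^sub>E i\<in>{..<p}. if i = k then {0} else UNIV)"
  proof (intro equalityI subsetI)
    fix x :: "nat \<Rightarrow> real"
    assume x: "x \<in> (\<Pi>\<^sub>E i\<in>{..<p}. if i = k then {0} else UNIV)"
    then have "x k = 0"
      using PiE_mem[of x "{..<p}" "\<lambda>i. if i = k then {0} else UNIV" k] k by simp
    then show "x \<in> {x \<in> space (vec_lborel p). x k = 0}"
      using x by (simp add: space_PiM PiE_iff)
  qed (use k in \<open>simp add: space_PiM PiE_iff\<close>)
  ultimately have null: "emeasure (vec_lborel p) {x \<in> space (vec_lborel p). x k = 0} = 0"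
    by (simp only:)
  have "(\<lambda>x. x k) -` {0} \<inter> space (vec_lborel p) \<in> sets (vec_lborel p)"
    using k by (intro measurable_sets[OF measurable_component_singleton]) auto
  then have "{x \<in> space (vec_lborel p). x k = 0} \<in> sets (vec_lborel p)"
    by (simp add: vimage_def Int_def conj_commute)
  with null have "AE x in vec_lborel p. x k \<noteq> 0"
    by (intro AE_I[of _ _ "{x \<in> space (vec_lborel p). x k = 0}"]) auto
  then have "AE x in uniform_measure (vec_lborel p) (unit_ball p). direction p x k \<noteq> 0"
  proof (subst AE_uniform_measure[OF emeasure_unit_ball(1)])
    show "emeasure (vec_lborel p) (unit_ball p) < \<infinity>"
      using emeasure_unit_ball(2)[of p] by (simp add: less_top)
  next
    assume "AE x in vec_lborel p. x k \<noteq> 0"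
    then show "AE x in vec_lborel p. x \<in> unit_ball p \<longrightarrow> direction p x k \<noteq> 0"
    proof eventually_elim
      case (elim x)
      have "0 < (x k)\<^sup>2"
        using elim by simp
      also have "\<dots> \<le> (\<Sum>k<p. (x k)\<^sup>2)"
        using k by (intro member_le_sum) auto
      finally show ?case
        using k elim unfolding direction_def by auto
    qed
  qed
  moreover have "{u \<in> space (vec_borel p). u k \<noteq> 0} \<in> sets (vec_borel p)"
  proof -
    have "(\<lambda>x. x k) -` (- {0}) \<inter> space (vec_borel p) \<in> sets (vec_borel p)"
      using k by (intro measurable_sets[OF measurable_component_singleton]) auto
    then show ?thesis
      by (simp add: vimage_def Int_def conj_commute)
  qed
  ultimately show ?thesis
    unfolding sphere_unif_eq by (subst AE_distr_iff) auto
qed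

section \<open>Invariance under signed permutations\<close>

lemma lborel_sign_invariant:
  assumes "A \<in> sets borel" "s \<in> {1, - 1 :: real}"
  shows "emeasure lborel {y. s * y \<in> A} = emeasure lborel A"
proof (cases "s = 1")
  case False
  have "emeasure lborel A = emeasure (distr lborel borel uminus) A"
    by (simp only: lborel_distr_uminus)
  also have "\<dots> = emeasure lborel {y. - y \<in> A}"
    using assms(1) by (subst emeasure_distr) (auto simp: vimage_def)
  finally show ?thesis
    using False assms(2) by simp
qed simp

context
  fixes p :: nat and s :: "nat \<Rightarrow> real" and \<pi> :: "nat \<Rightarrow> nat"
  assumes s: "\<And>i. s i \<in> {1, - 1}" and \<pi>: "bij_betw \<pi> {..<p} {..<p}"
begin

lemma perm_range: "\<pi> \<in> {..<p} \<rightarrow> {..<p}"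
  using \<pi> by (auto simp: bij_betw_def)

lemma signed_perm_sum_squares: "(\<Sum>k<p. (signed_perm p s \<pi> x k)\<^sup>2) = (\<Sum>k<p. (x k)\<^sup>2)"
proof -
  have "(s k * y)\<^sup>2 = y\<^sup>2" for k y
    using s[of k] by auto
  then have "(\<Sum>k<p. (signed_perm p s \<pi> x k)\<^sup>2) = (\<Sum>k<p. (x (\<pi> k))\<^sup>2)"
    by (simp add: signed_perm_def)
  also have "\<dots> = (\<Sum>k<p. (x k)\<^sup>2)"
    by (rule sum.reindex_bij_betw[OF \<pi>])
  finally show ?thesis .
qed

lemma distr_vec_lborel_signed_perm: "distr (vec_lborel p) (vec_lborel p) (signed_perm p s \<pi>) = vec_lborel p"
proof -
  interpret product_sigma_finite "\<lambda>_::nat. lborel :: real measure"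
    by unfold_locales
  define \<tau> where "\<tau> = inv_into {..<p} \<pi>"
  have \<tau>: "\<tau> (\<pi> i) = i" if "i < p" for i
    using that \<pi> unfolding \<tau>_def by (auto simp: bij_betw_def)
  have \<tau>': "\<pi> (\<tau> i) = i" "\<tau> i < p" if "i < p" for i
    using that \<pi> bij_betw_inv_into_right[OF \<pi>, of i] bij_betw_apply[OF bij_betw_inv_into[OF \<pi>], of i] unfolding \<tau>_def by auto
  have meas: "signed_perm p s \<pi> \<in> measurable (vec_lborel p) (vec_lborel p)"
    by (intro signed_perm_measurable perm_range sets_vec_lborel)
  show ?thesis
  proof (rule PiM_eqI)
    fix A :: "nat \<Rightarrow> real set"
    assume "\<And>i. i \<in> {..<p} \<Longrightarrow> A i \<in> sets lborel"
    then have A: "\<And>i. i < p \<Longrightarrow> A i \<in> sets borel"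
      by simp
    \<comment> \<open>The preimage of the box \<open>A\<close> is again a box, its sides moved along
      the inverse permutation \<tau> and possibly reflected.\<close>
    let ?B = "\<lambda>k. {y. s (\<tau> k) * y \<in> A (\<tau> k)}"
    have B: "?B k \<in> sets borel" if "k < p" for k
    proof -
      have [measurable]: "A (\<tau> k) \<in> sets borel"
        using \<tau>'(2)[OF that] by (rule A)
      show ?thesis by measurable
    qed
    have "emeasure (distr (vec_lborel p) (vec_lborel p) (signed_perm p s \<pi>)) (PiE {..<p} A)
        = emeasure (vec_lborel p) (signed_perm p s \<pi> -` PiE {..<p} A \<inter> space (vec_lborel p))"
      using meas A by (intro emeasure_distr sets_PiM_I_finite) auto
    also have "signed_perm p s \<pi> -` PiE {..<p} A \<inter> space (vec_lborel p) = PiE {..<p} ?B"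
    proof (intro equalityI subsetI)
      fix x assume x: "x \<in> signed_perm p s \<pi> -` PiE {..<p} A \<inter> space (vec_lborel p)"
      show "x \<in> PiE {..<p} ?B"
      proof (rule PiE_I)
        fix k assume "k \<in> {..<p}"
        then have "signed_perm p s \<pi> x (\<tau> k) \<in> A (\<tau> k)" "\<tau> k < p" "\<pi> (\<tau> k) = k"
          using x \<tau>' by auto
        then show "x k \<in> ?B k"
          by (simp add: signed_perm_def)
      qed (use x in \<open>auto simp: space_PiM PiE_iff extensional_def\<close>)
    next
      fix x assume x: "x \<in> PiE {..<p} ?B"
      have "signed_perm p s \<pi> x \<in> PiE {..<p} A"
      proof (rule PiE_I)
        fix i assume i: "i \<in> {..<p}"
        then have "x (\<pi> i) \<in> ?B (\<pi> i)"
          using x perm_range by (auto simp: PiE_iff)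
        then show "signed_perm p s \<pi> x i \<in> A i"
          using i \<tau>[of i] by (simp add: signed_perm_def)
      qed (simp add: signed_perm_def)
      then show "x \<in> signed_perm p s \<pi> -` PiE {..<p} A \<inter> space (vec_lborel p)"
        using x by (auto simp: space_PiM PiE_iff)
    qed
    also have "emeasure (vec_lborel p) (PiE {..<p} ?B) = (\<Prod>k<p. emeasure lborel (?B k))"
      using B by (intro emeasure_PiM) auto
    also have "\<dots> = (\<Prod>k<p. emeasure lborel (A (\<tau> k)))"
      using A \<tau>' s by (intro prod.cong lborel_sign_invariant) auto
    also have "\<dots> = (\<Prod>i<p. emeasure lborel (A i))"
      unfolding \<tau>_def by (rule prod.reindex_bij_betw[OF bij_betw_inv_into[OF \<pi>]])
    finally show "emeasure (distr (vec_lborel p) (vec_lborel p) (signed_perm p s \<pi>)) (PiE {..<p} A)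
        = (\<Prod>i\<in>{..<p}. emeasure lborel (A i))" .
  qed auto
qed

lemma distr_sphere_unif_signed_perm: "distr (sphere_unif p) (vec_borel p) (signed_perm p s \<pi>) = sphere_unif p"
proof -
  let ?T = "signed_perm p s \<pi>" and ?U = "uniform_measure (vec_lborel p) (unit_ball p)"
  have meas: "?T \<in> measurable (vec_lborel p) (vec_lborel p)" "?T \<in> measurable (vec_borel p) (vec_borel p)"
      "?T \<in> measurable ?U (vec_lborel p)"
    by (intro signed_perm_measurable perm_range; simp add: sets_vec_lborel)+
  have U: "distr ?U (vec_lborel p) ?T = ?U"
  proof (rule measure_eqI)
    fix A assume "A \<in> sets (distr ?U (vec_lborel p) ?T)"
    then have A: "A \<in> sets (vec_lborel p)"
      by simp
    have pre: "?T -` A \<inter> space (vec_lborel p) \<in> sets (vec_lborel p)"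
      using meas(1) A by (rule measurable_sets)
    have Tsp: "?T x \<in> space (vec_lborel p)" if "x \<in> space (vec_lborel p)" for x
      using meas(1) that by (rule measurable_space)
    have "emeasure (distr ?U (vec_lborel p) ?T) A = emeasure ?U (?T -` A \<inter> space (vec_lborel p))"
      using meas(3) A by (subst emeasure_distr) auto
    also have "\<dots> = emeasure (vec_lborel p) (unit_ball p \<inter> (?T -` A \<inter> space (vec_lborel p))) / emeasure (vec_lborel p) (unit_ball p)"
      using pre by (intro emeasure_uniform_measure) auto
    also have "unit_ball p \<inter> (?T -` A \<inter> space (vec_lborel p)) = ?T -` (unit_ball p \<inter> A) \<inter> space (vec_lborel p)"
      using Tsp by (auto simp: unit_ball_def signed_perm_sum_squares)
    also have "emeasure (vec_lborel p) \<dots> = emeasure (distr (vec_lborel p) (vec_lborel p) ?T) (unit_ball p \<inter> A)"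
      using meas(1) A by (intro emeasure_distr[symmetric]) auto
    also have "\<dots> = emeasure (vec_lborel p) (unit_ball p \<inter> A)"
      by (simp only: distr_vec_lborel_signed_perm)
    also have "\<dots> / emeasure (vec_lborel p) (unit_ball p) = emeasure ?U A"
      using A by (intro emeasure_uniform_measure[symmetric]) auto
    finally show "emeasure (distr ?U (vec_lborel p) ?T) A = emeasure ?U A" .
  qed simp
  \<comment> \<open>This holds at the origin too, where division by 0 makes every coordinate of the
    direction 0.\<close>
  have comm: "direction p (?T x) = ?T (direction p x)" for x
  proof
    fix i
    show "direction p (?T x) i = ?T (direction p x) i"
    proof (cases "i < p")
      case True
      then have "\<pi> i < p"
        using perm_range by auto
      then show ?thesis
        using True unfolding direction_def signed_perm_sum_squares by (simp add: signed_perm_def)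
    qed (simp add: direction_def signed_perm_def)
  qed
  have "sphere_unif p = distr (distr ?U (vec_lborel p) ?T) (vec_borel p) (direction p)"
    unfolding sphere_unif_eq U ..
  also have "\<dots> = distr ?U (vec_borel p) (\<lambda>x. direction p (?T x))"
    using meas by (subst distr_distr) (auto simp: comp_def)
  also have "\<dots> = distr (sphere_unif p) (vec_borel p) ?T"
    unfolding sphere_unif_eq comm using meas by (subst distr_distr) (auto simp: comp_def)
  finally show ?thesis ..
qed

end

text \<open>The two opposite comparisons cover the product space and have equal probability under
  swapping. Ties may have positive probability, as for a radial law with atoms, hence the
  inequality.\<close>

lemma prob_le_swap_ge_half:
  fixes f :: "'a \<Rightarrow> real"
  assumes "prob_space N" and [measurable]: "f \<in> borel_measurable N"
  shows "1 / 2 \<le> (\<integral>z. (of_bool (f (snd z) \<le> f (fst z)) :: real) \<partial>(N \<Otimes>\<^sub>M N))"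
proof -
  interpret N: prob_space N by fact
  interpret NN: pair_prob_space N N ..
  let ?a = "\<lambda>z. of_bool (f (snd z) \<le> f (fst z)) :: real" and ?b = "\<lambda>z. of_bool (f (fst z) \<le> f (snd z)) :: real"
  have i: "integrable (N \<Otimes>\<^sub>M N) ?a" "integrable (N \<Otimes>\<^sub>M N) ?b"
    by (rule NN.integrable_const_bound[where B=1]; (auto; fail)?; unfold of_bool_def; measurable)+
  have "(\<integral>z. ?a z \<partial>(N \<Otimes>\<^sub>M N)) = (\<integral>z. ?a z \<partial>distr (N \<Otimes>\<^sub>M N) (N \<Otimes>\<^sub>M N) (\<lambda>(x, y). (y, x)))"
    by (simp only: NN.distr_pair_swap[symmetric])
  also have "\<dots> = (\<integral>z. ?b z \<partial>(N \<Otimes>\<^sub>M N))"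
    using i by (subst integral_distr) (auto simp: case_prod_beta')
  finally have eq: "(\<integral>z. ?a z \<partial>(N \<Otimes>\<^sub>M N)) = (\<integral>z. ?b z \<partial>(N \<Otimes>\<^sub>M N))" .
  have "(1::real) = (\<integral>z. 1 \<partial>(N \<Otimes>\<^sub>M N))"
    by (simp add: NN.prob_space)
  also have "\<dots> \<le> (\<integral>z. ?a z + ?b z \<partial>(N \<Otimes>\<^sub>M N))"
    using i by (intro integral_mono) auto
  also have "\<dots> = (\<integral>z. ?a z \<partial>(N \<Otimes>\<^sub>M N)) + (\<integral>z. ?b z \<partial>(N \<Otimes>\<^sub>M N))"
    using i by (rule Bochner_Integration.integral_add)
  finally show ?thesis
    using eq by simp
qed


subsection \<open>Lower bound for the pseudo variance\<close>

text \<open>The exact second moment gives 4 \<zeta> plus an error of at most 32 / (n - 1). This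
  shows that the limit in \<open>sigma_ps\<close> exists, without which \<open>lim\<close> would
  carry no information.\<close>

lemma sigma_ps_square:
  assumes "is_law 2 (elliptical_pair p R)"
  shows "(sigma_ps p R)\<^sup>2 = 4 * zeta (elliptical_pair p R) 0 1"
proof -
  let ?E = "elliptical_pair p R"
  interpret K: sym_kernel ?E "kernel 0 1"
    using assms by (rule sym_kernel_kernel) auto
  let ?z = "K.\<kappa> - K.\<mu>\<^sup>2"
  have tau: "tau_hat n x 0 1 = K.ustat n x" for n x
    using assms by (rule tau_hat_eq_ustat) auto
  have bounds: "4 * ?z \<le> pseudo_var n p R \<and> pseudo_var n p R \<le> 4 * ?z + 32 / (real n - 1)" if n: "2 \<le> n" for n
  proof -
    obtain \<rho> where \<rho>: "(\<integral>x. (K.ustat n x - K.\<mu>)\<^sup>2 \<partial>K.sample n) = 4 * ?z / real n + \<rho>"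
      "0 \<le> \<rho>" "\<rho> \<le> 32 / (real n * (real n - 1))"
      using K.ustat_second_moment[OF n] .
    have "pseudo_var n p R = (\<integral>x. (sqrt (real n) * K.ustat n x - sqrt (real n) * K.\<mu>)\<^sup>2 \<partial>K.sample n)"
      unfolding pseudo_var_def iid_def tau using K.ustat_expectation[OF n] by simp
    also have "\<dots> = (\<integral>x. real n * (K.ustat n x - K.\<mu>)\<^sup>2 \<partial>K.sample n)"
      by (simp add: right_diff_distrib[symmetric] power_mult_distrib)
    also have "\<dots> = 4 * ?z + real n * \<rho>"
      using n \<rho>(1) by (simp add: field_simps)
    finally have eq: "pseudo_var n p R = 4 * ?z + real n * \<rho>" .
    have "real n * \<rho> \<le> real n * (32 / (real n * (real n - 1)))"
      using \<rho> by (intro mult_left_mono) auto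
    also have "\<dots> = 32 / (real n - 1)"
      using n by simp
    finally show ?thesis
      using eq \<rho>(2) by simp
  qed
  have "(\<lambda>n. pseudo_var n p R) \<longlonglongrightarrow> 4 * ?z"
  proof (rule tendsto_sandwich)
    show "eventually (\<lambda>n. 4 * ?z \<le> pseudo_var n p R) sequentially"
      "eventually (\<lambda>n. pseudo_var n p R \<le> 4 * ?z + 32 / (real n - 1)) sequentially"
      using bounds by (auto intro!: eventually_sequentiallyI[of 2])
    have "(\<lambda>n. 32 / (real n - 1)) \<longlonglongrightarrow> 0"
      by real_asymp
    from tendsto_add[OF tendsto_const this] show "(\<lambda>n. 4 * ?z + 32 / (real n - 1)) \<longlonglongrightarrow> 4 * ?z"
      by simp
  qed simp
  then have "(\<lambda>n. sqrt (pseudo_var n p R)) \<longlonglongrightarrow> sqrt (4 * ?z)"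
    by (rule tendsto_real_sqrt)
  then have "sigma_ps p R = sqrt (4 * ?z)"
    unfolding sigma_ps_def by (rule limI)
  then show ?thesis
    using K.\<zeta>_nonneg zeta_eq[OF assms, of 0 1] by simp
qed

lemma AE_pair_fst:
  assumes "prob_space N" "AE x in M. Q x"
  shows "AE z in M \<Otimes>\<^sub>M N. Q (fst z)"
proof -
  interpret N: prob_space N by fact
  obtain B where B: "B \<in> null_sets M" "{x \<in> space M. \<not> Q x} \<subseteq> B"
    using assms(2) by (auto simp: eventually_ae_filter)
  show ?thesis
    using B(2) by (intro AE_I'[OF N.times_in_null_sets1[OF B(1) sets.top]]) (auto simp: space_pair_measure)
qed

lemma AE_pair_snd:
  assumes "prob_space N" "AE x in N. Q x"
  shows "AE z in M \<Otimes>\<^sub>M N. Q (snd z)"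
proof -
  interpret N: prob_space N by fact
  obtain B where B: "B \<in> null_sets N" "{x \<in> space N. \<not> Q x} \<subseteq> B"
    using assms(2) by (auto simp: eventually_ae_filter)
  show ?thesis
    using B(2) by (intro AE_I'[OF N.times_in_null_sets2[OF sets.top B(1)]]) (auto simp: space_pair_measure)
qed

lemma integral_pair_product:
  fixes f h :: "_ \<Rightarrow> real"
  assumes "prob_space M" "prob_space N"
    and [measurable]: "f \<in> borel_measurable M" "h \<in> borel_measurable N"
    and b: "\<And>x. \<bar>f x\<bar> \<le> 1" "\<And>x. \<bar>h x\<bar> \<le> 1"
  shows "(\<integral>z. f (fst z) * h (snd z) \<partial>(M \<Otimes>\<^sub>M N)) = (\<integral>x. f x \<partial>M) * (\<integral>y. h y \<partial>N)"
proof -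
  interpret M: prob_space M by fact
  interpret N: prob_space N by fact
  interpret MN: pair_prob_space M N ..
  have "integrable (M \<Otimes>\<^sub>M N) (\<lambda>(x, y). f x * h y)"
    by (rule MN.integrable_const_bound[where B="1"])
      (auto intro!: AE_I2 mult_le_one simp: b abs_mult)
  from MN.integral_fst'[OF this] show ?thesis
    by (simp add: case_prod_beta')
qed

section \<open>Coordinatewise dominance between two points of the sphere\<close>

lemma sphere_component_measurable [measurable]:
  "k < p \<Longrightarrow> (\<lambda>u. u k) \<in> borel_measurable (sphere_unif p)"
  using measurable_cong_sets[OF sets_sphere_unif refl] by simp

text \<open>The coordinates of a point of the sphere are dependent, so the two events cannot simply
  be multiplied. Since the indicators are idempotent, E N^2 = E N + p (p - 1) b with b the
  probability sought, whence E N (E N - 1) \<le> p (p - 1) b. The final 1/8 is attained by the bound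
  at p = 3.\<close>

lemma sphere_unif_dominance:
  assumes p: "3 \<le> p"
  defines "S \<equiv> sphere_unif p"
  shows "1 / 8 \<le> (\<integral>z. of_bool (\<bar>snd z 0\<bar> \<le> \<bar>fst z 0\<bar>) * of_bool (\<bar>snd z 1\<bar> \<le> \<bar>fst z 1\<bar>) \<partial>(S \<Otimes>\<^sub>M S) :: real)"
proof -
  interpret S: prob_space S
    unfolding S_def by (rule prob_space_sphere_unif)
  interpret SS: pair_prob_space S S ..
  define I where "I i z = (of_bool (\<bar>snd z i\<bar> \<le> \<bar>fst z i\<bar>) :: real)" for i :: nat and z :: "(nat \<Rightarrow> real) \<times> (nat \<Rightarrow> real)"
  have comp [measurable]: "(\<lambda>u. u i) \<in> borel_measurable S" if "i < p" for i
    unfolding S_def using that by (rule sphere_component_measurable)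
  have I_meas [measurable]: "I i \<in> borel_measurable (S \<Otimes>\<^sub>M S)" if "i < p" for i
    unfolding I_def of_bool_def using that by measurable
  have I_bounds: "0 \<le> I i z" "I i z \<le> 1" "I i z * I i z = I i z" for i z
    by (auto simp: I_def)
  have int: "integrable (S \<Otimes>\<^sub>M S) (\<lambda>z. I i z * I j z)" if "i < p" "j < p" for i j
    using that I_bounds by (intro SS.integrable_const_bound[where B=1]) (auto intro!: AE_I2 mult_le_one)
  have int1: "integrable (S \<Otimes>\<^sub>M S) (I i)" if "i < p" for i
    using int[OF that that] by (simp add: I_bounds)
  let ?b = "\<integral>z. I 0 z * I 1 z \<partial>(S \<Otimes>\<^sub>M S)"
  have exch: "(\<integral>z. I i z * I j z \<partial>(S \<Otimes>\<^sub>M S)) = ?b" if ij: "i < p" "j < p" "i \<noteq> j" for i j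
  proof -
    \<comment> \<open>A permutation with 0 \<mapsto> i and 1 \<mapsto> j is needed. First exchanging
      1 with \<open>t j\<close> and then applying \<open>t\<close> sends 1 to
      \<open>t (t j) = j\<close>, and 0 to i because \<open>t j \<noteq> 0\<close>.\<close>
    define t where "t = Transposition.transpose 0 i"
    define \<pi> where "\<pi> = t \<circ> Transposition.transpose 1 (t j)"
    have tj: "t j < p" "t j \<noteq> 0"
      using ij unfolding t_def Transposition.transpose_def by auto
    have "\<pi> permutes {..<p}"
      unfolding \<pi>_def t_def using ij p tj
      by (intro permutes_compose permutes_swap_id) (auto simp: t_def)
    then have bij: "bij_betw \<pi> {..<p} {..<p}"
      by (rule permutes_imp_bij)
    have \<pi>: "\<pi> 0 = i" "\<pi> 1 = j"
      using ij tj unfolding \<pi>_def t_def Transposition.transpose_def by (auto split: if_splits)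
    let ?T = "signed_perm p (\<lambda>_. 1) \<pi>"
    have T: "?T \<in> measurable S S"
      unfolding S_def using bij by (intro signed_perm_measurable sets_sphere_unif) (auto simp: bij_betw_def)
    have inv: "distr S S ?T = S"
      using distr_sphere_unif_signed_perm[OF _ bij, of "\<lambda>_. 1"]
      unfolding S_def by (simp add: distr_cong[OF refl sets_sphere_unif refl])
    have "S \<Otimes>\<^sub>M S = distr S S ?T \<Otimes>\<^sub>M distr S S ?T"
      by (simp only: inv)
    also have "\<dots> = distr (S \<Otimes>\<^sub>M S) (S \<Otimes>\<^sub>M S) (\<lambda>(x, y). (?T x, ?T y))"
      using T by (intro pair_measure_distr) (auto simp: inv intro: S.sigma_finite_measure_axioms)
    finally have D: "S \<Otimes>\<^sub>M S = distr (S \<Otimes>\<^sub>M S) (S \<Otimes>\<^sub>M S) (\<lambda>(x, y). (?T x, ?T y))" .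
    have "?b = (\<integral>z. I 0 z * I 1 z \<partial>distr (S \<Otimes>\<^sub>M S) (S \<Otimes>\<^sub>M S) (\<lambda>(x, y). (?T x, ?T y)))"
      using D by simp
    also have "\<dots> = (\<integral>z. I 0 (?T (fst z), ?T (snd z)) * I 1 (?T (fst z), ?T (snd z)) \<partial>(S \<Otimes>\<^sub>M S))"
      using T p by (subst integral_distr) (auto simp: case_prod_beta')
    also have "\<dots> = (\<integral>z. I i z * I j z \<partial>(S \<Otimes>\<^sub>M S))"
      using p \<pi> by (simp add: I_def signed_perm_def)
    finally show ?thesis ..
  qed
  define N where "N z = (\<Sum>i<p. I i z)" for z
  let ?e = "\<integral>z. N z \<partial>(S \<Otimes>\<^sub>M S)"
  have N_meas [measurable]: "N \<in> borel_measurable (S \<Otimes>\<^sub>M S)"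
    unfolding N_def by measurable
  have e: "?e = (\<Sum>i<p. \<integral>z. I i z \<partial>(S \<Otimes>\<^sub>M S))"
    unfolding N_def using int1 by (intro Bochner_Integration.integral_sum) auto
  have "(\<Sum>i<p. 1 / 2) \<le> ?e"
    unfolding e
  proof (rule sum_mono)
    fix i assume "i \<in> {..<p}"
    then show "1 / 2 \<le> (\<integral>z. I i z \<partial>(S \<Otimes>\<^sub>M S))"
      unfolding I_def by (intro prob_le_swap_ge_half[of S "\<lambda>u. \<bar>u i\<bar>"] S.prob_space_axioms) auto
  qed
  then have e_ge: "real p / 2 \<le> ?e"
    by simp
  have N_abs: "\<bar>N z\<bar> \<le> real p" for z
  proof -
    have "0 \<le> N z"
      unfolding N_def by (intro sum_nonneg I_bounds)
    moreover have "N z \<le> (\<Sum>i<p. 1)"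
      unfolding N_def by (intro sum_mono I_bounds)
    ultimately show ?thesis by simp
  qed
  have "?e\<^sup>2 \<le> (\<integral>z. (N z)\<^sup>2 \<partial>(S \<Otimes>\<^sub>M S))"
    using N_abs by (intro SS.square_expectation_le[where B="real p"]) auto
  also have "\<dots> = (\<integral>z. (\<Sum>i<p. \<Sum>j<p. I i z * I j z) \<partial>(S \<Otimes>\<^sub>M S))"
    unfolding N_def by (simp add: power2_eq_square sum_product)
  also have "\<dots> = (\<Sum>i<p. \<Sum>j<p. \<integral>z. I i z * I j z \<partial>(S \<Otimes>\<^sub>M S))"
    using int by (subst Bochner_Integration.integral_sum)
      (auto intro!: Bochner_Integration.integral_sum sum.cong Bochner_Integration.integrable_sum)
  also have "\<dots> = (\<Sum>i<p. (\<integral>z. I i z \<partial>(S \<Otimes>\<^sub>M S)) + (real p - 1) * ?b)"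
  proof (intro sum.cong refl)
    fix i assume i: "i \<in> {..<p}"
    have "(\<Sum>j<p. \<integral>z. I i z * I j z \<partial>(S \<Otimes>\<^sub>M S))
        = (\<integral>z. I i z * I i z \<partial>(S \<Otimes>\<^sub>M S)) + (\<Sum>j\<in>{..<p} - {i}. \<integral>z. I i z * I j z \<partial>(S \<Otimes>\<^sub>M S))"
      using i by (intro sum.remove) auto
    also have "(\<Sum>j\<in>{..<p} - {i}. \<integral>z. I i z * I j z \<partial>(S \<Otimes>\<^sub>M S)) = (\<Sum>j\<in>{..<p} - {i}. ?b)"
      using i by (intro sum.cong exch) auto
    also have "\<dots> = (real p - 1) * ?b"
      using i p by (simp add: of_nat_diff)
    finally show "(\<Sum>j<p. \<integral>z. I i z * I j z \<partial>(S \<Otimes>\<^sub>M S)) = (\<integral>z. I i z \<partial>(S \<Otimes>\<^sub>M S)) + (real p - 1) * ?b"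
      by (simp only: I_bounds)
  qed
  also have "\<dots> = ?e + real p * (real p - 1) * ?b"
    unfolding e by (simp add: sum.distrib)
  finally have le: "?e * (?e - 1) \<le> real p * (real p - 1) * ?b"
    by (simp add: power2_eq_square algebra_simps)
  have "real p / 2 * (real p / 2 - 1) \<le> ?e * (?e - 1)"
    using e_ge p by (intro mult_mono) auto
  with le have "real p / 2 * (real p / 2 - 1) \<le> real p * (real p - 1) * ?b"
    by linarith
  then have "real p * ((real p - 2) / 4) \<le> real p * ((real p - 1) * ?b)"
    by (simp add: field_simps)
  then have 1: "(real p - 2) / 4 \<le> (real p - 1) * ?b"
    using p by (subst (asm) mult_le_cancel_left_pos) auto
  have "(real p - 1) * (1 / 8) \<le> (real p - 2) / 4"
    using p by (simp add: field_simps)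
  then have "(real p - 1) * (1 / 8) \<le> (real p - 1) * ?b"
    using 1 by linarith
  then have "1 / 8 \<le> ?b"
    using p by (subst (asm) mult_le_cancel_left_pos) auto
  then show ?thesis
    by (simp add: I_def)
qed

section \<open>The variance of the projection for an elliptical pair\<close>

definition scaled_pair :: "real \<times> (nat \<Rightarrow> real) \<Rightarrow> nat \<Rightarrow> real" where
  "scaled_pair a = (\<lambda>i\<in>{..<2}. fst a * snd a i)"

lemma elliptical_pair_eq: "elliptical_pair p R = distr (R \<Otimes>\<^sub>M sphere_unif p) (vec_borel 2) scaled_pair"
  unfolding elliptical_pair_def scaled_pair_def case_prod_beta' ..

text \<open>The conditions \<open>x 0 \<noteq> 0\<close> and \<open>x 1 \<noteq> 0\<close> are
  included because the sign inequality that uses this indicator fails when both numbers compared are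
  0. The two factors match the factorization of the symmetrized kernel.\<close>

definition dominates :: "(nat \<Rightarrow> real) \<Rightarrow> (nat \<Rightarrow> real) \<Rightarrow> real" where
  "dominates x y = of_bool (x 0 \<noteq> 0 \<and> \<bar>y 0\<bar> \<le> \<bar>x 0\<bar>) * of_bool (x 1 \<noteq> 0 \<and> \<bar>y 1\<bar> \<le> \<bar>x 1\<bar>)"

context
  fixes p :: nat and R :: "real measure"
  assumes R: "radial_law R" and R0: "AE r in R. r \<noteq> 0" and p: "3 \<le> p"
begin

interpretation R: prob_space R
  using R by (simp add: radial_law_def)

interpretation S: prob_space "sphere_unif p"
  by (rule prob_space_sphere_unif)

interpretation RS: pair_prob_space R "sphere_unif p" ..

lemma radial_sets [measurable_cong]: "sets R = sets borel"
  using R by (simp add: radial_law_def)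

lemma scaled_pair_measurable [measurable]: "scaled_pair \<in> measurable (R \<Otimes>\<^sub>M sphere_unif p) (vec_borel 2)"
  unfolding scaled_pair_def
proof (intro measurable_restrict borel_measurable_times)
  fix i :: nat assume "i \<in> {..<2}"
  then have "(\<lambda>u. u i) \<in> borel_measurable (sphere_unif p)"
    using p by (intro sphere_component_measurable) auto
  then show "(\<lambda>x. snd x i) \<in> borel_measurable (R \<Otimes>\<^sub>M sphere_unif p)"
    by (rule measurable_compose[OF measurable_snd])
qed measurable

lemma is_law_elliptical_pair: "is_law 2 (elliptical_pair p R)"
  unfolding is_law_def elliptical_pair_eq by (auto intro!: RS.prob_space_distr)

interpretation K: sym_kernel "elliptical_pair p R" "kernel 0 1"
  using is_law_elliptical_pair by (rule sym_kernel_kernel) auto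

lemma pair_component_measurable [measurable]:
  "(\<lambda>x. x 0) \<in> borel_measurable (elliptical_pair p R)" "(\<lambda>x. x 1) \<in> borel_measurable (elliptical_pair p R)"
  "(\<lambda>x. x (Suc 0)) \<in> borel_measurable (elliptical_pair p R)"
  using law_component_measurable[OF is_law_elliptical_pair] by auto

lemma dominates_measurable [measurable]:
  "case_prod dominates \<in> borel_measurable (elliptical_pair p R \<Otimes>\<^sub>M elliptical_pair p R)"
  unfolding dominates_def of_bool_def by measurable

text \<open>A sign change of the two coordinates lifts to one of all p coordinates of the sphere,
  which preserves the uniform law and commutes with multiplication by the radius.\<close>

lemma distr_elliptical_pair_flip:
  assumes s: "\<And>i. s i \<in> {1, - 1}"
  shows "distr (elliptical_pair p R) (vec_borel 2) (signed_perm 2 s id) = elliptical_pair p R"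
proof -
  let ?S = "sphere_unif p" and ?T = "signed_perm p s id" and ?F = "signed_perm 2 s id"
  have T: "?T \<in> measurable ?S ?S"
    by (intro signed_perm_measurable sets_sphere_unif) auto
  have F: "?F \<in> measurable (vec_borel 2) (vec_borel 2)"
    by (intro signed_perm_measurable) auto
  have inv: "distr ?S ?S ?T = ?S"
    using distr_sphere_unif_signed_perm[OF s, of id p]
    by (simp add: distr_cong[OF refl sets_sphere_unif refl] bij_betw_id)
  have "R \<Otimes>\<^sub>M ?S = distr R R (\<lambda>r. r) \<Otimes>\<^sub>M distr ?S ?S ?T"
    by (simp only: inv distr_id2[OF refl])
  also have "\<dots> = distr (R \<Otimes>\<^sub>M ?S) (R \<Otimes>\<^sub>M ?S) (\<lambda>(r, u). (r, ?T u))"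
    using T by (intro pair_measure_distr) (auto simp: inv intro: S.sigma_finite_measure_axioms)
  finally have D: "R \<Otimes>\<^sub>M ?S = distr (R \<Otimes>\<^sub>M ?S) (R \<Otimes>\<^sub>M ?S) (\<lambda>(r, u). (r, ?T u))" .
  have "elliptical_pair p R = distr (distr (R \<Otimes>\<^sub>M ?S) (R \<Otimes>\<^sub>M ?S) (\<lambda>(r, u). (r, ?T u))) (vec_borel 2) scaled_pair"
    unfolding elliptical_pair_eq using D by simp
  also have "\<dots> = distr (R \<Otimes>\<^sub>M ?S) (vec_borel 2) (\<lambda>a. scaled_pair (fst a, ?T (snd a)))"
    using T by (subst distr_distr) (auto simp: comp_def case_prod_beta')
  also have "(\<lambda>a. scaled_pair (fst a, ?T (snd a))) = (\<lambda>a. ?F (scaled_pair a))"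
    using p by (auto simp: scaled_pair_def signed_perm_def fun_eq_iff)
  also have "distr (R \<Otimes>\<^sub>M ?S) (vec_borel 2) \<dots> = distr (elliptical_pair p R) (vec_borel 2) ?F"
    unfolding elliptical_pair_eq using F by (subst distr_distr) (auto simp: comp_def)
  finally show ?thesis ..
qed

lemma integral_elliptical_pair_flip:
  fixes f :: "(nat \<Rightarrow> real) \<Rightarrow> real"
  assumes s: "\<And>i. s i \<in> {1, - 1}" and f: "f \<in> borel_measurable (elliptical_pair p R)"
  shows "(\<integral>x. f (signed_perm 2 s id x) \<partial>elliptical_pair p R) = (\<integral>x. f x \<partial>elliptical_pair p R)"
proof -
  have sets: "sets (elliptical_pair p R) = sets (vec_borel 2)"
    using is_law_elliptical_pair by (simp add: is_law_def)
  have "(\<integral>x. f x \<partial>elliptical_pair p R) = (\<integral>x. f x \<partial>distr (elliptical_pair p R) (vec_borel 2) (signed_perm 2 s id))"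
    by (simp only: distr_elliptical_pair_flip[OF s])
  also have "\<dots> = (\<integral>x. f (signed_perm 2 s id x) \<partial>elliptical_pair p R)"
    using f sets by (intro integral_distr signed_perm_measurable) (auto simp: measurable_cong_sets[OF sets refl])
  finally show ?thesis ..
qed

text \<open>If the radius and both coordinates on the sphere are dominated, then so are the scaled
  coordinates. Radius and direction are independent, which gives 1/2 * 1/8. A zero radius or
  coordinate has probability 0.\<close>

lemma elliptical_pair_dominance:
  "1 / 16 \<le> (\<integral>x. (\<integral>y. dominates x y \<partial>elliptical_pair p R) \<partial>elliptical_pair p R)"
proof -
  let ?S = "sphere_unif p" and ?E = "elliptical_pair p R" and ?RS = "R \<Otimes>\<^sub>M sphere_unif p"
  define k where "k u u' = (of_bool (\<bar>u' 0\<bar> \<le> \<bar>u 0\<bar>) * of_bool (\<bar>u' 1\<bar> \<le> \<bar>u 1\<bar>) :: real)" for u u' :: "nat \<Rightarrow> real"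
  define \<rho> where "\<rho> r r' = (of_bool (r' \<le> r) :: real)" for r r' :: real
  define A where "A r = (\<integral>r'. \<rho> r r' \<partial>R)" for r
  define B where "B u = (\<integral>u'. k u u' \<partial>?S)" for u
  have [measurable]: "(\<lambda>u. u 0) \<in> borel_measurable ?S" "(\<lambda>u. u 1) \<in> borel_measurable ?S" "(\<lambda>u. u (Suc 0)) \<in> borel_measurable ?S"
    using p by (auto intro!: sphere_component_measurable)
  have k_meas [measurable]: "case_prod k \<in> borel_measurable (?S \<Otimes>\<^sub>M ?S)"
    unfolding k_def of_bool_def by measurable
  have \<rho>_meas [measurable]: "case_prod \<rho> \<in> borel_measurable (R \<Otimes>\<^sub>M R)"
    unfolding \<rho>_def of_bool_def by measurable
  have kb: "0 \<le> k u u'" "k u u' \<le> 1" and \<rho>b: "0 \<le> \<rho> r r'" "\<rho> r r' \<le> 1" for u u' r r'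
    by (auto simp: k_def \<rho>_def)
  have k1: "k u \<in> borel_measurable ?S" if "u \<in> space ?S" for u
    using measurable_compose[OF measurable_Pair1'[OF that] k_meas] by simp
  have \<rho>1: "\<rho> r \<in> borel_measurable R" for r
    unfolding \<rho>_def of_bool_def by measurable
  have A_meas [measurable]: "A \<in> borel_measurable R"
    unfolding A_def by measurable
  have B_meas [measurable]: "B \<in> borel_measurable ?S"
    unfolding B_def by measurable
  have Ab: "0 \<le> A r" "A r \<le> 1" for r
  proof -
    show "0 \<le> A r" unfolding A_def using \<rho>b by (intro integral_nonneg_AE AE_I2)
    have "A r \<le> (\<integral>r'. 1 \<partial>R)"
      unfolding A_def using \<rho>b \<rho>1 by (intro integral_mono R.integrable_const_bound[where B=1]) auto
    then show "A r \<le> 1" by (simp add: R.prob_space)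
  qed
  have Bb: "0 \<le> B u" "B u \<le> 1" for u
  proof -
    show "0 \<le> B u" unfolding B_def using kb by (intro integral_nonneg_AE AE_I2)
    show "B u \<le> 1"
    \<comment> \<open>Measurability of \<open>k u\<close> is known only for \<open>u\<close> in the
      space; elsewhere the integral may be 0 by default, which is harmless.\<close>
    proof (cases "integrable ?S (k u)")
      case True
      then have "B u \<le> (\<integral>u'. 1 \<partial>?S)"
        unfolding B_def using kb by (intro integral_mono) auto
      then show ?thesis by (simp add: S.prob_space)
    qed (simp add: B_def not_integrable_integral_eq)
  qed
  have dom_bounds: "0 \<le> dominates x y" "dominates x y \<le> 1" for x y
    by (auto simp: dominates_def)
  have sp [simp]: "scaled_pair a 0 = fst a * snd a 0" "scaled_pair a (Suc 0) = fst a * snd a (Suc 0)" for a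
    by (auto simp: scaled_pair_def)
  have inner_meas: "(\<lambda>x. \<integral>y. dominates x y \<partial>?E) \<in> borel_measurable ?E"
    by measurable
  have sets: "sets ?E = sets (vec_borel 2)"
    using is_law_elliptical_pair by (simp add: is_law_def)
  have dom1: "dominates x \<in> borel_measurable ?E" for x
    unfolding dominates_def of_bool_def by measurable
  have dom_sp: "(\<lambda>b. dominates x (scaled_pair b)) \<in> borel_measurable ?RS" for x
    using dom1 sets by (intro measurable_compose[OF scaled_pair_measurable]) (simp add: measurable_cong_sets[OF sets refl])
  have inner_eq: "(\<integral>y. dominates x y \<partial>?E) = (\<integral>b. dominates x (scaled_pair b) \<partial>?RS)" for x
    unfolding elliptical_pair_eq using dom1[of x] sets
    by (intro integral_distr) (auto simp: measurable_cong_sets[OF sets refl])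
  have AEpos: "AE b in ?RS. 0 \<le> fst b"
    using R by (intro AE_pair_fst S.prob_space_axioms) (auto simp: radial_law_def)
  have inner_ge: "A (fst a) * B (snd a) \<le> (\<integral>y. dominates (scaled_pair a) y \<partial>?E)"
    if a: "0 \<le> fst a" "fst a \<noteq> 0" "snd a 0 \<noteq> 0" "snd a 1 \<noteq> 0" "a \<in> space ?RS" for a
  proof -
    have sa: "snd a \<in> space ?S"
      using a by (auto simp: space_pair_measure)
    note k1' [measurable] = k1[OF sa] and \<rho>1' [measurable] = \<rho>1[of "fst a"]
    have "A (fst a) * B (snd a) = (\<integral>b. \<rho> (fst a) (fst b) * k (snd a) (snd b) \<partial>?RS)"
      unfolding A_def B_def
      by (rule integral_pair_product[symmetric])
        (use kb \<rho>b in \<open>auto intro: R.prob_space_axioms S.prob_space_axioms k1' \<rho>1'\<close>)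
    also have "\<dots> \<le> (\<integral>b. dominates (scaled_pair a) (scaled_pair b) \<partial>?RS)"
    proof (rule integral_mono_AE)
      show "integrable ?RS (\<lambda>b. \<rho> (fst a) (fst b) * k (snd a) (snd b))"
        using kb \<rho>b by (intro RS.integrable_const_bound[where B=1]) (auto intro!: AE_I2 mult_le_one)
      show "integrable ?RS (\<lambda>b. dominates (scaled_pair a) (scaled_pair b))"
        using dom_bounds by (intro RS.integrable_const_bound[where B=1] dom_sp) auto
      show "AE b in ?RS. \<rho> (fst a) (fst b) * k (snd a) (snd b) \<le> dominates (scaled_pair a) (scaled_pair b)"
        using AEpos
      proof eventually_elim
        case (elim b)
        show ?case
        proof (cases "fst b \<le> fst a \<and> \<bar>snd b 0\<bar> \<le> \<bar>snd a 0\<bar> \<and> \<bar>snd b 1\<bar> \<le> \<bar>snd a 1\<bar>")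
          case True
          then have "dominates (scaled_pair a) (scaled_pair b) = 1"
            using a elim unfolding dominates_def by (auto simp: abs_mult intro!: mult_mono)
          then show ?thesis
            using kb \<rho>b by (simp add: mult_le_one)
        next
          case False
          then have "\<rho> (fst a) (fst b) * k (snd a) (snd b) = 0"
            by (auto simp: \<rho>_def k_def)
          then show ?thesis by (rule ord_eq_le_trans) (rule dom_bounds)
        qed
      qed
    qed
    finally show ?thesis
      unfolding inner_eq .
  qed
  have "1 / 2 * (1 / 8) \<le> (\<integral>r. A r \<partial>R) * (\<integral>u. B u \<partial>?S)"
  proof (rule mult_mono)
    interpret RR: pair_prob_space R R ..
    interpret SS: pair_prob_space ?S ?S ..
    have "1 / 2 \<le> (\<integral>z. \<rho> (fst z) (snd z) \<partial>(R \<Otimes>\<^sub>M R))"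
      unfolding \<rho>_def by (rule prob_le_swap_ge_half) (auto intro: R.prob_space_axioms measurable_ident_sets[OF radial_sets])
    also have "\<dots> = (\<integral>r. A r \<partial>R)"
    proof -
      have "integrable (R \<Otimes>\<^sub>M R) (case_prod \<rho>)"
        using \<rho>b by (intro RR.integrable_const_bound[where B=1]) (auto intro!: AE_I2)
      from RR.integral_fst'[OF this] show ?thesis
        by (simp add: A_def case_prod_beta')
    qed
    finally show "1 / 2 \<le> (\<integral>r. A r \<partial>R)" .
    have "1 / 8 \<le> (\<integral>z. k (fst z) (snd z) \<partial>(?S \<Otimes>\<^sub>M ?S))"
      unfolding k_def using p by (rule sphere_unif_dominance)
    also have "\<dots> = (\<integral>u. B u \<partial>?S)"
    proof -
      have "integrable (?S \<Otimes>\<^sub>M ?S) (case_prod k)"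
        using kb by (intro SS.integrable_const_bound[where B=1]) (auto intro!: AE_I2)
      from SS.integral_fst'[OF this] show ?thesis
        by (simp add: B_def case_prod_beta')
    qed
    finally show "1 / 8 \<le> (\<integral>u. B u \<partial>?S)" .
  qed (use Ab in auto)
  also have "\<dots> = (\<integral>a. A (fst a) * B (snd a) \<partial>?RS)"
    using Ab Bb by (intro integral_pair_product[symmetric] R.prob_space_axioms S.prob_space_axioms) auto
  also have "\<dots> \<le> (\<integral>a. (\<integral>y. dominates (scaled_pair a) y \<partial>?E) \<partial>?RS)"
  proof (rule integral_mono_AE)
    show "integrable ?RS (\<lambda>a. A (fst a) * B (snd a))"
      using Ab Bb by (intro RS.integrable_const_bound[where B=1]) (auto intro!: AE_I2 mult_le_one)
    have b: "0 \<le> (\<integral>y. dominates x y \<partial>?E)" "(\<integral>y. dominates x y \<partial>?E) \<le> 1" for x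
    proof -
      have "(\<integral>y. dominates x y \<partial>?E) \<le> (\<integral>y. 1 \<partial>?E)"
        using dom_bounds dom1 by (intro integral_mono K.integrable_const_bound[where B=1]) auto
      then show "(\<integral>y. dominates x y \<partial>?E) \<le> 1" by (simp add: K.prob_space)
    qed (use dom_bounds in \<open>auto intro!: integral_nonneg_AE\<close>)
    show "integrable ?RS (\<lambda>a. \<integral>y. dominates (scaled_pair a) y \<partial>?E)"
      using b inner_meas sets
      by (intro RS.integrable_const_bound[where B=1] measurable_compose[OF scaled_pair_measurable])
        (auto simp: measurable_cong_sets[OF sets refl])
    have u: "AE a in ?RS. snd a k \<noteq> 0" if "k < p" for k
      using that by (intro AE_pair_snd S.prob_space_axioms sphere_unif_nonzero)
    show "AE a in ?RS. A (fst a) * B (snd a) \<le> (\<integral>y. dominates (scaled_pair a) y \<partial>?E)"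
    proof -
      have "AE a in ?RS. snd a 0 \<noteq> 0" "AE a in ?RS. snd a 1 \<noteq> 0"
        using u p by auto
      with AEpos AE_pair_fst[OF S.prob_space_axioms R0] AE_space show ?thesis
        by eventually_elim (rule inner_ge)
    qed
  qed
  also have "\<dots> = (\<integral>x. (\<integral>y. dominates x y \<partial>?E) \<partial>?E)"
    unfolding elliptical_pair_eq[of p R] using inner_meas sets unfolding elliptical_pair_eq[of p R]
    by (intro integral_distr[symmetric]) (auto simp: measurable_cong_sets[OF sets refl])
  finally show ?thesis by simp
qed

text \<open>Flipping one coordinate shows \<mu> = 0, so \<zeta> = \<kappa>. Averaging the kernel
  over the four sign patterns of y factorizes over the coordinates, and multiplication by the signs
  of x makes each factor at least the indicator of dominance. Thus E[g sg] \<ge> (1/16) / 4 = 1/64,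
  and \<kappa> \<ge> (1/64)^2 = 1/4096 by nonnegativity of the variance.\<close>

lemma zeta_elliptical_pair_ge: "1 / 4096 \<le> zeta (elliptical_pair p R) 0 1"
proof -
  let ?E = "elliptical_pair p R"
  define sg where "sg x = sgn (x 0) * sgn (x 1)" for x :: "nat \<Rightarrow> real"
  define s where "s a b = (\<lambda>i::nat. if i = 0 then a else b)" for a b :: real
  let ?F = "\<lambda>a b. signed_perm 2 (s a b) id"
  have s: "s a b i \<in> {1, -1}" if "a \<in> {1, -1}" "b \<in> {1, -1}" for a b i
    using that by (auto simp: s_def)
  have F: "?F a b x 0 = a * x 0" "?F a b x (Suc 0) = b * x (Suc 0)" for a b x
    by (auto simp: signed_perm_def s_def)
  have flip: "(\<integral>x. f (?F a b x) \<partial>?E) = (\<integral>x. f x \<partial>?E)"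
    if "a \<in> {1, -1}" "b \<in> {1, -1}" "f \<in> borel_measurable ?E" for a b and f :: "_ \<Rightarrow> real"
    using that s by (intro integral_elliptical_pair_flip) auto
  have sets: "sets ?E = sets (vec_borel 2)"
    using is_law_elliptical_pair by (simp add: is_law_def)
  have Fm: "?F a b \<in> measurable ?E ?E" for a b
    using sets by (intro signed_perm_measurable) auto
  have Kx: "kernel 0 1 x \<in> borel_measurable ?E" for x
    unfolding kernel_def by measurable
  have sym: "K.g (?F (-1) 1 x) = - K.g x" for x
  proof -
    have "K.g (?F (-1) 1 x) = (\<integral>y. kernel 0 1 (?F (-1) 1 x) (?F (-1) 1 y) \<partial>?E)"
      unfolding K.g_def by (rule flip[symmetric]) (simp_all add: Kx del: One_nat_def)
    also have "\<dots> = (\<integral>y. - kernel 0 1 x y \<partial>?E)"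
      by (intro Bochner_Integration.integral_cong) (auto simp: kernel_def F sgn_if)
    finally show ?thesis
      unfolding K.g_def by simp
  qed
  have "K.\<mu> = (\<integral>x. K.g (?F (-1) 1 x) \<partial>?E)"
    unfolding K.\<mu>_def by (rule flip[symmetric]) (simp_all add: K.g_measurable del: One_nat_def)
  also have "\<dots> = - K.\<mu>"
    unfolding sym K.\<mu>_def by simp
  finally have \<mu>: "K.\<mu> = 0" by simp
  \<comment> \<open>The left side is 2 for \<bar>b\<bar> < \<bar>a\<bar>, 1 for \<bar>b\<bar> =
    \<bar>a\<bar> \<noteq> 0, and 0 otherwise.\<close>
  have \<psi>: "(sgn (a - b) + sgn (a + b)) * sgn a \<ge> of_bool (a \<noteq> 0 \<and> \<bar>b\<bar> \<le> \<bar>a\<bar>)" for a b :: real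
    by (auto simp: sgn_if abs_if of_bool_def)
  have dom1: "dominates x \<in> borel_measurable ?E" for x
    unfolding dominates_def of_bool_def by measurable
  have ge: "(\<integral>y. dominates x y \<partial>?E) \<le> 4 * (K.g x * sg x)" for x
  proof -
    let ?h = "\<lambda>a b y. kernel 0 1 x (?F a b y)"
    have hm: "?h a b \<in> borel_measurable ?E" for a b
      by (rule measurable_compose[OF Fm Kx])
    have hi: "integrable ?E (?h a b)" for a b
      using K.H_abs by (intro K.integrable_const_bound[where B=1] hm) auto
    have h: "K.g x = (\<integral>y. ?h a b y \<partial>?E)" if "a \<in> {1, -1}" "b \<in> {1, -1}" for a b
      unfolding K.g_def using that by (intro flip[symmetric] Kx) auto
    have "4 * (K.g x * sg x) = ((\<integral>y. ?h 1 1 y \<partial>?E) + (\<integral>y. ?h (-1) 1 y \<partial>?E) + (\<integral>y. ?h 1 (-1) y \<partial>?E) + (\<integral>y. ?h (-1) (-1) y \<partial>?E)) * sg x"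
      using h[of 1 1] h[of "-1" 1] h[of 1 "-1"] h[of "-1" "-1"] by simp
    also have "\<dots> = (\<integral>y. (?h 1 1 y + ?h (-1) 1 y + ?h 1 (-1) y + ?h (-1) (-1) y) * sg x \<partial>?E)"
      using hi by simp
    also have "\<dots> \<ge> (\<integral>y. dominates x y \<partial>?E)"
    proof (rule integral_mono)
      show "integrable ?E (dominates x)"
        by (rule K.integrable_const_bound[where B=1]) (auto simp: dominates_def intro: dom1)
      show "integrable ?E (\<lambda>y. (?h 1 1 y + ?h (-1) 1 y + ?h 1 (-1) y + ?h (-1) (-1) y) * sg x)"
        using hi by auto
      fix y
      have "dominates x y \<le> ((sgn (x 0 - y 0) + sgn (x 0 + y 0)) * sgn (x 0)) * ((sgn (x 1 - y 1) + sgn (x 1 + y 1)) * sgn (x 1))"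
        unfolding dominates_def by (intro mult_mono \<psi>) (auto intro: order_trans[OF _ \<psi>])
      also have "\<dots> = (?h 1 1 y + ?h (-1) 1 y + ?h 1 (-1) y + ?h (-1) (-1) y) * sg x"
        unfolding kernel_def One_nat_def F sg_def by (simp add: algebra_simps)
      finally show "dominates x y \<le> (?h 1 1 y + ?h (-1) 1 y + ?h 1 (-1) y + ?h (-1) (-1) y) * sg x" .
    qed
    finally show ?thesis .
  qed
  have sg_abs: "\<bar>sg x\<bar> \<le> 1" for x
    by (auto simp: sg_def abs_mult abs_sgn_eq)
  have gs_abs: "\<bar>K.g x * sg x\<bar> \<le> 1" for x
    using K.abs_mult_le[OF K.g_abs sg_abs] by simp
  have [measurable]: "sg \<in> borel_measurable ?E"
    unfolding sg_def by measurable
  have gs_int: "integrable ?E (\<lambda>x. K.g x * sg x)"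
    using gs_abs by (intro K.integrable_const_bound[where B=1]) (simp_all del: One_nat_def)
  have "1 / 16 \<le> (\<integral>x. 4 * (K.g x * sg x) \<partial>?E)"
  proof (rule order_trans[OF elliptical_pair_dominance integral_mono])
    have b: "0 \<le> (\<integral>y. dominates x y \<partial>?E)" "(\<integral>y. dominates x y \<partial>?E) \<le> 4" for x
      using ge[of x] gs_abs[of x] by (auto simp: dominates_def abs_le_iff)
    show "integrable ?E (\<lambda>x. \<integral>y. dominates x y \<partial>?E)"
      using b by (intro K.integrable_const_bound[where B=4]) auto
  qed (use gs_int ge in auto)
  then have "1 / 64 \<le> (\<integral>x. K.g x * sg x \<partial>?E)"
    by simp
  then have "(1 / 64)\<^sup>2 \<le> (\<integral>x. K.g x * sg x \<partial>?E)\<^sup>2"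
    by (intro power_mono) auto
  also have "\<dots> \<le> (\<integral>x. (K.g x * sg x)\<^sup>2 \<partial>?E)"
    using gs_abs by (intro K.square_expectation_le[where B=1]) (simp_all del: One_nat_def)
  also have "\<dots> \<le> K.\<kappa>"
    unfolding K.\<kappa>_def
  proof (rule integral_mono)
    show "integrable ?E (\<lambda>x. (K.g x * sg x)\<^sup>2)"
      using gs_abs by (intro K.integrable_const_bound[where B=1]) (simp_all add: abs_square_le_1 del: One_nat_def)
    fix x
    have "(sg x)\<^sup>2 \<le> 1"
      using sg_abs by (simp add: abs_square_le_1)
    then show "(K.g x * sg x)\<^sup>2 \<le> (K.g x)\<^sup>2"
      unfolding power_mult_distrib using mult_left_le[of "(sg x)\<^sup>2" "(K.g x)\<^sup>2"] by simp
  qed (rule K.g_integrable)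
  finally show ?thesis
    using zeta_eq[OF is_law_elliptical_pair, of 0 1] \<mu> by (simp add: power2_eq_square)
qed

end

section \<open>Excluding rank at most two\<close>

lemma orthogonal_to_two_vectors:
  fixes a1 a2 a3 b1 b2 b3 :: real
  obtains c1 c2 c3 where "c1 \<noteq> 0 \<or> c2 \<noteq> 0 \<or> c3 \<noteq> 0"
    "c1 * a1 + c2 * a2 + c3 * a3 = 0" "c1 * b1 + c2 * b2 + c3 * b3 = 0"
proof -
  \<comment> \<open>The cross product works unless it vanishes. Then the vectors are parallel, and a
    relation between the first two coordinates, or the first unit vector, does.\<close>
  consider "a2 * b3 - a3 * b2 \<noteq> 0 \<or> a3 * b1 - a1 * b3 \<noteq> 0 \<or> a1 * b2 - a2 * b1 \<noteq> 0"
    | "a1 = 0" "b1 = 0"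
    | "a2 * b3 - a3 * b2 = 0" "a3 * b1 - a1 * b3 = 0" "a1 * b2 - a2 * b1 = 0" "a1 \<noteq> 0"
    | "a2 * b3 - a3 * b2 = 0" "a3 * b1 - a1 * b3 = 0" "a1 * b2 - a2 * b1 = 0" "a1 = 0" "b1 \<noteq> 0"
    by blast
  then show thesis
  proof cases
    case 1
    then show ?thesis
      by (intro that[of "a2 * b3 - a3 * b2" "a3 * b1 - a1 * b3" "a1 * b2 - a2 * b1"]) (auto simp: algebra_simps)
  next
    case 2
    then show ?thesis by (intro that[of 1 0 0]) auto
  next
    case 3
    then show ?thesis by (intro that[of a2 "- a1" 0]) (auto simp: algebra_simps)
  next
    case 4
    then show ?thesis by (intro that[of b2 "- b1" 0]) (auto simp: algebra_simps)
  qed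
qed

text \<open>Both signs must occur. The third number is either 0, leaving the single product -1, or
  shares a sign with one of the others, giving 1 - 1 - 1.\<close>

lemma sgn_products_of_zero_sum:
  fixes x y z :: real
  assumes "x + y + z = 0" "x \<noteq> 0 \<or> y \<noteq> 0 \<or> z \<noteq> 0"
  shows "sgn x * sgn y + sgn x * sgn z + sgn y * sgn z = -1"
  using assms by (auto simp: sgn_if)

lemma sgn_strict_mono_diff:
  fixes f :: "real \<Rightarrow> real"
  assumes "strict_mono f"
  shows "sgn (f a - f b) = sgn (a - b)"
  using strict_mono_less[OF assms, of a b] strict_mono_less[OF assms, of b a] strict_mono_eq[OF assms, of a b]
  by (cases a b rule: linorder_cases) (auto simp: sgn_if)

context
  fixes d p :: nat and P :: "(nat \<Rightarrow> real) measure" and R :: "real measure"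
    and f :: "nat \<Rightarrow> real \<Rightarrow> real" and A :: "real mat"
  assumes law: "is_law d P" "continuous_marginals d P" and R: "radial_law R"
    and f: "\<And>i. i < d \<Longrightarrow> strict_mono (f i)"
    and eq: "distr P (vec_borel d) (\<lambda>z. \<lambda>i\<in>{..<d}. f i (z i)) =
        distr (R \<Otimes>\<^sub>M sphere_unif p) (vec_borel d) (\<lambda>(r, u). \<lambda>i\<in>{..<d}. r * (\<Sum>k<p. A $$ (i, k) * u k))"
begin

text \<open>The meta-elliptical representation is an equality in law only, so an almost sure
  property is moved through the two image measures. The \<open>f i\<close> are measurable because
  they are monotone.\<close>

lemma AE_transfer:
  assumes Q: "{y \<in> space (vec_borel d). Q y} \<in> sets (vec_borel d)"
  shows "(AE z in P. Q (\<lambda>i\<in>{..<d}. f i (z i))) \<longleftrightarrow>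
    (AE a in R \<Otimes>\<^sub>M sphere_unif p. Q (\<lambda>i\<in>{..<d}. fst a * (\<Sum>k<p. A $$ (i, k) * snd a k)))"
proof -
  have m1: "(\<lambda>z. \<lambda>i\<in>{..<d}. f i (z i)) \<in> measurable P (vec_borel d)"
  proof (rule measurable_restrict)
    fix i assume i: "i \<in> {..<d}"
    have "f i \<in> borel_measurable borel"
      using f[of i] i by (intro borel_measurable_mono strict_mono_mono) auto
    with law_component_measurable[OF law(1)] i show "(\<lambda>z. f i (z i)) \<in> borel_measurable P"
      by (auto intro: measurable_compose)
  qed
  have R_sets: "sets R = sets borel"
    using R by (simp add: radial_law_def)
  have m2: "(\<lambda>a. \<lambda>i\<in>{..<d}. fst a * (\<Sum>k<p. A $$ (i, k) * snd a k)) \<in> measurable (R \<Otimes>\<^sub>M sphere_unif p) (vec_borel d)"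
  proof (intro measurable_restrict borel_measurable_times borel_measurable_sum borel_measurable_const)
    show "fst \<in> borel_measurable (R \<Otimes>\<^sub>M sphere_unif p)"
      using measurable_compose[OF measurable_fst measurable_ident_sets[OF R_sets]] .
    fix k assume "k \<in> {..<p}"
    then show "(\<lambda>a. snd a k) \<in> borel_measurable (R \<Otimes>\<^sub>M sphere_unif p)"
      using measurable_compose[OF measurable_snd sphere_component_measurable] by auto
  qed
  show ?thesis
    unfolding AE_distr_iff[OF m1 Q, symmetric] AE_distr_iff[OF m2 Q, symmetric] eq case_prod_beta' ..
qed

text \<open>An atom of \<xi> at 0 would make the transformed coordinate 0 with positive probability.
  But a strictly increasing function has at most one zero, and the marginal has no atom
  there.\<close>

lemma radial_nonzero:
  assumes "0 < d"
  shows "AE r in R. r \<noteq> 0"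
proof -
  interpret S: prob_space "sphere_unif p"
    by (rule prob_space_sphere_unif)
  have "AE z in P. f 0 (z 0) \<noteq> 0"
  proof (cases "\<exists>a. f 0 a = 0")
    case True
    then obtain a where "f 0 a = 0" by blast
    then show ?thesis
      using continuous_marginals_null[OF law assms, of a] strict_mono_eq[OF f[OF assms]]
      by (auto elim!: eventually_mono) metis
  qed auto
  moreover have "(\<lambda>y. y 0) -` (- {0}) \<inter> space (vec_borel d) \<in> sets (vec_borel d)"
    using assms by (intro measurable_sets[OF measurable_component_singleton]) auto
  then have "{y \<in> space (vec_borel d). y 0 \<noteq> 0} \<in> sets (vec_borel d)"
    by (simp add: vimage_def Int_def conj_commute)
  ultimately have "AE a in R \<Otimes>\<^sub>M sphere_unif p. fst a * (\<Sum>k<p. A $$ (0, k) * snd a k) \<noteq> 0"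
    using AE_transfer[of "\<lambda>y. y 0 \<noteq> 0"] assms by simp
  then have "AE a in R \<Otimes>\<^sub>M sphere_unif p. fst a \<noteq> 0"
    by (rule eventually_mono) auto
  moreover have "{r \<in> space R. r \<noteq> 0} \<in> sets R"
    using R by (auto simp: radial_law_def sets_eq_imp_space_eq[of R borel])
  ultimately have "AE r in distr (R \<Otimes>\<^sub>M sphere_unif p) R fst. r \<noteq> 0"
    by (subst AE_distr_iff) auto
  then show ?thesis
    by (simp only: S.distr_pair_fst)
qed

text \<open>
  Three vectors in a plane satisfy a linear relation, so the differences of the corresponding
  coordinates, multiplied by fixed signs, never all have the same sign.
\<close>

lemma low_rank_dependent_triple:
  assumes p: "p \<le> 2" and i: "i1 < d" "i2 < d" "i3 < d" and n: "2 \<le> n"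
  shows "1 / 3 \<le> \<bar>tau n P i1 i2\<bar> \<or> 1 / 3 \<le> \<bar>tau n P i1 i3\<bar> \<or> 1 / 3 \<le> \<bar>tau n P i2 i3\<bar>"
proof -
  \<comment> \<open>For p < 2 some of these entries lie outside the matrix; below the relations are
    used only for columns k < p.\<close>
  obtain c1 c2 c3 where c: "c1 \<noteq> 0 \<or> c2 \<noteq> 0 \<or> c3 \<noteq> 0"
    "c1 * A $$ (i1, 0) + c2 * A $$ (i2, 0) + c3 * A $$ (i3, 0) = 0"
    "c1 * A $$ (i1, 1) + c2 * A $$ (i2, 1) + c3 * A $$ (i3, 1) = 0"
    by (rule orthogonal_to_two_vectors)
  interpret K12: sym_kernel P "kernel i1 i2" using law(1) i(1,2) by (rule sym_kernel_kernel)
  interpret K13: sym_kernel P "kernel i1 i3" using law(1) i(1,3) by (rule sym_kernel_kernel)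
  interpret K23: sym_kernel P "kernel i2 i3" using law(1) i(2,3) by (rule sym_kernel_kernel)
  let ?F = "\<lambda>x. c1 * f i1 (x i1) + c2 * f i2 (x i2) + c3 * f i3 (x i3)"
  have rel: "AE x in P. ?F x = 0"
  proof -
    have col: "c1 * A $$ (i1, k) + c2 * A $$ (i2, k) + c3 * A $$ (i3, k) = 0" if "k < p" for k
    proof -
      have "k = 0 \<or> k = 1" using that p by linarith
      then show ?thesis using c by auto
    qed
    have "c1 * (r * (\<Sum>k<p. A $$ (i1, k) * u k)) + c2 * (r * (\<Sum>k<p. A $$ (i2, k) * u k)) + c3 * (r * (\<Sum>k<p. A $$ (i3, k) * u k))
        = r * (\<Sum>k<p. (c1 * A $$ (i1, k) + c2 * A $$ (i2, k) + c3 * A $$ (i3, k)) * u k)" for r and u :: "nat \<Rightarrow> real"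
      by (simp add: sum_distrib_left sum.distrib algebra_simps)
    then have zero: "c1 * (r * (\<Sum>k<p. A $$ (i1, k) * u k)) + c2 * (r * (\<Sum>k<p. A $$ (i2, k) * u k)) + c3 * (r * (\<Sum>k<p. A $$ (i3, k) * u k)) = 0" for r and u :: "nat \<Rightarrow> real"
      using col by simp
    have comp: "(\<lambda>y. y k) \<in> borel_measurable (vec_borel d)" if "k < d" for k
      using that by (intro measurable_component_singleton) auto
    have "(\<lambda>y. c1 * y i1 + c2 * y i2 + c3 * y i3) \<in> borel_measurable (vec_borel d)"
      using i by (intro borel_measurable_add borel_measurable_times borel_measurable_const comp)
    from measurable_sets[OF this, of "{0}"]
    have "{y \<in> space (vec_borel d). c1 * y i1 + c2 * y i2 + c3 * y i3 = 0} \<in> sets (vec_borel d)"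
      by (simp add: vimage_def Int_def conj_commute)
    from AE_transfer[OF this] show ?thesis
      using i zero by simp
  qed
  define e1 e2 e3 where "e1 = sgn c1" and "e2 = sgn c2" and "e3 = sgn c3"
  let ?h = "\<lambda>x y. e1 * e2 * kernel i1 i2 x y + e1 * e3 * kernel i1 i3 x y + e2 * e3 * kernel i2 i3 x y"
  have inner: "e1 * e2 * K12.g x + e1 * e3 * K13.g x + e2 * e3 * K23.g x = -1" if x: "?F x = 0" "x \<in> space P" for x
  proof -
    \<comment> \<open>The three weighted increments sum to 0. Since some weight is nonzero and
      \<open>x\<close> and \<open>y\<close> almost surely differ in each of the three coordinates,
      they do not all vanish.\<close>
    have "AE y in P. ?h x y = -1"
      using rel continuous_marginals_null[OF law i(1), of "x i1"] continuous_marginals_null[OF law i(2), of "x i2"]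
        continuous_marginals_null[OF law i(3), of "x i3"]
    proof eventually_elim
      case (elim y)
      let ?t1 = "c1 * (f i1 (x i1) - f i1 (y i1))" and ?t2 = "c2 * (f i2 (x i2) - f i2 (y i2))"
        and ?t3 = "c3 * (f i3 (x i3) - f i3 (y i3))"
      have "?t1 + ?t2 + ?t3 = ?F x - ?F y"
        by (simp add: algebra_simps)
      also have "\<dots> = 0"
        using x elim by simp
      finally have "sgn ?t1 * sgn ?t2 + sgn ?t1 * sgn ?t3 + sgn ?t2 * sgn ?t3 = -1"
      proof (rule sgn_products_of_zero_sum)
        show "?t1 \<noteq> 0 \<or> ?t2 \<noteq> 0 \<or> ?t3 \<noteq> 0"
          using c(1) elim strict_mono_eq[OF f[OF i(1)]] strict_mono_eq[OF f[OF i(2)]] strict_mono_eq[OF f[OF i(3)]]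
          by auto
      qed
      then show ?case
        by (simp add: sgn_mult sgn_strict_mono_diff f i kernel_def e1_def e2_def e3_def mult_ac)
    qed
    then have "(\<integral>y. ?h x y \<partial>P) = (\<integral>y. -1 \<partial>P)"
      using x(2) by (intro integral_cong_AE) auto
    then show ?thesis
      using K12.H_integrable[OF x(2)] K13.H_integrable[OF x(2)] K23.H_integrable[OF x(2)]
      by (simp add: K12.g_def K13.g_def K23.g_def K12.prob_space)
  qed
  have "(\<integral>x. e1 * e2 * K12.g x + e1 * e3 * K13.g x + e2 * e3 * K23.g x \<partial>P) = (\<integral>x. -1 \<partial>P)"
  proof (rule integral_cong_AE)
    show "AE x in P. e1 * e2 * K12.g x + e1 * e3 * K13.g x + e2 * e3 * K23.g x = -1"
      using rel AE_space by eventually_elim (rule inner)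
  qed auto
  then have sum: "e1 * e2 * K12.\<mu> + e1 * e3 * K13.\<mu> + e2 * e3 * K23.\<mu> = -1"
    using K12.g_integrable(1) K13.g_integrable(1) K23.g_integrable(1)
    by (simp add: K12.\<mu>_def K13.\<mu>_def K23.\<mu>_def K12.prob_space)
  have e: "\<bar>a * b * t\<bar> \<le> \<bar>t\<bar>" if "a \<in> {e1, e2, e3}" "b \<in> {e1, e2, e3}" for a b t
    using that by (auto simp: e1_def e2_def e3_def abs_mult abs_sgn_eq)
  \<comment> \<open>Three values with weights in {-1, 0, 1} sum to -1, so one of them is at least
    1/3 in modulus.\<close>
  have "1 \<le> \<bar>K12.\<mu>\<bar> + \<bar>K13.\<mu>\<bar> + \<bar>K23.\<mu>\<bar>"
    using sum e[of e1 e2 K12.\<mu>] e[of e1 e3 K13.\<mu>] e[of e2 e3 K23.\<mu>] by auto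
  then show ?thesis
    unfolding tau_eq[OF law(1) i(1,2) n] tau_eq[OF law(1) i(1,3) n] tau_eq[OF law(1) i(2,3) n] by linarith
qed

end

lemma card_less_obtain:
  assumes "finite B" "card B < d"
  obtains j where "j < d" "j \<notin> B"
proof -
  have "\<not> {..<d} \<subseteq> B"
    using assms card_mono[of B "{..<d}"] by auto
  then show thesis using that by auto
qed

text \<open>Greedy choice, excluding at most s + 2 t indices. Besides the earlier supports, i2 has
  to avoid \<Gamma>, so that its own support is small when i3 is chosen.\<close>

lemma sparse_independent_triple:
  assumes sp: "sparse_dependence \<alpha>0 s t n1 n2 d P Q" and d: "s + 2 * \<bar>t\<bar> < real d"
  obtains i1 i2 i3 where "i1 < d" "i2 < d" "i3 < d"
    "i2 \<notin> supp \<alpha>0 n1 n2 d P Q i1" "i3 \<notin> supp \<alpha>0 n1 n2 d P Q i1" "i3 \<notin> supp \<alpha>0 n1 n2 d P Q i2"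
proof -
  let ?S = "supp \<alpha>0 n1 n2 d P Q"
  obtain \<Gamma> where \<Gamma>: "\<Gamma> \<subseteq> {..<d}" "real (card \<Gamma>) \<le> s"
      "\<And>j. j < d \<Longrightarrow> j \<notin> \<Gamma> \<Longrightarrow> real (card (?S j)) \<le> t"
    using sp unfolding sparse_dependence_def by auto
  have fin: "finite \<Gamma>" "finite (?S j)" for j
    using finite_subset[OF \<Gamma>(1)] by (auto simp: supp_def)
  have "card \<Gamma> < d"
    using \<Gamma>(2) d by linarith
  then obtain i1 where i1: "i1 < d" "i1 \<notin> \<Gamma>"
    using card_less_obtain[of \<Gamma> d] fin by auto
  \<comment> \<open>As an upper bound for a cardinality \<open>t\<close> is nonnegative, so the
    absolute value in the assumption is \<open>t\<close> itself.\<close>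
  have t: "0 \<le> t"
    using \<Gamma>(3)[OF i1] of_nat_0_le_iff order_trans by blast
  have "card (\<Gamma> \<union> ?S i1) \<le> card \<Gamma> + card (?S i1)"
    by (rule card_Un_le)
  then have "card (\<Gamma> \<union> ?S i1) < d"
    using \<Gamma>(2) \<Gamma>(3)[OF i1] d t by linarith
  then obtain i2 where i2: "i2 < d" "i2 \<notin> \<Gamma> \<union> ?S i1"
    using card_less_obtain[of "\<Gamma> \<union> ?S i1" d] fin by auto
  have "card (\<Gamma> \<union> ?S i1 \<union> ?S i2) \<le> card \<Gamma> + card (?S i1) + card (?S i2)"
    by (intro order_trans[OF card_Un_le] add_mono card_Un_le order_refl)
  then have "card (\<Gamma> \<union> ?S i1 \<union> ?S i2) < d"
    using \<Gamma>(2) \<Gamma>(3)[OF i1] \<Gamma>(3)[of i2] i2 d by auto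
  then obtain i3 where i3: "i3 < d" "i3 \<notin> \<Gamma> \<union> ?S i1 \<union> ?S i2"
    using card_less_obtain[of "\<Gamma> \<union> ?S i1 \<union> ?S i2" d] fin by auto
  show thesis
    using that[of i1 i2 i3] i1 i2 i3 by auto
qed


text \<open>One triple with small tau forces p \<ge> 3; then 4 \<zeta> \<ge> 4 / 4096 = 1 /
  1024.\<close>

lemma sigma_ps_square_ge:
  assumes meta: "meta_elliptical d P p R" and n: "2 \<le> n"
    and i: "i1 < d" "i2 < d" "i3 < d"
    and small: "\<bar>tau n P i1 i2\<bar> < 1 / 3" "\<bar>tau n P i1 i3\<bar> < 1 / 3" "\<bar>tau n P i2 i3\<bar> < 1 / 3"
  shows "1 / 1024 \<le> (sigma_ps p R)\<^sup>2"
proof -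
  have law: "is_law d P" "continuous_marginals d P" and R: "radial_law R"
    using meta by (auto simp: meta_elliptical_def)
  obtain f :: "nat \<Rightarrow> real \<Rightarrow> real" and A :: "real mat" where fA: "\<And>i. i < d \<Longrightarrow> strict_mono (f i)"
    "distr P (vec_borel d) (\<lambda>z. \<lambda>i\<in>{..<d}. f i (z i)) =
        distr (R \<Otimes>\<^sub>M sphere_unif p) (vec_borel d) (\<lambda>(r, u). \<lambda>i\<in>{..<d}. r * (\<Sum>k<p. A $$ (i, k) * u k))"
    using meta unfolding meta_elliptical_def by blast
  have "\<not> p \<le> 2"
  proof
    assume "p \<le> 2"
    from low_rank_dependent_triple[OF law R fA this i n] show False
      using small by linarith
  qed
  then have p: "3 \<le> p" by simp
  have R0: "AE r in R. r \<noteq> 0"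
    using radial_nonzero[OF law R fA] i by simp
  show ?thesis
    using sigma_ps_square[OF is_law_elliptical_pair[OF R R0 p]] zeta_elliptical_pair_ge[OF R R0 p] by simp
qed

section \<open>Power bounds at fixed sample sizes and dimension\<close>

lemma Max_ge_obtain:
  fixes F :: "nat \<times> nat \<Rightarrow> real"
  assumes "2 \<le> d" "c \<le> Max (F ` index_pairs d)"
  obtains i j where "(i, j) \<in> index_pairs d" "c \<le> F (i, j)"
  using assms finite_index_pairs[of d] index_pairs_nonempty[of d] by (auto simp: Max_ge_iff)

lemma gap_of_ratio:
  fixes D :: real
  assumes "C * sqrt L \<le> \<bar>D\<bar> / sqrt v" "0 < v"
  shows "C * sqrt L * sqrt v \<le> \<bar>D\<bar>"
  using assms by (simp add: pos_le_divide_eq)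

text \<open>Common to jackknife and plug-in. The natural v is the sum of the 4 \<zeta> / n_a, so v
  n_a \<ge> 4 r_a, and the window [2 \<zeta>, 6 \<zeta>] for n V makes the denominator positive and
  at most 3 v / 2.\<close>

lemma rejection_prob_variance_estimator_ge:
  fixes V :: "nat \<Rightarrow> (nat \<Rightarrow> nat \<Rightarrow> real) \<Rightarrow> nat \<Rightarrow> nat \<Rightarrow> real"
  assumes V_meas: "\<And>P n i j. is_law d P \<Longrightarrow> i < d \<Longrightarrow> j < d \<Longrightarrow> 4 \<le> n \<Longrightarrow>
      (\<lambda>x. V n x i j) \<in> borel_measurable (iid n P)"
    and V_dev: "\<And>P n i j r. admissible d r P \<Longrightarrow> (i, j) \<in> index_pairs d \<Longrightarrow> 0 < r \<Longrightarrow> 4 \<le> n \<Longrightarrow> 64 \<le> r * real n \<Longrightarrow>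
      measure (iid n P) {x \<in> space (iid n P). \<not> (2 * zeta P i j \<le> real n * V n x i j \<and>
        real n * V n x i j \<le> 6 * zeta P i j)} \<le> 240000 / (real n * r\<^sup>2)"
    and adm: "admissible d r1 P" "admissible d r2 Q" and U: "in_U 4 n1 n2 d P Q"
    and r: "0 < r1" "0 < r2" and n: "4 \<le> n1" "4 \<le> n2" "64 \<le> r1 * real n1" "64 \<le> r2 * real n2"
    and d: "2 \<le> d" and L: "G_inv \<alpha> \<le> 2 * ln (real d) + ln (ln (real d))"
  shows "1 - (144 / (4 * r1 * ln (real d)) + 144 / (4 * r2 * ln (real d)) +
      (240000 / (real n1 * r1\<^sup>2) + 240000 / (real n2 * r2\<^sup>2)))
    \<le> rejection_prob \<alpha> n1 n2 d (\<lambda>(x, y). max_stat n1 n2 d (\<lambda>i j. V n1 x i j + V n2 y i j) (x, y)) P Q"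
proof -
  have law: "is_law d P" "is_law d Q"
    using adm by (auto simp: admissible_def)
  let ?T = "two_sample n1 n2 P Q"
  interpret T: prob_space ?T
    using law by (rule prob_space_two_sample)
  obtain i j where ij: "(i, j) \<in> index_pairs d"
    and ratio: "4 * sqrt (ln (real d)) \<le> \<bar>tau n1 P i j - tau n2 Q i j\<bar> /
             sqrt (4 * zeta P i j / real n1 + 4 * zeta Q i j / real n2)"
    using Max_ge_obtain[OF d, of "4 * sqrt (ln (real d))" "\<lambda>(i, j). \<bar>tau n1 P i j - tau n2 Q i j\<bar> /
             sqrt (4 * zeta P i j / real n1 + 4 * zeta Q i j / real n2)"] U unfolding in_U_def by auto
  have ijd: "i < d" "j < d"
    using ij by (auto simp: index_pairs_def)
  have z: "r1 < zeta P i j" "r2 < zeta Q i j"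
    using adm ij by (auto simp: admissible_def)
  define v where "v = 4 * zeta P i j / real n1 + 4 * zeta Q i j / real n2"
  have zpos: "0 < zeta P i j / real n1" "0 < zeta Q i j / real n2"
    using z r n by auto
  have v: "0 < v"
    unfolding v_def using zpos by simp
  have Vm: "(\<lambda>\<omega>. V n1 (fst \<omega>) k l) \<in> borel_measurable ?T" "(\<lambda>\<omega>. V n2 (snd \<omega>) k l) \<in> borel_measurable ?T"
    if "k < d" "l < d" for k l
    unfolding two_sample_def
    using measurable_compose[OF measurable_fst V_meas[OF law(1) that n(1)]]
      measurable_compose[OF measurable_snd V_meas[OF law(2) that n(2)]] by auto
  show ?thesis
  proof (rule rejection_prob_ge[OF law _ _ _ ij _ L v])
    show "0 < ln (real d)"
      using d by simp
    show "4 * sqrt (ln (real d)) * sqrt v \<le> \<bar>tau n1 P i j - tau n2 Q i j\<bar>"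
      using ratio v unfolding v_def by (rule gap_of_ratio)
    have "4 * r1 \<le> 4 * zeta P i j / real n1 * real n1"
      using z n by simp
    also have "\<dots> \<le> v * real n1"
      unfolding v_def using zpos by (intro mult_right_mono) auto
    finally show "4 * r1 \<le> v * real n1" .
    have "4 * r2 \<le> 4 * zeta Q i j / real n2 * real n2"
      using z n by simp
    also have "\<dots> \<le> v * real n2"
      unfolding v_def using zpos by (intro mult_right_mono) auto
    finally show "4 * r2 \<le> v * real n2" .
    show "(\<lambda>\<omega>. V n1 (fst \<omega>) k l + V n2 (snd \<omega>) k l) \<in> borel_measurable ?T" if "(k, l) \<in> index_pairs d" for k l
      using that Vm[of k l] by (auto simp: index_pairs_def)
    define A where "A = {x \<in> space (iid n1 P). \<not> (2 * zeta P i j \<le> real n1 * V n1 x i j \<and> real n1 * V n1 x i j \<le> 6 * zeta P i j)}"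
    define B where "B = {x \<in> space (iid n2 Q). \<not> (2 * zeta Q i j \<le> real n2 * V n2 x i j \<and> real n2 * V n2 x i j \<le> 6 * zeta Q i j)}"
    note [measurable] = V_meas[OF law(1) ijd n(1)] V_meas[OF law(2) ijd n(2)]
    have AB: "A \<in> sets (iid n1 P)" "B \<in> sets (iid n2 Q)"
      unfolding A_def B_def by measurable
    let ?A = "{\<omega> \<in> space ?T. fst \<omega> \<in> A}" and ?B = "{\<omega> \<in> space ?T. snd \<omega> \<in> B}"
    have AB': "?A \<in> sets ?T" "?B \<in> sets ?T"
      using AB by (auto simp: two_sample_def intro!: measurable_sets_Collect[OF measurable_fst] measurable_sets_Collect[OF measurable_snd])
    have "{\<omega> \<in> space ?T. \<not> (0 < V n1 (fst \<omega>) i j + V n2 (snd \<omega>) i j \<and> V n1 (fst \<omega>) i j + V n2 (snd \<omega>) i j \<le> 3 / 2 * v)}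
        \<subseteq> ?A \<union> ?B"
    proof (rule subsetI, rule ccontr)
      fix \<omega>
      assume \<omega>: "\<omega> \<in> {\<omega> \<in> space ?T. \<not> (0 < V n1 (fst \<omega>) i j + V n2 (snd \<omega>) i j \<and> V n1 (fst \<omega>) i j + V n2 (snd \<omega>) i j \<le> 3 / 2 * v)}"
        and "\<omega> \<notin> ?A \<union> ?B"
      then have "2 * zeta P i j \<le> real n1 * V n1 (fst \<omega>) i j" "real n1 * V n1 (fst \<omega>) i j \<le> 6 * zeta P i j"
        "2 * zeta Q i j \<le> real n2 * V n2 (snd \<omega>) i j" "real n2 * V n2 (snd \<omega>) i j \<le> 6 * zeta Q i j"
        by (auto simp: A_def B_def two_sample_def space_pair_measure)
      then have "2 * zeta P i j / real n1 \<le> V n1 (fst \<omega>) i j" "V n1 (fst \<omega>) i j \<le> 6 * zeta P i j / real n1"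
        "2 * zeta Q i j / real n2 \<le> V n2 (snd \<omega>) i j" "V n2 (snd \<omega>) i j \<le> 6 * zeta Q i j / real n2"
        using n by (auto simp: divide_le_eq le_divide_eq mult.commute)
      then have "0 < V n1 (fst \<omega>) i j + V n2 (snd \<omega>) i j" "V n1 (fst \<omega>) i j + V n2 (snd \<omega>) i j \<le> 3 / 2 * v"
        using zpos unfolding v_def by auto
      then show False using \<omega> by simp
    qed
    then have "T.prob {\<omega> \<in> space ?T. \<not> (0 < V n1 (fst \<omega>) i j + V n2 (snd \<omega>) i j \<and> V n1 (fst \<omega>) i j + V n2 (snd \<omega>) i j \<le> 3 / 2 * v)}
        \<le> T.prob (?A \<union> ?B)"
      using AB' by (intro T.finite_measure_mono) auto
    also have "\<dots> \<le> T.prob ?A + T.prob ?B"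
      using AB' by (intro measure_Un_le)
    also have "\<dots> = measure (iid n1 P) A + measure (iid n2 Q) B"
      using AB measure_pair_rectangles[OF prob_space_iid[OF law(1)] prob_space_iid[OF law(2)]]
      unfolding two_sample_def by simp
    also have "\<dots> \<le> 240000 / (real n1 * r1\<^sup>2) + 240000 / (real n2 * r2\<^sup>2)"
      unfolding A_def B_def using adm ij r n by (intro add_mono V_dev) auto
    finally show "T.prob {\<omega> \<in> space ?T. \<not> (0 < V n1 (fst \<omega>) i j + V n2 (snd \<omega>) i j \<and> V n1 (fst \<omega>) i j + V n2 (snd \<omega>) i j \<le> 3 / 2 * v)}
        \<le> 240000 / (real n1 * r1\<^sup>2) + 240000 / (real n2 * r2\<^sup>2)" .
  qed (use n r in auto)
qed

text \<open>The denominator is deterministic and equal to v, so it contributes no error term, and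
  the lower bound for \<open>sigma_ps\<close> gives v n_a \<ge> 1 / 1024.\<close>

lemma rejection_prob_ps_ge:
  assumes law: "is_law d P" "is_law d Q"
    and \<sigma>: "1 / 1024 \<le> (sigma_ps p1 R1)\<^sup>2" "1 / 1024 \<le> (sigma_ps p2 R2)\<^sup>2"
    and V: "in_V 4 n1 n2 d P p1 R1 Q p2 R2"
    and n: "2 \<le> n1" "2 \<le> n2" and d: "2 \<le> d" and L: "G_inv \<alpha> \<le> 2 * ln (real d) + ln (ln (real d))"
  shows "1 - (144 / (1 / 1024 * ln (real d)) + 144 / (1 / 1024 * ln (real d)) + 0)
    \<le> rejection_prob \<alpha> n1 n2 d (M_ps n1 n2 d p1 R1 p2 R2) P Q"
proof -
  define v where "v = (sigma_ps p1 R1)\<^sup>2 / real n1 + (sigma_ps p2 R2)\<^sup>2 / real n2"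
  have pos: "0 < (sigma_ps p1 R1)\<^sup>2 / real n1" "0 < (sigma_ps p2 R2)\<^sup>2 / real n2"
    using \<sigma> n by (auto intro!: divide_pos_pos simp del: zero_less_power2 intro: less_le_trans[of 0 "1 / 1024"])
  have v: "0 < v" "v \<noteq> 0" "v \<le> 3 / 2 * v"
    using pos unfolding v_def by auto
  obtain i j where ij: "(i, j) \<in> index_pairs d"
    and ratio: "4 * sqrt (ln (real d)) \<le> \<bar>tau n1 P i j - tau n2 Q i j\<bar> / sqrt v"
    using Max_ge_obtain[OF d, of "4 * sqrt (ln (real d))" "\<lambda>(i, j). \<bar>tau n1 P i j - tau n2 Q i j\<bar> / sqrt v"]
      V unfolding in_V_def v_def by auto
  have M: "M_ps n1 n2 d p1 R1 p2 R2 = (\<lambda>(x, y). max_stat n1 n2 d (\<lambda>i j. v) (x, y))"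
    unfolding M_ps_def v_def by auto
  show ?thesis
    unfolding M
  proof (rule rejection_prob_ge[OF law n _ ij _ L v(1)])
    show "0 < ln (real d)"
      using d by simp
    show "4 * sqrt (ln (real d)) * sqrt v \<le> \<bar>tau n1 P i j - tau n2 Q i j\<bar>"
      using ratio v(1) by (rule gap_of_ratio)
    have "1 / 1024 \<le> (sigma_ps p1 R1)\<^sup>2 / real n1 * real n1"
      using \<sigma> n by simp
    also have "\<dots> \<le> v * real n1"
      unfolding v_def using pos by (intro mult_right_mono) auto
    finally show "1 / 1024 \<le> v * real n1" .
    have "1 / 1024 \<le> (sigma_ps p2 R2)\<^sup>2 / real n2 * real n2"
      using \<sigma> n by simp
    also have "\<dots> \<le> v * real n2"
      unfolding v_def using pos by (intro mult_right_mono) auto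
    finally show "1 / 1024 \<le> v * real n2" .
    have "{\<omega> \<in> space (two_sample n1 n2 P Q). \<not> (0 < v \<and> v \<le> 3 / 2 * v)} = {}"
      using v by auto
    then show "measure (two_sample n1 n2 P Q) {\<omega> \<in> space (two_sample n1 n2 P Q). \<not> (0 < v \<and> v \<le> 3 / 2 * v)} \<le> 0"
      by (simp only: measure_empty)
  qed auto
qed

lemma filterlim_at_top_of_bigo:
  fixes f g :: "nat \<Rightarrow> nat"
  assumes "filterlim f at_top sequentially" "(\<lambda>m. real (f m)) \<in> O(\<lambda>m. real (g m))"
  shows "filterlim (\<lambda>m. real (g m)) at_top sequentially"
proof -
  obtain c where c: "c > 0" "eventually (\<lambda>m. norm (real (f m)) \<le> c * norm (real (g m))) sequentially"
    using assms(2) by (auto elim: landau_o.bigE)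
  have "filterlim (\<lambda>m. real (f m) / c) at_top sequentially"
    using filterlim_compose[OF filterlim_real_sequentially assms(1)] c(1)
    by (simp add: divide_inverse filterlim_at_top_mult_tendsto_pos[OF tendsto_const])
  moreover have "eventually (\<lambda>m. real (f m) / c \<le> real (g m)) sequentially"
    using c(2) by eventually_elim (use c(1) in \<open>simp add: divide_le_eq mult.commute\<close>)
  ultimately show ?thesis
    by (rule filterlim_at_top_mono)
qed


subsection \<open>Asymptotic power\<close>

theorem theorem3p4:
  fixes \<alpha> \<epsilon> r1 r2 :: real and n1 n2 d n :: "nat \<Rightarrow> nat"
  assumes alpha: "0 < \<alpha>" "\<alpha> < 1"
    and n_def: "\<And>m. n m = max (n1 m) (n2 m)"
    and n_lim: "filterlim n at_top sequentially"
    and d_lim: "filterlim d at_top sequentially"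
    and balanced: "(\<lambda>m. real (n1 m)) \<in> \<Theta>(\<lambda>m. real (n2 m))"
                  "(\<lambda>m. real (n2 m)) \<in> \<Theta>(\<lambda>m. real (n m))"
    and eps: "0 < \<epsilon>" "\<epsilon> < 1 / 3"
    and growth: "(\<lambda>m. ln (real (d m))) \<in> O(\<lambda>m. real (n m) powr (1 / 3 - \<epsilon>))"
    and r_pos: "0 < r1" "0 < r2"
  shows
    "(\<lambda>m. inf_prob {rejection_prob \<alpha> (n1 m) (n2 m) (d m) (M_jack (n1 m) (n2 m) (d m)) P Q | P Q.
            admissible (d m) r1 P \<and> admissible (d m) r2 Q \<and>
            in_U 4 (n1 m) (n2 m) (d m) P Q}) \<longlonglongrightarrow> 1
     \<and>
     (\<lambda>m. inf_prob {rejection_prob \<alpha> (n1 m) (n2 m) (d m) (M_plug (n1 m) (n2 m) (d m)) P Q | P Q.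
            admissible (d m) r1 P \<and> admissible (d m) r2 Q \<and>
            in_U 4 (n1 m) (n2 m) (d m) P Q}) \<longlonglongrightarrow> 1
     \<and>
     (\<forall>(\<alpha>0 :: real) (s :: nat \<Rightarrow> real) (t :: nat \<Rightarrow> real).
        \<alpha>0 > 0 \<longrightarrow>
        s \<in> o(\<lambda>m. real (d m)) \<longrightarrow>
        (\<forall>\<gamma>>0. t \<in> o(\<lambda>m. real (d m) powr \<gamma>)) \<longrightarrow>
        (\<lambda>m. inf_prob {rejection_prob \<alpha> (n1 m) (n2 m) (d m)
                         (M_ps (n1 m) (n2 m) (d m) p1 R1 p2 R2) P Q | P p1 R1 Q p2 R2.
               admissible (d m) r1 P \<and> admissible (d m) r2 Q \<and>
               meta_elliptical (d m) P p1 R1 \<and> meta_elliptical (d m) Q p2 R2 \<and>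
               sparse_dependence \<alpha>0 (s m) (t m) (n1 m) (n2 m) (d m) P Q \<and>
               in_V 4 (n1 m) (n2 m) (d m) P p1 R1 Q p2 R2}) \<longlonglongrightarrow> 1)"
proof -
  let ?L = "\<lambda>m. ln (real (d m))"
  \<comment> \<open>Only the maximum of the sample sizes is assumed to tend to infinity; balance
    carries this over to both.\<close>
  have n2_n: "(\<lambda>m. real (n m)) \<in> O(\<lambda>m. real (n2 m))"
    using balanced(2) by (auto simp: bigtheta_def bigomega_iff_bigo)
  have n2: "filterlim (\<lambda>m. real (n2 m)) at_top sequentially"
    using n_lim n2_n by (rule filterlim_at_top_of_bigo)
  have "(\<lambda>m. real (n2 m)) \<in> O(\<lambda>m. real (n1 m))"
    using balanced(1) by (auto simp: bigtheta_def bigomega_iff_bigo)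
  then have "(\<lambda>m. real (n m)) \<in> O(\<lambda>m. real (n1 m))"
    using n2_n landau_o.big_trans by blast
  with n_lim have n1: "filterlim (\<lambda>m. real (n1 m)) at_top sequentially"
    by (rule filterlim_at_top_of_bigo)
  have d_real: "filterlim (\<lambda>m. real (d m)) at_top sequentially"
    by (rule filterlim_compose[OF filterlim_real_sequentially d_lim])
  have L: "filterlim ?L at_top sequentially"
    by (rule filterlim_compose[OF ln_at_top d_real])
  have L0: "(\<lambda>m. c / (b * ?L m)) \<longlonglongrightarrow> 0" if "0 < b" for b c :: real
    by (rule real_tendsto_divide_at_top[OF tendsto_const filterlim_tendsto_pos_mult_at_top[OF tendsto_const that L]])
  have n0: "(\<lambda>m. c / (k m * b)) \<longlonglongrightarrow> 0" if "0 < b" "filterlim k at_top sequentially" for b c and k :: "nat \<Rightarrow> real"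
    by (rule real_tendsto_divide_at_top[OF tendsto_const filterlim_at_top_mult_tendsto_pos[OF tendsto_const that]])
  have d2: "eventually (\<lambda>m. 2 \<le> d m) sequentially"
    using d_lim by (auto simp: filterlim_at_top)
  have large: "eventually (\<lambda>m. c \<le> k m) sequentially" if "filterlim k at_top sequentially" for c and k :: "nat \<Rightarrow> real"
    using that by (auto simp: filterlim_at_top)
  have critical: "eventually (\<lambda>m. G_inv \<alpha> \<le> 2 * ?L m + ln (?L m)) sequentially"
    using large[OF L, of 1] large[OF L, of "G_inv \<alpha>"]
  proof eventually_elim
    case (elim m)
    then have "0 \<le> ln (?L m)" by simp
    with elim show ?case by linarith
  qed
  have rn: "eventually (\<lambda>m. 4 \<le> k m) sequentially" "eventually (\<lambda>m. 64 \<le> r * real (k m)) sequentially"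
    if "filterlim (\<lambda>m. real (k m)) at_top sequentially" "0 < r" for r :: real and k :: "nat \<Rightarrow> nat"
  proof -
    show "eventually (\<lambda>m. 4 \<le> k m) sequentially"
      using large[OF that(1), of 4] by eventually_elim simp
    show "eventually (\<lambda>m. 64 \<le> r * real (k m)) sequentially"
      using large[OF that(1), of "64 / r"] by eventually_elim (use that in \<open>simp add: divide_le_eq mult.commute\<close>)
  qed
  let ?e = "\<lambda>m. 144 / (4 * r1 * ?L m) + 144 / (4 * r2 * ?L m) +
      (240000 / (real (n1 m) * r1\<^sup>2) + 240000 / (real (n2 m) * r2\<^sup>2))"
  have "?e \<longlonglongrightarrow> 0 + 0 + (0 + 0)"
    using r_pos n1 n2 by (intro tendsto_add L0 n0) auto
  then have e: "?e \<longlonglongrightarrow> 0" by simp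
  have e0: "eventually (\<lambda>m. 0 \<le> ?e m) sequentially"
    using d2 by eventually_elim (use r_pos in \<open>auto intro!: add_nonneg_nonneg divide_nonneg_nonneg\<close>)
  have estimated: "(\<lambda>m. inf_prob {rejection_prob \<alpha> (n1 m) (n2 m) (d m)
        (\<lambda>(x, y). max_stat (n1 m) (n2 m) (d m) (\<lambda>i j. V (n1 m) x i j + V (n2 m) y i j) (x, y)) P Q | P Q.
          admissible (d m) r1 P \<and> admissible (d m) r2 Q \<and> in_U 4 (n1 m) (n2 m) (d m) P Q}) \<longlonglongrightarrow> 1"
    if V_meas: "\<And>P d n i j. is_law d P \<Longrightarrow> i < d \<Longrightarrow> j < d \<Longrightarrow> 4 \<le> n \<Longrightarrow>
        (\<lambda>x. V n x i j) \<in> borel_measurable (iid n P)"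
      and V_dev: "\<And>P d n i j r. admissible d r P \<Longrightarrow> (i, j) \<in> index_pairs d \<Longrightarrow> 0 < r \<Longrightarrow> 4 \<le> n \<Longrightarrow> 64 \<le> r * real n \<Longrightarrow>
        measure (iid n P) {x \<in> space (iid n P). \<not> (2 * zeta P i j \<le> real n * V n x i j \<and>
          real n * V n x i j \<le> 6 * zeta P i j)} \<le> 240000 / (real n * r\<^sup>2)"
    for V :: "nat \<Rightarrow> (nat \<Rightarrow> nat \<Rightarrow> real) \<Rightarrow> nat \<Rightarrow> nat \<Rightarrow> real"
    using e e0
  proof (rule inf_prob_tendsto_1)
    show "eventually (\<lambda>m. \<forall>x\<in>{rejection_prob \<alpha> (n1 m) (n2 m) (d m)
        (\<lambda>(x, y). max_stat (n1 m) (n2 m) (d m) (\<lambda>i j. V (n1 m) x i j + V (n2 m) y i j) (x, y)) P Q | P Q.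
          admissible (d m) r1 P \<and> admissible (d m) r2 Q \<and> in_U 4 (n1 m) (n2 m) (d m) P Q}. 1 - ?e m \<le> x) sequentially"
      using rn[OF n1 r_pos(1)] rn[OF n2 r_pos(2)] d2 critical
    proof eventually_elim
      case (elim m)
      have "1 - ?e m \<le> rejection_prob \<alpha> (n1 m) (n2 m) (d m)
          (\<lambda>(x, y). max_stat (n1 m) (n2 m) (d m) (\<lambda>i j. V (n1 m) x i j + V (n2 m) y i j) (x, y)) P Q"
        if "admissible (d m) r1 P" "admissible (d m) r2 Q" "in_U 4 (n1 m) (n2 m) (d m) P Q" for P Q
        by (rule rejection_prob_variance_estimator_ge[OF V_meas V_dev that r_pos elim(1,3,2,4,5,6)])
      then show ?case
        by blast
    qed
  qed
  have idx: "i < d'" "j < d'" if "(i, j) \<in> index_pairs d'" for i j d'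
    using that by (auto simp: index_pairs_def)
  have jack: "(\<lambda>m. inf_prob {rejection_prob \<alpha> (n1 m) (n2 m) (d m) (M_jack (n1 m) (n2 m) (d m)) P Q | P Q.
            admissible (d m) r1 P \<and> admissible (d m) r2 Q \<and>
            in_U 4 (n1 m) (n2 m) (d m) P Q}) \<longlonglongrightarrow> 1"
    unfolding M_jack_def
  proof (rule estimated)
    fix P :: "(nat \<Rightarrow> real) measure" and d n i j :: nat and r :: real
    assume a: "admissible d r P" "(i, j) \<in> index_pairs d" "0 < r" "4 \<le> n" "64 \<le> r * real n"
    show "measure (iid n P) {x \<in> space (iid n P). \<not> (2 * zeta P i j \<le> real n * var_jack n x i j \<and>
          real n * var_jack n x i j \<le> 6 * zeta P i j)} \<le> 240000 / (real n * r\<^sup>2)"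
      using a idx[OF a(2)] by (intro var_jack_deviation[of d]) (auto simp: admissible_def)
  qed (rule var_jack_measurable; simp)
  have plug: "(\<lambda>m. inf_prob {rejection_prob \<alpha> (n1 m) (n2 m) (d m) (M_plug (n1 m) (n2 m) (d m)) P Q | P Q.
            admissible (d m) r1 P \<and> admissible (d m) r2 Q \<and>
            in_U 4 (n1 m) (n2 m) (d m) P Q}) \<longlonglongrightarrow> 1"
    unfolding M_plug_def
  proof (rule estimated)
    fix P :: "(nat \<Rightarrow> real) measure" and d n i j :: nat and r :: real
    assume a: "admissible d r P" "(i, j) \<in> index_pairs d" "0 < r" "4 \<le> n" "64 \<le> r * real n"
    show "measure (iid n P) {x \<in> space (iid n P). \<not> (2 * zeta P i j \<le> real n * var_plug n x i j \<and>
          real n * var_plug n x i j \<le> 6 * zeta P i j)} \<le> 240000 / (real n * r\<^sup>2)"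
      using a idx[OF a(2)] by (intro var_plug_deviation[of d]) (auto simp: admissible_def)
  qed (rule var_plug_measurable; simp)
  have ps: "(\<lambda>m. inf_prob {rejection_prob \<alpha> (n1 m) (n2 m) (d m)
                         (M_ps (n1 m) (n2 m) (d m) p1 R1 p2 R2) P Q | P p1 R1 Q p2 R2.
               admissible (d m) r1 P \<and> admissible (d m) r2 Q \<and>
               meta_elliptical (d m) P p1 R1 \<and> meta_elliptical (d m) Q p2 R2 \<and>
               sparse_dependence \<alpha>0 (s m) (t m) (n1 m) (n2 m) (d m) P Q \<and>
               in_V 4 (n1 m) (n2 m) (d m) P p1 R1 Q p2 R2}) \<longlonglongrightarrow> 1"
    if \<alpha>0: "0 < \<alpha>0" and s: "s \<in> o(\<lambda>m. real (d m))" and t: "\<forall>\<gamma>>0. t \<in> o(\<lambda>m. real (d m) powr \<gamma>)"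
    for \<alpha>0 :: real and s t :: "nat \<Rightarrow> real"
  proof -
    let ?f = "\<lambda>m. 144 / (1 / 1024 * ?L m) + 144 / (1 / 1024 * ?L m) + 0"
    have "?f \<longlonglongrightarrow> 0 + 0 + 0"
      by (intro tendsto_add L0 tendsto_const) auto
    then have f: "?f \<longlonglongrightarrow> 0" by simp
    have f0: "eventually (\<lambda>m. 0 \<le> ?f m) sequentially"
      using d2 by eventually_elim auto
    \<comment> \<open>With \<gamma> = 1 both bounds are eventually at most d / 4, so s + 2
      \<bar>t\<bar> \<le> 3 d / 4 leaves room for the triple.\<close>
    have t1: "t \<in> o(\<lambda>m. real (d m) powr 1)"
      by (rule t[rule_format]) simp
    have quarter: "(0::real) < 1 / 4"
      by simp
    have small: "eventually (\<lambda>m. s m + 2 * \<bar>t m\<bar> < real (d m)) sequentially"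
      using landau_o.smallD[OF s quarter] landau_o.smallD[OF t1 quarter] d2
    proof eventually_elim
      case (elim m)
      then have "\<bar>s m\<bar> \<le> real (d m) / 4" "\<bar>t m\<bar> \<le> real (d m) / 4" "2 \<le> real (d m)"
        by auto
      then show ?case by linarith
    qed
    have "((\<lambda>x. x powr (- 1 - \<alpha>0)) \<longlongrightarrow> 0) at_top"
      using \<alpha>0 by (intro tendsto_neg_powr filterlim_ident) auto
    then have "(\<lambda>m. ?L m powr (- 1 - \<alpha>0)) \<longlonglongrightarrow> 0"
      by (rule filterlim_compose[OF _ L])
    \<comment> \<open>Outside the supports \<bar>\<tau>\<bar> is below this threshold, hence
      eventually below the 1/3 that rank at most two would force.\<close>
    then have threshold: "eventually (\<lambda>m. ?L m powr (- 1 - \<alpha>0) < 1 / 3) sequentially"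
      by (rule order_tendstoD) simp
    have bound: "1 - ?f m \<le> rejection_prob \<alpha> (n1 m) (n2 m) (d m) (M_ps (n1 m) (n2 m) (d m) p1 R1 p2 R2) P Q"
      if m: "s m + 2 * \<bar>t m\<bar> < real (d m)" "?L m powr (- 1 - \<alpha>0) < 1 / 3" "2 \<le> d m" "4 \<le> n1 m" "4 \<le> n2 m"
          "G_inv \<alpha> \<le> 2 * ?L m + ln (?L m)"
        and meta: "meta_elliptical (d m) P p1 R1" "meta_elliptical (d m) Q p2 R2"
        and sp: "sparse_dependence \<alpha>0 (s m) (t m) (n1 m) (n2 m) (d m) P Q"
        and V: "in_V 4 (n1 m) (n2 m) (d m) P p1 R1 Q p2 R2"
      for m P p1 R1 Q p2 R2
    proof -
      obtain i1 i2 i3 where i: "i1 < d m" "i2 < d m" "i3 < d m"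
        and ind: "i2 \<notin> supp \<alpha>0 (n1 m) (n2 m) (d m) P Q i1" "i3 \<notin> supp \<alpha>0 (n1 m) (n2 m) (d m) P Q i1"
          "i3 \<notin> supp \<alpha>0 (n1 m) (n2 m) (d m) P Q i2"
        using sparse_independent_triple[OF sp m(1)] .
      \<comment> \<open>In \<open>supp\<close> the member is the first index of tau, so the triple
        is passed in the order i3, i2, i1 to match.\<close>
      have "1 / 1024 \<le> (sigma_ps p1 R1)\<^sup>2"
        using meta(1) m ind i by (intro sigma_ps_square_ge[of "d m" P p1 R1 "n1 m" i3 i2 i1]) (auto simp: supp_def)
      moreover have "1 / 1024 \<le> (sigma_ps p2 R2)\<^sup>2"
        using meta(2) m ind i by (intro sigma_ps_square_ge[of "d m" Q p2 R2 "n2 m" i3 i2 i1]) (auto simp: supp_def)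
      ultimately show ?thesis
        using meta V m by (intro rejection_prob_ps_ge) (auto simp: meta_elliptical_def)
    qed
    from f f0 show ?thesis
    proof (rule inf_prob_tendsto_1)
      show "eventually (\<lambda>m. \<forall>x\<in>{rejection_prob \<alpha> (n1 m) (n2 m) (d m)
                         (M_ps (n1 m) (n2 m) (d m) p1 R1 p2 R2) P Q | P p1 R1 Q p2 R2.
               admissible (d m) r1 P \<and> admissible (d m) r2 Q \<and>
               meta_elliptical (d m) P p1 R1 \<and> meta_elliptical (d m) Q p2 R2 \<and>
               sparse_dependence \<alpha>0 (s m) (t m) (n1 m) (n2 m) (d m) P Q \<and>
               in_V 4 (n1 m) (n2 m) (d m) P p1 R1 Q p2 R2}. 1 - ?f m \<le> x) sequentially"
        using small threshold d2 rn(1)[OF n1 r_pos(1)] rn(1)[OF n2 r_pos(2)] critical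
      proof eventually_elim
        case (elim m)
        then show ?case
          using bound[of m] by blast
      qed
    qed
  qed
  show ?thesis
    using jack plug ps by blast
qed

end
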